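(* Let $X$ be a locally compact Hausdorff space and let $\mathcal{A}=C_0(X)$, a commutative C$^*$-algebra. The following are equivalent: (1) $X$ is scattered; (2) for every ultrafilter $\mathcal{U}$ and every bounded linear map $K:\mathcal{A}''\rightarrow(\mathcal{A})_{\mathcal{U}}$ such that $\sigma_{\mathcal{U}}\circ K$ is the identity on $\mathcal{A}''$ and $K\circ\kappa_{\mathcal{A}}$ is the canonical map $\mathcal{A}\rightarrow(\mathcal{A})_{\mathcal{U}}$, one has $\sigma_{\mathcal{U}}(K(\Phi)K(\Psi))=\Phi\,\Box\,\Psi$ for all $\Phi,\Psi\in\mathcal{A}''$.
   Context: A topological space is scattered if every non-empty subset contains an isolated point (isolated in the relative topology of that subset). $E'$ denotes the dual of a Banach space $E$, $\langle\mu,x\rangle=\mu(x)$, and $\kappa_E:E\rightarrow E''$ is the canonical embedding. Ultrapowers: for a non-principal ultrafilter $\mathcal{U}$ on a set $I$, $(E)_{\mathcal{U}}=\ell^\infty(E,I)/\mathcal{N}_{\mathcal{U}}$, where $\ell^\infty(E,I)$ is the space of bounded families $(x_i)_{i\in I}$ in $E$ with the supremum norm and $\mathcal{N}_{\mathcal{U}}=\{(x_i):\lim_{i\rightarrow\mathcal{U}}\|x_i\|=0\}$; the quotient norm is $\lim_{i\rightarrow\mathcal{U}}\|x_i\|$. The class of $(x_i)$ is again written $(x_i)$. The canonical map $E\rightarrow(E)_{\mathcal{U}}$ sends $x$ to the constant family $(x)$. All ultrafilters are assumed countably incomplete (some countable subfamily of $\mathcal{U}$ has intersection not in $\mathcal{U}$).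 For a Banach algebra $\mathcal{A}$, $(\mathcal{A})_{\mathcal{U}}$ is a Banach algebra under the pointwise product. The map $\sigma_{\mathcal{U}}:(E)_{\mathcal{U}}\rightarrow E''$ is given by $\langle\sigma_{\mathcal{U}}((x_i)),\mu\rangle=\lim_{i\rightarrow\mathcal{U}}\langle\mu,x_i\rangle$ for $\mu\in E'$. First Arens product on $\mathcal{A}''$: for $a,b\in\mathcal{A}$, $\mu\in\mathcal{A}'$, $\Phi,\Psi\in\mathcal{A}''$, put $\langle\mu\cdot a,b\rangle=\langle\mu,ab\rangle$, $\langle\Phi\cdot\mu,a\rangle=\langle\Phi,\mu\cdot a\rangle$, $\langle\Phi\,\Box\,\Psi,\mu\rangle=\langle\Phi,\Psi\cdot\mu\rangle$. (C$^*$-algebras are Arens regular, so this equals the second Arens product.) *)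

theory Defs
  imports "HOL-Analysis.Analysis"
begin

section \<open>Topology\<close>

definition scattered_space :: "'a topology \<Rightarrow> bool" where
  "scattered_space X \<longleftrightarrow>
     (\<forall>S. S \<subseteq> topspace X \<and> S \<noteq> {} \<longrightarrow> (\<exists>x\<in>S. openin (subtopology X S) {x}))"

section \<open>Complex normed spaces with explicit carriers\<close>

text \<open>
  Duals of complex spaces and ultrapowers depending on an ultrafilter are not available as types,
  so complex normed spaces and algebras are records of a carrier and operations. Elements that
  are functions on a carrier (functionals, families, members of \<open>C\<^sub>0(X)\<close>) are kept
  extensional (\<^term>\<open>undefined\<close> off their domain), so that equality of elements is HOL equality.
\<close>

record 'a normed_space =
  vecs :: "'a set"
  vadd :: "'a \<Rightarrow> 'a \<Rightarrow> 'a"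
  vscale :: "complex \<Rightarrow> 'a \<Rightarrow> 'a"
  vnorm :: "'a \<Rightarrow> real"

record 'a normed_alg = "'a normed_space" +
  vmult :: "'a \<Rightarrow> 'a \<Rightarrow> 'a"

definition scalars :: "complex normed_space" where
  "scalars = \<lparr>vecs = UNIV, vadd = (+), vscale = (*), vnorm = cmod\<rparr>"

definition bounded_linear_map ::
  "('a, 'm) normed_space_scheme \<Rightarrow> ('b, 'n) normed_space_scheme \<Rightarrow> ('a \<Rightarrow> 'b) \<Rightarrow> bool" where
  "bounded_linear_map E F T \<longleftrightarrow>
     (\<forall>x\<in>vecs E. T x \<in> vecs F) \<and>
     (\<forall>x\<in>vecs E. \<forall>y\<in>vecs E. T (vadd E x y) = vadd F (T x) (T y)) \<and>
     (\<forall>c. \<forall>x\<in>vecs E. T (vscale E c x) = vscale F c (T x)) \<and>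
     (\<exists>B. \<forall>x\<in>vecs E. vnorm F (T x) \<le> B * vnorm E x)"

definition dual :: "('a, 'm) normed_space_scheme \<Rightarrow> ('a \<Rightarrow> complex) normed_space" where
  "dual E = \<lparr>vecs = {\<mu> \<in> extensional (vecs E). bounded_linear_map E scalars \<mu>},
             vadd = (\<lambda>\<mu> \<nu>. \<lambda>x\<in>vecs E. \<mu> x + \<nu> x),
             vscale = (\<lambda>c \<mu>. \<lambda>x\<in>vecs E. c * \<mu> x),
             vnorm = (\<lambda>\<mu>. SUP x\<in>{x \<in> vecs E. vnorm E x \<le> 1}. cmod (\<mu> x))\<rparr>"

abbreviation bidual ::
  "('a, 'm) normed_space_scheme \<Rightarrow> (('a \<Rightarrow> complex) \<Rightarrow> complex) normed_space" where
  "bidual E \<equiv> dual (dual E)"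

definition canonical_embedding ::
  "('a, 'm) normed_space_scheme \<Rightarrow> 'a \<Rightarrow> ('a \<Rightarrow> complex) \<Rightarrow> complex" where
  "canonical_embedding E x = (\<lambda>\<mu>\<in>vecs (dual E). \<mu> x)"

section \<open>The algebra of continuous functions vanishing at infinity\<close>

text \<open>The \<open>insert 0\<close> only matters for the empty space, where it makes the norm zero.\<close>

definition C0 :: "'a topology \<Rightarrow> ('a \<Rightarrow> complex) normed_alg" where
  "C0 X = \<lparr>vecs = {f \<in> extensional (topspace X). continuous_map X euclidean f \<and>
                     (\<forall>e>0. \<exists>C. compactin X C \<and> (\<forall>x\<in>topspace X - C. cmod (f x) < e))},
           vadd = (\<lambda>f g. \<lambda>x\<in>topspace X. f x + g x),
           vscale = (\<lambda>c f. \<lambda>x\<in>topspace X. c * f x),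
           vnorm = (\<lambda>f. Sup (insert 0 ((\<lambda>x. cmod (f x)) ` topspace X))),
           vmult = (\<lambda>f g. \<lambda>x\<in>topspace X. f x * g x)\<rparr>"

section \<open>First Arens product\<close>

definition dual_act ::
  "('a, 'm) normed_alg_scheme \<Rightarrow> ('a \<Rightarrow> complex) \<Rightarrow> 'a \<Rightarrow> ('a \<Rightarrow> complex)" where
  "dual_act A \<mu> a = (\<lambda>b\<in>vecs A. \<mu> (vmult A a b))"

definition bidual_act ::
  "('a, 'm) normed_alg_scheme \<Rightarrow> (('a \<Rightarrow> complex) \<Rightarrow> complex) \<Rightarrow> ('a \<Rightarrow> complex) \<Rightarrow> ('a \<Rightarrow> complex)" where
  "bidual_act A \<Phi> \<mu> = (\<lambda>a\<in>vecs A. \<Phi> (dual_act A \<mu> a))"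

definition arens ::
  "('a, 'm) normed_alg_scheme \<Rightarrow> (('a \<Rightarrow> complex) \<Rightarrow> complex) \<Rightarrow> (('a \<Rightarrow> complex) \<Rightarrow> complex)
     \<Rightarrow> (('a \<Rightarrow> complex) \<Rightarrow> complex)" where
  "arens A \<Phi> \<Psi> = (\<lambda>\<mu>\<in>vecs (dual A). \<Phi> (bidual_act A \<Psi> \<mu>))"

section \<open>Ultrafilters and ultrapowers\<close>

text \<open>
  An ultrafilter on a set \<open>I\<close> is represented by the filter on the ambient type that it generates:
  a set \<open>S \<subseteq> I\<close> is a member iff \<open>eventually (\<lambda>i. i \<in> S) U\<close>. The last conjunct below is
  countable incompleteness.
\<close>

definition admissible_ultrafilter :: "'i set \<Rightarrow> 'i filter \<Rightarrow> bool" where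
  "admissible_ultrafilter I U \<longleftrightarrow>
     eventually (\<lambda>i. i \<in> I) U \<and> U \<noteq> bot \<and>
     (\<forall>P. eventually P U \<or> eventually (\<lambda>i. \<not> P i) U) \<and>
     (\<forall>j\<in>I. \<not> eventually (\<lambda>i. i = j) U) \<and>
     (\<exists>\<C>. countable \<C> \<and> (\<forall>S\<in>\<C>. eventually (\<lambda>i. i \<in> S) U) \<and> \<not> eventually (\<lambda>i. i \<in> \<Inter>\<C>) U)"

definition linf :: "('a, 'm) normed_space_scheme \<Rightarrow> 'i set \<Rightarrow> ('i \<Rightarrow> 'a) normed_space" where
  "linf E I = \<lparr>vecs = {x \<in> I \<rightarrow>\<^sub>E vecs E. bdd_above ((\<lambda>i. vnorm E (x i)) ` I)},
               vadd = (\<lambda>x y. \<lambda>i\<in>I. vadd E (x i) (y i)),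
               vscale = (\<lambda>c x. \<lambda>i\<in>I. vscale E c (x i)),
               vnorm = (\<lambda>x. SUP i\<in>I. vnorm E (x i))\<rparr>"

definition null_families ::
  "('a, 'm) normed_space_scheme \<Rightarrow> 'i set \<Rightarrow> 'i filter \<Rightarrow> ('i \<Rightarrow> 'a) set" where
  "null_families E I U = {x \<in> vecs (linf E I). ((\<lambda>i. vnorm E (x i)) \<longlongrightarrow> 0) U}"

definition ultra_rel ::
  "('a, 'm) normed_space_scheme \<Rightarrow> 'i set \<Rightarrow> 'i filter \<Rightarrow> (('i \<Rightarrow> 'a) \<times> ('i \<Rightarrow> 'a)) set" where
  "ultra_rel E I U = {(x, y). x \<in> vecs (linf E I) \<and> y \<in> vecs (linf E I) \<and>
     vadd (linf E I) x (vscale (linf E I) (-1) y) \<in> null_families E I U}"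

definition ultra_class ::
  "('a, 'm) normed_space_scheme \<Rightarrow> 'i set \<Rightarrow> 'i filter \<Rightarrow> ('i \<Rightarrow> 'a) \<Rightarrow> ('i \<Rightarrow> 'a) set" where
  "ultra_class E I U x = ultra_rel E I U `` {x}"

text \<open>
  The operations on classes are those induced from representatives; the norm is the quotient norm,
  i.e. the infimum of the supremum norms of the representatives.
\<close>

definition ultrapower ::
  "('a, 'm) normed_space_scheme \<Rightarrow> 'i set \<Rightarrow> 'i filter \<Rightarrow> ('i \<Rightarrow> 'a) set normed_space" where
  "ultrapower E I U =
     \<lparr>vecs = vecs (linf E I) // ultra_rel E I U,
      vadd = (\<lambda>p q. \<Union>x\<in>p. \<Union>y\<in>q. ultra_class E I U (vadd (linf E I) x y)),
      vscale = (\<lambda>c p. \<Union>x\<in>p. ultra_class E I U (vscale (linf E I) c x)),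
      vnorm = (\<lambda>p. INF x\<in>p. vnorm (linf E I) x)\<rparr>"

definition ultra_mult ::
  "('a, 'm) normed_alg_scheme \<Rightarrow> 'i set \<Rightarrow> 'i filter \<Rightarrow> ('i \<Rightarrow> 'a) set \<Rightarrow> ('i \<Rightarrow> 'a) set
     \<Rightarrow> ('i \<Rightarrow> 'a) set" where
  "ultra_mult A I U p q =
     (\<Union>x\<in>p. \<Union>y\<in>q. ultra_class A I U (\<lambda>i\<in>I. vmult A (x i) (y i)))"

definition ultra_const ::
  "('a, 'm) normed_space_scheme \<Rightarrow> 'i set \<Rightarrow> 'i filter \<Rightarrow> 'a \<Rightarrow> ('i \<Rightarrow> 'a) set" where
  "ultra_const E I U a = ultra_class E I U (\<lambda>i\<in>I. a)"

text \<open>The limit is the same for all representatives of a class, whence the definite description.\<close>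

definition ultra_sigma ::
  "('a, 'm) normed_space_scheme \<Rightarrow> 'i set \<Rightarrow> 'i filter \<Rightarrow> ('i \<Rightarrow> 'a) set
     \<Rightarrow> (('a \<Rightarrow> complex) \<Rightarrow> complex)" where
  "ultra_sigma E I U p =
     (\<lambda>\<mu>\<in>vecs (dual E). THE l. \<forall>x\<in>p. ((\<lambda>i. \<mu> (x i)) \<longlongrightarrow> l) U)"

section \<open>Index sets\<close>

text \<open>
  HOL cannot quantify over index sets of all types inside a formula. In the theorem the index sets
  are the subsets of a type \<open>'i + 'a lr_index\<close> with \<open>'i\<close> arbitrary, so up to bijection every set
  occurs for some \<open>'i\<close>. The summand below makes sure that for each \<open>'i\<close> the index sets
  of the principle of local reflexivity for \<open>C0 X\<close> occur: triples of a finite subset of the bidual,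
  a finite subset of the dual and a tolerance \<open>1/n\<close>. (For a small index type there may be no
  ultrafilter or no lifting \<open>K\<close> at all, so that a condition on all liftings would be vacuous.)
\<close>

type_synonym 'a lr_index =
  "((('a \<Rightarrow> complex) \<Rightarrow> complex) \<Rightarrow> complex) set \<times> (('a \<Rightarrow> complex) \<Rightarrow> complex) set \<times> nat"

end

theory Submission
  imports Defs
begin

text \<open>
  If \<open>X\<close> is scattered, every functional on \<open>C\<^sub>0(X)\<close> is a norm limit of finite combinations of point
  evaluations: the open sets on which this holds are closed under unions, and an isolated point of
  the complement could be added. For a point evaluation at \<open>x\<close> both \<open>\<Phi> \<box> \<Psi>\<close> and the weak* limit of the
  products are \<open>\<Phi> (dirac x) * \<Psi> (dirac x)\<close>.

  If \<open>X\<close> is not scattered, a local reflexivity principle gives operators \<open>T\<^sub>i\<close> of the form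
  \<open>\<Phi> \<mapsto> \<Sum>\<^sub>k \<Phi>(\<nu>\<^sub>k) f\<^sub>k\<close> with a partition of unity \<open>f\<^sub>k\<close>, which define a lifting. It may be perturbed to
  \<open>T\<^sub>i + s \<theta> r\<^sub>i\<close>, where \<open>\<theta>\<close> is a nonzero functional on the bidual that vanishes on \<open>C\<^sub>0(X)\<close>, and \<open>r\<^sub>i\<close> is a
  bounded weakly null net whose squares are not weakly null; it comes from a Cantor scheme. For
  \<open>s = -1, 0, 1\<close> these liftings cannot all satisfy the product formula, since
  \<open>(u + r)\<^sup>2 + (u - r)\<^sup>2 - 2 u\<^sup>2 = 2 r\<^sup>2\<close>.
\<close>

section \<open>Ultrafilters\<close>

text \<open>Functionals are never represented by measures; they are handled through their values on
  the unit ball and through sums over functions whose moduli add up to at most 1. The obstacle is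
  that finitely many complex functionals come with no common positive measure on which to condition.
  One is made by a variational argument: at a vector \<open>a\<close> of functions where the
  functionals nearly attain their norm on functions with Euclidean values, first-order optimality
  gives each \<mu> the approximate density \<open>cnj (a \<mu>)\<close> with respect to a nearly
  positive \<rho>. Conditioning \<rho> on the cells of a partition of unity gives the \<nu>_k. Their
  norms are only kept below 2, which is enough because a lifting need only be bounded. That \<theta>
  vanishes on C0(X) keeps the second lifting condition under the perturbation, and that r_i is
  weakly null keeps the first; products still see r_i through its square. Three values of s are used
  because neither the weak* limit of the u * u nor that of the u * r is known: the second difference
  in s removes both.\<close>

definition ultra :: "'i filter \<Rightarrow> bool" where
  "ultra U \<longleftrightarrow> U \<noteq> bot \<and> (\<forall>P. eventually P U \<or> eventually (\<lambda>i. \<not> P i) U)"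

text \<open>Zorn's lemma for the proper filters below \<open>F\<close>, with the order reversed
  because a smaller filter contains more sets.\<close>

lemma ultra_exists:
  fixes F :: "'i filter"
  assumes "F \<noteq> bot"
  obtains U where "ultra U" "U \<le> F"
proof -
  let ?A = "{G. G \<noteq> bot \<and> G \<le> F}"
  have po: "partial_order_on ?A (relation_of (\<lambda>G H. H \<le> G) ?A)"
    by (rule partial_order_on_relation_ofI) auto
  have "\<exists>m\<in>?A. \<forall>a\<in>?A. a \<le> m \<longrightarrow> a = m"
  proof (rule predicate_Zorn[OF po])
    fix C assume C: "C \<in> Chains (relation_of (\<lambda>G H. H \<le> G) ?A)"
    show "\<exists>u\<in>?A. \<forall>a\<in>C. u \<le> a"
    proof (cases "C = {}")
      case True
      with assms show ?thesis by auto
    next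
      case False
      from C have tot: "\<And>a b. a \<in> C \<Longrightarrow> b \<in> C \<Longrightarrow> a \<le> b \<or> b \<le> a"
        and sub: "C \<subseteq> ?A"
        by (auto simp: Chains_def relation_of_def)
      \<comment> \<open>Members of a chain are comparable, so no finite meets have to be formed: a
        set lies in the infimum iff it lies in some member, and the infimum stays proper.\<close>
      have ev: "eventually P (Inf C) \<longleftrightarrow> (\<exists>b\<in>C. eventually P b)" for P
        using False tot by (intro eventually_Inf_base) (metis le_inf_iff order_refl)+
      have "Inf C \<noteq> bot"
        using sub unfolding trivial_limit_def ev by (auto simp: trivial_limit_def)
      moreover have "Inf C \<le> F"
      proof -
        obtain G where "G \<in> C" using False by auto
        then have "Inf C \<le> G" "G \<le> F" using sub by (auto intro: Inf_lower)
        then show ?thesis by (rule order_trans)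
      qed
      ultimately show ?thesis by (auto intro: Inf_lower)
    qed
  qed
  then obtain U where U: "U \<noteq> bot" "U \<le> F" and max: "\<And>a. a \<noteq> bot \<Longrightarrow> a \<le> U \<Longrightarrow> a = U"
    by (auto intro: order_trans)
  have "eventually P U \<or> eventually (\<lambda>i. \<not> P i) U" for P
  proof (rule disjCI)
    assume *: "\<not> eventually (\<lambda>i. \<not> P i) U"
    \<comment> \<open>Adjoining \<open>P\<close> keeps the filter proper because the complement of
      \<open>P\<close> is not in \<open>U\<close>; by the choice of \<open>U\<close> nothing new was
      adjoined.\<close>
    let ?V = "inf U (principal {i. P i})"
    have "?V \<noteq> bot"
      using * by (auto simp: trivial_limit_def eventually_inf_principal)
    then have "?V = U" using max by simp
    moreover have "eventually P ?V" by (simp add: eventually_inf_principal)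
    ultimately show "eventually P U" by simp
  qed
  with U that show ?thesis by (auto simp: ultra_def)
qed

text \<open>A cluster point along an ultrafilter is a limit: a neighbourhood that is not eventually
  entered is eventually avoided.\<close>

lemma ultra_tendsto_compact:
  fixes f :: "'i \<Rightarrow> 'b::topological_space"
  assumes "ultra U" "compact K" "eventually (\<lambda>i. f i \<in> K) U"
  obtains l where "l \<in> K" "(f \<longlongrightarrow> l) U"
proof -
  have "filtermap f U \<noteq> bot"
    using assms by (auto simp: ultra_def filtermap_bot_iff)
  moreover have "eventually (\<lambda>x. x \<in> K) (filtermap f U)"
    using assms(3) by (simp add: eventually_filtermap)
  ultimately obtain l where l: "l \<in> K" "inf (nhds l) (filtermap f U) \<noteq> bot"
    using \<open>compact K\<close> unfolding compact_filter by blast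
  have "eventually (\<lambda>i. f i \<in> S) U" if "open S" "l \<in> S" for S
  proof (rule ccontr)
    assume "\<not> ?thesis"
    then have "eventually (\<lambda>i. f i \<notin> S) U"
      using assms(1) unfolding ultra_def by blast
    then have "eventually (\<lambda>x. x \<notin> S) (filtermap f U)"
      by (simp add: eventually_filtermap)
    moreover have "eventually (\<lambda>x. x \<in> S) (nhds l)"
      using that by (simp add: eventually_nhds_in_open)
    ultimately have "eventually (\<lambda>x. False) (inf (nhds l) (filtermap f U))"
      unfolding eventually_inf by blast
    with l show False by simp
  qed
  then have "(f \<longlongrightarrow> l) U" by (simp add: tendsto_def)
  with l that show ?thesis by blast
qed

text \<open>Makes \<open>Lim U\<close> a generalised limit on bounded nets. The functionals that are
  obtained by compactness in \<open>Cantor_scheme\<close> and \<open>exists_jump_functional\<close>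
  are such limits.\<close>

lemma ultra_bounded_tendsto_Lim:
  fixes f :: "'i \<Rightarrow> 'b::heine_borel"
  assumes "ultra U" "eventually (\<lambda>i. dist a (f i) \<le> B) U"
  shows "(f \<longlongrightarrow> Lim U f) U"
proof -
  obtain l where "(f \<longlongrightarrow> l) U"
    using ultra_tendsto_compact[OF assms(1) compact_cball[of a B], of f] assms(2) by auto
  moreover have "U \<noteq> bot" using assms(1) by (simp add: ultra_def)
  ultimately show ?thesis using tendsto_Lim by blast
qed

section \<open>Functions vanishing at infinity and their functionals\<close>

locale lch_space =
  fixes X :: "'a topology"
  assumes locally_compact: "locally_compact_space X"
    and Hausdorff: "Hausdorff_space X"
begin

abbreviation "CX \<equiv> vecs (C0 X)"
abbreviation "MX \<equiv> vecs (dual (C0 X))"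
abbreviation "BX \<equiv> vecs (bidual (C0 X))"
abbreviation "mnorm \<equiv> vnorm (dual (C0 X))"
abbreviation "bnorm \<equiv> vnorm (bidual (C0 X))"

text \<open>Unlike the members of \<open>CX\<close>, the functions in \<open>c0\<close> need not be extensional, and \<open>ev\<close>
  applies functionals to them; so functions can be written as plain \<open>\<lambda>\<close>-terms.\<close>

definition c0 :: "('a \<Rightarrow> complex) \<Rightarrow> bool" where
  "c0 f \<longleftrightarrow> continuous_map X euclidean f \<and>
     (\<forall>e>0. \<exists>C. compactin X C \<and> (\<forall>x\<in>topspace X - C. cmod (f x) < e))"

definition ev :: "(('a \<Rightarrow> complex) \<Rightarrow> complex) \<Rightarrow> ('a \<Rightarrow> complex) \<Rightarrow> complex" where
  "ev \<mu> f = \<mu> (restrict f (topspace X))"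

definition unit_ball :: "('a \<Rightarrow> complex) \<Rightarrow> bool" where
  "unit_ball f \<longleftrightarrow> c0 f \<and> (\<forall>x\<in>topspace X. cmod (f x) \<le> 1)"

lemma c0_continuous: "c0 f \<Longrightarrow> continuous_map X euclidean f"
  by (simp add: c0_def)

lemma c0_cong: "(\<And>x. x \<in> topspace X \<Longrightarrow> f x = g x) \<Longrightarrow> c0 f \<longleftrightarrow> c0 g"
  unfolding c0_def by (intro conj_cong) (auto intro: continuous_map_eq)

lemma c0_restrict [simp]: "c0 (restrict f (topspace X)) \<longleftrightarrow> c0 f"
  by (rule c0_cong) simp

lemma CX_iff: "f \<in> CX \<longleftrightarrow> f \<in> extensional (topspace X) \<and> c0 f"
  unfolding C0_def normed_space.select_convs c0_def by blast

lemma restrict_CX [simp]: "restrict f (topspace X) \<in> CX \<longleftrightarrow> c0 f"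
  by (simp add: CX_iff)

lemma CX_c0: "f \<in> CX \<Longrightarrow> c0 f"
  by (simp add: CX_iff)

lemma CX_restrict [simp]: "f \<in> CX \<Longrightarrow> restrict f (topspace X) = f"
  by (simp add: CX_iff extensional_restrict)

lemma ev_CX [simp]: "f \<in> CX \<Longrightarrow> ev \<mu> f = \<mu> f"
  by (simp add: ev_def)

lemma ev_cong: "(\<And>x. x \<in> topspace X \<Longrightarrow> f x = g x) \<Longrightarrow> ev \<mu> f = ev \<mu> g"
  unfolding ev_def by (metis restrict_ext)

lemma c0_bounded:
  assumes "c0 f"
  obtains B where "B > 0" "\<And>x. x \<in> topspace X \<Longrightarrow> cmod (f x) \<le> B"
proof -
  obtain C where C: "compactin X C" "\<forall>x\<in>topspace X - C. cmod (f x) < 1"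
    using assms unfolding c0_def by (auto elim!: allE[of _ 1])
  have "compact (f ` C)"
    using image_compactin[OF C(1) c0_continuous[OF assms]] by simp
  then obtain B where "\<And>y. y \<in> f ` C \<Longrightarrow> cmod y \<le> B"
    by (meson compact_imp_bounded bounded_iff)
  then have "cmod (f x) \<le> max B 1" if "x \<in> topspace X" for x
    using C(2) that by (cases "x \<in> C") (force simp: max_def)+
  then show ?thesis using that[of "max B 1"] by simp
qed

lemma c0_dominated:
  assumes f: "c0 f" and g: "continuous_map X euclidean g"
    and le: "\<And>x. x \<in> topspace X \<Longrightarrow> cmod (g x) \<le> B * cmod (f x)"
  shows "c0 g"
  unfolding c0_def
proof (intro conjI allI impI g)
  fix e :: real assume e: "e > 0"
  then have "e / (\<bar>B\<bar> + 1) > 0" by simp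
  then obtain C where C: "compactin X C" "\<forall>x\<in>topspace X - C. cmod (f x) < e / (\<bar>B\<bar> + 1)"
    using f unfolding c0_def by blast
  have "cmod (g x) < e" if "x \<in> topspace X - C" for x
  proof -
    have "cmod (g x) \<le> (\<bar>B\<bar> + 1) * cmod (f x)"
      using le[of x] that by (smt (verit) DiffD1 mult_right_mono norm_ge_zero)
    also have "\<dots> < e"
      using C(2) that by (auto simp: field_simps)
    finally show ?thesis .
  qed
  with C show "\<exists>C. compactin X C \<and> (\<forall>x\<in>topspace X - C. cmod (g x) < e)" by blast
qed

lemma c0_zero [simp, intro]: "c0 (\<lambda>x. 0)"
  unfolding c0_def by (auto intro: exI[of _ "{}"])

lemma c0_add [intro]:
  assumes "c0 f" "c0 g"
  shows "c0 (\<lambda>x. f x + g x)"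
  unfolding c0_def
proof (intro conjI allI impI)
  show "continuous_map X euclidean (\<lambda>x. f x + g x)"
    using assms by (intro continuous_map_add c0_continuous)
  fix e :: real assume "e > 0"
  then obtain C D where "compactin X C" "\<forall>x\<in>topspace X - C. cmod (f x) < e/2"
    and "compactin X D" "\<forall>x\<in>topspace X - D. cmod (g x) < e/2"
    using half_gt_zero[of e] assms unfolding c0_def by blast
  then have "compactin X (C \<union> D)" "\<forall>x\<in>topspace X - (C \<union> D). cmod (f x + g x) < e"
    by (auto intro: compactin_Un intro!: norm_add_less[of _ "e/2" _ "e/2", simplified])
  then show "\<exists>C. compactin X C \<and> (\<forall>x\<in>topspace X - C. cmod (f x + g x) < e)" by blast
qed

lemma continuous_map_complex_mult:
  fixes f g :: "'a \<Rightarrow> complex"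
  shows "continuous_map X euclidean f \<Longrightarrow> continuous_map X euclidean g \<Longrightarrow>
    continuous_map X euclidean (\<lambda>x. f x * g x)"
  by (simp add: continuous_map_atin tendsto_mult)

lemma continuous_map_cnj:
  "continuous_map X euclidean f \<Longrightarrow> continuous_map X euclidean (\<lambda>x. cnj (f x))"
  by (simp add: continuous_map_atin tendsto_cnj)

lemma c0_mult_bounded:
  assumes "c0 f" "continuous_map X euclidean g" "\<And>x. x \<in> topspace X \<Longrightarrow> cmod (g x) \<le> B"
  shows "c0 (\<lambda>x. f x * g x)"
  using assms c0_continuous[OF assms(1)]
  by (intro c0_dominated[OF assms(1), of _ B] continuous_map_complex_mult)
     (auto simp: norm_mult mult.commute[of B] intro: mult_left_mono)

lemma c0_scale [intro]: "c0 f \<Longrightarrow> c0 (\<lambda>x. c * f x)"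
  using c0_mult_bounded[of f "\<lambda>x. c" "cmod c"] by (simp add: mult.commute)

lemma c0_mult [intro]: "c0 f \<Longrightarrow> c0 g \<Longrightarrow> c0 (\<lambda>x. f x * g x)"
  using c0_mult_bounded c0_continuous c0_bounded by metis

lemma c0_cnj [intro]: "c0 f \<Longrightarrow> c0 (\<lambda>x. cnj (f x))"
  using c0_dominated[of f "\<lambda>x. cnj (f x)" 1] continuous_map_cnj c0_continuous by simp

lemma c0_diff [intro]: "c0 f \<Longrightarrow> c0 g \<Longrightarrow> c0 (\<lambda>x. f x - g x)"
  using c0_add[OF _ c0_scale[of g "-1"], of f] by simp

lemma c0_sum [intro]: "(\<And>k. k \<in> K \<Longrightarrow> c0 (f k)) \<Longrightarrow> c0 (\<lambda>x. \<Sum>k\<in>K. f k x)"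
  by (induction K rule: infinite_finite_induct) auto

lemma unit_ball_c0: "unit_ball f \<Longrightarrow> c0 f"
  by (simp add: unit_ball_def)

lemma vnorm_C0: "vnorm (C0 X) f = Sup (insert 0 ((\<lambda>x. cmod (f x)) ` topspace X))"
  by (simp only: C0_def normed_space.select_convs)

lemma norm_C0_le_iff:
  assumes "c0 f" "b \<ge> 0"
  shows "vnorm (C0 X) (restrict f (topspace X)) \<le> b \<longleftrightarrow> (\<forall>x\<in>topspace X. cmod (f x) \<le> b)"
proof -
  let ?S = "insert 0 ((\<lambda>x. cmod (f x)) ` topspace X)"
  obtain B where "B > 0" "\<And>x. x \<in> topspace X \<Longrightarrow> cmod (f x) \<le> B"
    using c0_bounded[OF assms(1)] by blast
  then have bdd: "bdd_above ?S" by (auto intro!: bdd_aboveI2 bdd_aboveI[of _ B])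
  have "vnorm (C0 X) (restrict f (topspace X)) = Sup ?S"
    unfolding vnorm_C0 by (intro arg_cong[where f = Sup] arg_cong[where f = "insert 0"] image_cong) simp_all
  then show ?thesis
    using cSup_le_iff[OF _ bdd, of b] assms(2) by auto
qed

lemma CX_norm_le_iff:
  "f \<in> CX \<Longrightarrow> b \<ge> 0 \<Longrightarrow> vnorm (C0 X) f \<le> b \<longleftrightarrow> (\<forall>x\<in>topspace X. cmod (f x) \<le> b)"
  using norm_C0_le_iff[of f b] by (simp add: CX_c0)

lemma CX_norm_nonneg: "f \<in> CX \<Longrightarrow> 0 \<le> vnorm (C0 X) f"
proof -
  assume f: "f \<in> CX"
  obtain B where "B > 0" "\<And>x. x \<in> topspace X \<Longrightarrow> cmod (f x) \<le> B"
    using c0_bounded[OF CX_c0[OF f]] by blast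
  then have "bdd_above (insert 0 ((\<lambda>x. cmod (f x)) ` topspace X))"
    by (auto intro!: bdd_aboveI[of _ B])
  then show ?thesis
    unfolding vnorm_C0 by (intro cSup_upper) simp_all
qed

lemma CX_norm_bound: "f \<in> CX \<Longrightarrow> x \<in> topspace X \<Longrightarrow> cmod (f x) \<le> vnorm (C0 X) f"
  using CX_norm_le_iff[of f "vnorm (C0 X) f"] CX_norm_nonneg by simp

section \<open>Functionals on C0(X) and their norm\<close>

lemma dual_D:
  assumes "\<mu> \<in> vecs (dual E)"
  shows "x \<in> vecs E \<Longrightarrow> y \<in> vecs E \<Longrightarrow> \<mu> (vadd E x y) = \<mu> x + \<mu> y"
    and "x \<in> vecs E \<Longrightarrow> \<mu> (vscale E c x) = c * \<mu> x"
    and "\<exists>B. \<forall>x\<in>vecs E. cmod (\<mu> x) \<le> B * vnorm E x"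
    and "\<mu> \<in> extensional (vecs E)"
  using assms by (simp_all add: dual_def bounded_linear_map_def scalars_def)

lemma C0_ops [simp]:
  "vadd (C0 X) f g = (\<lambda>x\<in>topspace X. f x + g x)"
  "vscale (C0 X) c f = (\<lambda>x\<in>topspace X. c * f x)"
  "vmult (C0 X) f g = (\<lambda>x\<in>topspace X. f x * g x)"
  by (simp_all only: C0_def normed_space.select_convs normed_alg.select_convs)

lemma vnorm_dual: "vnorm (dual E) \<mu> = (SUP x\<in>{x \<in> vecs E. vnorm E x \<le> 1}. cmod (\<mu> x))"
  by (simp only: dual_def normed_space.select_convs)

lemma dual_ops [simp]:
  "vadd (dual E) \<mu> \<nu> = (\<lambda>x\<in>vecs E. \<mu> x + \<nu> x)"
  "vscale (dual E) c \<mu> = (\<lambda>x\<in>vecs E. c * \<mu> x)"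
  by (simp_all only: dual_def normed_space.select_convs)

lemma
  assumes "\<mu> \<in> MX" "c0 f"
  shows ev_add: "c0 g \<Longrightarrow> ev \<mu> (\<lambda>x. f x + g x) = ev \<mu> f + ev \<mu> g"
    and ev_scale: "ev \<mu> (\<lambda>x. c * f x) = c * ev \<mu> f"
proof -
  let ?r = "\<lambda>f. restrict f (topspace X)"
  show "ev \<mu> (\<lambda>x. f x + g x) = ev \<mu> f + ev \<mu> g" if "c0 g"
  proof -
    have "\<mu> (vadd (C0 X) (?r f) (?r g)) = \<mu> (?r f) + \<mu> (?r g)"
      using assms that by (intro dual_D(1)[of _ "C0 X"]) (simp_all only: restrict_CX)
    moreover have "vadd (C0 X) (?r f) (?r g) = ?r (\<lambda>x. f x + g x)" by auto
    ultimately show ?thesis by (simp add: ev_def)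
  qed
  have "\<mu> (vscale (C0 X) c (?r f)) = c * \<mu> (?r f)"
    using assms by (intro dual_D(2)[of _ "C0 X"]) (simp_all only: restrict_CX)
  moreover have "vscale (C0 X) c (?r f) = ?r (\<lambda>x. c * f x)" by auto
  ultimately show "ev \<mu> (\<lambda>x. c * f x) = c * ev \<mu> f" by (simp add: ev_def)
qed

lemma ev_zero [simp]: "\<mu> \<in> MX \<Longrightarrow> ev \<mu> (\<lambda>x. 0) = 0"
  using ev_scale[of \<mu> "\<lambda>x. 0" 0] by simp

lemma ev_diff: "\<mu> \<in> MX \<Longrightarrow> c0 f \<Longrightarrow> c0 g \<Longrightarrow> ev \<mu> (\<lambda>x. f x - g x) = ev \<mu> f - ev \<mu> g"
  using ev_add[of \<mu> f "\<lambda>x. -1 * g x"] ev_scale[of \<mu> g "-1"] c0_scale[of g "-1"]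
  by simp

lemma ev_sum:
  "\<mu> \<in> MX \<Longrightarrow> (\<And>k. k \<in> K \<Longrightarrow> c0 (f k)) \<Longrightarrow> ev \<mu> (\<lambda>x. \<Sum>k\<in>K. f k x) = (\<Sum>k\<in>K. ev \<mu> (f k))"
  by (induction K rule: infinite_finite_induct) (auto simp: ev_add c0_sum)

text \<open>Stated for an arbitrary \<open>E\<close> so that it serves both \<open>mnorm\<close> and
  \<open>bnorm\<close>. The real \<open>SUP\<close> in the dual norm says something only for sets
  that are bounded above, whence the detour through \<open>B\<close>.\<close>

lemma dual_bound_unit:
  assumes \<mu>: "\<mu> \<in> vecs (dual E)" and nonneg: "\<And>x. x \<in> vecs E \<Longrightarrow> 0 \<le> vnorm E x"
    and x: "x \<in> vecs E" "vnorm E x \<le> 1"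
  shows "cmod (\<mu> x) \<le> vnorm (dual E) \<mu>"
proof -
  obtain B where B: "\<And>y. y \<in> vecs E \<Longrightarrow> cmod (\<mu> y) \<le> B * vnorm E y"
    using dual_D(3)[OF \<mu>] by blast
  let ?S = "{y \<in> vecs E. vnorm E y \<le> 1}"
  have "cmod (\<mu> y) \<le> \<bar>B\<bar>" if "y \<in> ?S" for y
  proof -
    have "cmod (\<mu> y) \<le> B * vnorm E y" using B that by auto
    also have "\<dots> \<le> \<bar>B\<bar> * vnorm E y" using nonneg[of y] that by (intro mult_right_mono) auto
    also have "\<dots> \<le> \<bar>B\<bar> * 1" using that by (intro mult_left_mono) auto
    finally show ?thesis by simp
  qed
  then have "bdd_above ((\<lambda>y. cmod (\<mu> y)) ` ?S)" by (rule bdd_aboveI2)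
  moreover have "x \<in> ?S" using x by simp
  ultimately show ?thesis unfolding vnorm_dual by (intro cSUP_upper)
qed

lemma ev_bound_unit:
  assumes "\<mu> \<in> MX" "unit_ball f"
  shows "cmod (ev \<mu> f) \<le> mnorm \<mu>"
proof -
  have f: "c0 f" "\<forall>x\<in>topspace X. cmod (f x) \<le> 1" using assms(2) by (simp_all add: unit_ball_def)
  show ?thesis
    unfolding ev_def
  proof (rule dual_bound_unit[OF assms(1) CX_norm_nonneg])
    show "restrict f (topspace X) \<in> CX" using f(1) by (simp only: restrict_CX)
    show "vnorm (C0 X) (restrict f (topspace X)) \<le> 1" using f(2) by (simp only: norm_C0_le_iff[OF f(1) zero_le_one])
  qed
qed

lemma mnorm_nonneg: "\<mu> \<in> MX \<Longrightarrow> 0 \<le> mnorm \<mu>"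
  using ev_bound_unit[of \<mu> "\<lambda>x. 0"] by (simp add: unit_ball_def)

lemma ev_bound:
  assumes "\<mu> \<in> MX" "c0 f" "\<And>x. x \<in> topspace X \<Longrightarrow> cmod (f x) \<le> b" "b \<ge> 0"
  shows "cmod (ev \<mu> f) \<le> mnorm \<mu> * b"
proof (cases "b = 0")
  case True
  then have "ev \<mu> f = ev \<mu> (\<lambda>x. 0)" using assms(3) by (intro ev_cong) auto
  then show ?thesis using True assms(1) by simp
next
  case False
  let ?g = "\<lambda>x. complex_of_real (1/b) * f x"
  have b: "b > 0" using False assms by simp
  have "unit_ball ?g"
    unfolding unit_ball_def
  proof (intro conjI ballI)
    fix x assume "x \<in> topspace X"
    then show "cmod (?g x) \<le> 1" using assms(3)[of x] b by (simp add: norm_mult norm_divide)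
  qed (rule c0_scale[OF assms(2)])
  then have "cmod (ev \<mu> ?g) \<le> mnorm \<mu>" by (rule ev_bound_unit[OF assms(1)])
  moreover have "cmod (ev \<mu> ?g) = cmod (ev \<mu> f) / b"
    unfolding ev_scale[OF assms(1,2)] using b by (simp add: norm_mult norm_divide)
  ultimately have "cmod (ev \<mu> f) / b \<le> mnorm \<mu>" by (simp only:)
  then show ?thesis using b by (simp add: field_simps)
qed

lemma unit_ball_mult:
  assumes f: "unit_ball f" and g: "unit_ball g"
  shows "unit_ball (\<lambda>x. f x * g x)"
  unfolding unit_ball_def
proof (intro conjI ballI c0_mult unit_ball_c0 f g)
  fix x assume "x \<in> topspace X"
  then have "cmod (f x) * cmod (g x) \<le> 1 * 1" using f g by (intro mult_mono) (auto simp: unit_ball_def)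
  then show "cmod (f x * g x) \<le> 1" by (simp add: norm_mult)
qed

text \<open>Multiplying each \<open>F k\<close> by a phase makes all terms nonnegative, and the sum
  becomes the value of \<open>\<mu>\<close> at a single function of the unit ball. This takes the
  place of estimates by the total variation.\<close>

lemma sum_cmod_ev_le:
  assumes \<mu>: "\<mu> \<in> MX" and F: "\<And>k. k \<in> D \<Longrightarrow> c0 (F k)"
    and le: "\<And>x. x \<in> topspace X \<Longrightarrow> (\<Sum>k\<in>D. cmod (F k x)) \<le> 1"
  shows "(\<Sum>k\<in>D. cmod (ev \<mu> (F k))) \<le> mnorm \<mu>"
proof -
  define s where "s = (\<lambda>k. cnj (sgn (ev \<mu> (F k))))"
  have s1: "cmod (s k) \<le> 1" for k by (simp add: s_def norm_sgn)
  have s2: "s k * ev \<mu> (F k) = of_real (cmod (ev \<mu> (F k)))" for k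
    by (cases "ev \<mu> (F k) = 0")
       (simp_all add: s_def sgn_eq mult.commute[of "cnj _"] complex_norm_square[symmetric] power2_eq_square)
  have "complex_of_real (\<Sum>k\<in>D. cmod (ev \<mu> (F k))) = (\<Sum>k\<in>D. ev \<mu> (\<lambda>x. s k * F k x))"
    unfolding of_real_sum s2[symmetric] by (intro sum.cong refl ev_scale[symmetric] \<mu> F)
  also have "\<dots> = ev \<mu> (\<lambda>x. \<Sum>k\<in>D. s k * F k x)"
    by (intro ev_sum[symmetric] \<mu> c0_scale F)
  also have "cmod \<dots> \<le> mnorm \<mu>"
  proof (rule ev_bound_unit[OF \<mu>], unfold unit_ball_def, intro conjI ballI)
    show "c0 (\<lambda>x. \<Sum>k\<in>D. s k * F k x)" by (intro c0_sum c0_scale F)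
    fix x assume x: "x \<in> topspace X"
    have "cmod (\<Sum>k\<in>D. s k * F k x) \<le> (\<Sum>k\<in>D. cmod (F k x))"
    proof (rule sum_norm_le)
      fix k
      show "cmod (s k * F k x) \<le> cmod (F k x)"
        unfolding norm_mult using mult_right_mono[OF s1, of "cmod (F k x)" k] by simp
    qed
    then show "cmod (\<Sum>k\<in>D. s k * F k x) \<le> 1" using le[OF x] by linarith
  qed
  finally have "\<bar>\<Sum>k\<in>D. cmod (ev \<mu> (F k))\<bar> \<le> mnorm \<mu>" by (simp only: norm_of_real)
  then show ?thesis by linarith
qed

lemma mnorm_le:
  assumes "\<And>f. unit_ball f \<Longrightarrow> cmod (ev \<mu> f) \<le> B"
  shows "mnorm \<mu> \<le> B"
proof -
  let ?S = "{x \<in> CX. vnorm (C0 X) x \<le> 1}"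
  have "restrict (\<lambda>x. 0) (topspace X) \<in> ?S"
    by (simp add: norm_C0_le_iff)
  then have ne: "?S \<noteq> {}" by blast
  have "cmod (\<mu> x) \<le> B" if "x \<in> ?S" for x
    using assms[of x] that by (auto simp: unit_ball_def CX_c0 CX_norm_le_iff)
  then have "(SUP x\<in>?S. cmod (\<mu> x)) \<le> B"
    by (intro cSUP_least[OF ne])
  then show ?thesis unfolding vnorm_dual .
qed

text \<open>The way in which all new members of \<open>MX\<close> are built. \<open>L\<close> acts
  on plain functions, so it has to ignore values off \<open>topspace X\<close>; a bound on the unit
  ball is enough by homogeneity.\<close>

lemma functional_intro:
  assumes add: "\<And>f g. c0 f \<Longrightarrow> c0 g \<Longrightarrow> L (\<lambda>x. f x + g x) = L f + L g"
    and scale: "\<And>c f. c0 f \<Longrightarrow> L (\<lambda>x. c * f x) = c * L f"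
    and cong: "\<And>f g. (\<And>x. x \<in> topspace X \<Longrightarrow> f x = g x) \<Longrightarrow> L f = L g"
    and bound: "\<And>f. unit_ball f \<Longrightarrow> cmod (L f) \<le> B"
  shows "restrict L CX \<in> MX" "\<And>f. c0 f \<Longrightarrow> ev (restrict L CX) f = L f" "mnorm (restrict L CX) \<le> B"
proof -
  show ev: "ev (restrict L CX) f = L f" if "c0 f" for f
    using that by (auto simp: ev_def intro: cong)
  have bd: "cmod (L f) \<le> B * vnorm (C0 X) f" if f: "f \<in> CX" for f
  proof (cases "vnorm (C0 X) f = 0")
    case True
    then have "L f = L (\<lambda>x. 0 * f x)"
      using CX_norm_bound[OF f] by (intro cong) auto
    then show ?thesis using scale[of f 0] CX_c0[OF f] True by simp
  next
    case False
    then have pos: "vnorm (C0 X) f > 0" using CX_norm_nonneg[OF f] by simp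
    let ?g = "\<lambda>x. complex_of_real (1 / vnorm (C0 X) f) * f x"
    have "unit_ball ?g"
      unfolding unit_ball_def
    proof (intro conjI ballI)
      fix x assume "x \<in> topspace X"
      then show "cmod (?g x) \<le> 1" using CX_norm_bound[OF f, of x] pos by (simp add: norm_mult norm_divide)
    qed (rule c0_scale[OF CX_c0[OF f]])
    then have "cmod (L ?g) \<le> B" by (rule bound)
    moreover have "cmod (L ?g) = cmod (L f) / vnorm (C0 X) f"
      unfolding scale[OF CX_c0[OF f]] using pos by (simp add: norm_mult norm_divide)
    ultimately have "cmod (L f) / vnorm (C0 X) f \<le> B" by (simp only:)
    then show ?thesis using pos by (simp add: field_simps)
  qed
  have add': "L (\<lambda>x\<in>topspace X. f x + g x) = L f + L g" if "c0 f" "c0 g" for f g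
    using add[OF that] cong[of "\<lambda>x\<in>topspace X. f x + g x" "\<lambda>x. f x + g x"] by simp
  have scale': "L (\<lambda>x\<in>topspace X. c * f x) = c * L f" if "c0 f" for f c
    using scale[OF that] cong[of "\<lambda>x\<in>topspace X. c * f x" "\<lambda>x. c * f x"] by simp
  show "restrict L CX \<in> MX"
    using bd by (auto simp: dual_def bounded_linear_map_def scalars_def CX_c0 c0_add c0_scale add' scale')
  show "mnorm (restrict L CX) \<le> B"
    by (rule mnorm_le) (simp add: ev unit_ball_c0 bound)
qed

lemma MX_extensional: "\<mu> \<in> MX \<Longrightarrow> \<mu> \<in> extensional CX"
  by (rule dual_D(4))

lemma MX_eqI:
  assumes "\<mu> \<in> MX" "\<nu> \<in> MX" "\<And>f. c0 f \<Longrightarrow> ev \<mu> f = ev \<nu> f"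
  shows "\<mu> = \<nu>"
proof (rule extensionalityI[OF MX_extensional[OF assms(1)] MX_extensional[OF assms(2)]])
  fix f assume "f \<in> CX"
  then show "\<mu> f = \<nu> f" using assms(3)[of f] CX_c0 by simp
qed

section \<open>Point evaluations and finite combinations\<close>

definition dirac :: "'a \<Rightarrow> ('a \<Rightarrow> complex) \<Rightarrow> complex" where
  "dirac x = restrict (\<lambda>f. f x) CX"

lemma
  assumes "x \<in> topspace X"
  shows dirac_MX: "dirac x \<in> MX" and ev_dirac: "c0 f \<Longrightarrow> ev (dirac x) f = f x"
    and mnorm_dirac: "mnorm (dirac x) \<le> 1"
  unfolding dirac_def using assms functional_intro[of "\<lambda>f. f x" 1] by (auto simp: unit_ball_def)

definition lincomb :: "'k set \<Rightarrow> ('k \<Rightarrow> complex) \<Rightarrow> ('k \<Rightarrow> ('a \<Rightarrow> complex) \<Rightarrow> complex) \<Rightarrow>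
    ('a \<Rightarrow> complex) \<Rightarrow> complex" where
  "lincomb K c \<nu> = (\<lambda>f\<in>CX. \<Sum>k\<in>K. c k * ev (\<nu> k) f)"

lemma
  assumes "\<And>k. k \<in> K \<Longrightarrow> \<nu> k \<in> MX"
  shows lincomb_MX: "lincomb K c \<nu> \<in> MX"
    and ev_lincomb: "c0 f \<Longrightarrow> ev (lincomb K c \<nu>) f = (\<Sum>k\<in>K. c k * ev (\<nu> k) f)"
proof -
  let ?L = "\<lambda>f. \<Sum>k\<in>K. c k * ev (\<nu> k) f"
  let ?B = "\<Sum>k\<in>K. cmod (c k) * mnorm (\<nu> k)"
  have 1: "?L (\<lambda>x. f x + g x) = ?L f + ?L g" if "c0 f" "c0 g" for f g
    using that assms by (simp add: ev_add sum.distrib distrib_left)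
  have 2: "?L (\<lambda>x. d * f x) = d * ?L f" if "c0 f" for f d
    using that assms by (simp add: ev_scale sum_distrib_left mult.left_commute)
  have 3: "?L f = ?L g" if "\<And>x. x \<in> topspace X \<Longrightarrow> f x = g x" for f g
    using ev_cong[OF that] by simp
  have 4: "cmod (?L f) \<le> ?B" if "unit_ball f" for f
  proof (rule sum_norm_le)
    fix k assume "k \<in> K"
    then show "cmod (c k * ev (\<nu> k) f) \<le> cmod (c k) * mnorm (\<nu> k)"
      using ev_bound_unit[OF assms that] by (simp add: norm_mult mult_left_mono)
  qed
  show "lincomb K c \<nu> \<in> MX"
    unfolding lincomb_def by (rule functional_intro(1)[where L = ?L and B = ?B]) (fact 1 2 3 4)+
  show "ev (lincomb K c \<nu>) f = ?L f" if "c0 f"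
    unfolding lincomb_def by (rule functional_intro(2)[where L = ?L and B = ?B]) (fact 1 2 3 4 that)+
qed

section \<open>Members of the bidual\<close>

lemma
  assumes "\<Phi> \<in> BX" "\<mu> \<in> MX"
  shows BX_add: "\<nu> \<in> MX \<Longrightarrow> \<Phi> (vadd (dual (C0 X)) \<mu> \<nu>) = \<Phi> \<mu> + \<Phi> \<nu>"
    and BX_scale: "\<Phi> (vscale (dual (C0 X)) c \<mu>) = c * \<Phi> \<mu>"
  using dual_D(1)[OF assms] dual_D(2)[OF assms] by blast+

lemma BX_lincomb:
  assumes "\<Phi> \<in> BX" "finite K" "\<And>k. k \<in> K \<Longrightarrow> \<nu> k \<in> MX"
  shows "\<Phi> (lincomb K c \<nu>) = (\<Sum>k\<in>K. c k * \<Phi> (\<nu> k))"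
  using assms(2,3)
proof (induction K)
  case empty
  \<comment> \<open>The empty combination is the zero functional; it equals its own multiple by 0,
    so homogeneity forces the value 0.\<close>
  have "lincomb {} c \<nu> = vscale (dual (C0 X)) 0 (lincomb {} c \<nu>)"
    by (auto simp: lincomb_def)
  then have "\<Phi> (lincomb {} c \<nu>) = 0 * \<Phi> (lincomb {} c \<nu>)"
    using BX_scale[OF assms(1) lincomb_MX, of "{}" \<nu> 0 c] by simp
  then show ?case by simp
next
  case (insert k K)
  have "lincomb (insert k K) c \<nu> =
      vadd (dual (C0 X)) (vscale (dual (C0 X)) (c k) (\<nu> k)) (lincomb K c \<nu>)"
    using insert.hyps by (auto simp: lincomb_def)
  moreover have "vscale (dual (C0 X)) (c k) (\<nu> k) = lincomb {k} c \<nu>"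
    by (auto simp: lincomb_def)
  moreover have "lincomb {k} c \<nu> \<in> MX" "lincomb K c \<nu> \<in> MX"
    using insert.prems by (auto intro!: lincomb_MX)
  ultimately show ?case
    using insert BX_add[OF assms(1)] BX_scale[OF assms(1), of "\<nu> k" "c k"] by (metis (no_types, lifting) insertCI sum.insert)
qed

lemma BX_bound_unit:
  "\<Phi> \<in> BX \<Longrightarrow> \<mu> \<in> MX \<Longrightarrow> mnorm \<mu> \<le> 1 \<Longrightarrow> cmod (\<Phi> \<mu>) \<le> bnorm \<Phi>"
  by (rule dual_bound_unit[OF _ mnorm_nonneg])

lemma bnorm_nonneg:
  assumes "\<Phi> \<in> BX"
  shows "0 \<le> bnorm \<Phi>"
proof -
  let ?\<mu> = "lincomb ({}::unit set) (\<lambda>_. 0) (\<lambda>_ _. 0)"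
  have "?\<mu> \<in> MX" by (rule lincomb_MX) simp
  moreover have "mnorm ?\<mu> \<le> 1"
    by (rule mnorm_le, subst ev_lincomb) (auto dest: unit_ball_c0)
  ultimately have "cmod (\<Phi> ?\<mu>) \<le> bnorm \<Phi>" by (rule BX_bound_unit[OF assms])
  then show ?thesis by (rule order_trans[OF norm_ge_zero])
qed

lemma BX_bound:
  assumes "\<Phi> \<in> BX" "\<mu> \<in> MX" "mnorm \<mu> \<le> b"
  shows "cmod (\<Phi> \<mu>) \<le> bnorm \<Phi> * b"
proof (cases "b = 0")
  case True
  obtain B where "cmod (\<Phi> \<mu>) \<le> B * mnorm \<mu>"
    using dual_D(3)[OF assms(1)] assms(2) by blast
  then show ?thesis using True assms mnorm_nonneg[of \<mu>] by simp
next
  case False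
  then have b: "b > 0" using assms mnorm_nonneg[of \<mu>] by simp
  let ?\<nu> = "vscale (dual (C0 X)) (complex_of_real (1/b)) \<mu>"
  have eq: "?\<nu> = lincomb {()} (\<lambda>_. complex_of_real (1/b)) (\<lambda>_. \<mu>)"
    by (auto simp: lincomb_def)
  have mem: "?\<nu> \<in> MX" unfolding eq using assms by (intro lincomb_MX) auto
  have "mnorm ?\<nu> \<le> 1"
  proof (rule mnorm_le)
    fix f assume f: "unit_ball f"
    have "cmod (ev \<mu> f) \<le> b" using ev_bound_unit[OF assms(2) f] assms(3) by simp
    then show "cmod (ev ?\<nu> f) \<le> 1"
      unfolding eq using assms f b
      by (simp add: ev_lincomb unit_ball_c0 norm_mult norm_divide field_simps)
  qed
  then have "cmod (\<Phi> ?\<nu>) \<le> bnorm \<Phi>" using BX_bound_unit assms(1) mem by blast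
  moreover have "\<Phi> ?\<nu> = complex_of_real (1/b) * \<Phi> \<mu>"
    by (rule BX_scale[OF assms(1,2)])
  ultimately have "cmod (complex_of_real (1/b) * \<Phi> \<mu>) \<le> bnorm \<Phi>" by (simp only:)
  then show ?thesis
    using b by (simp add: norm_mult norm_divide field_simps)
qed

text \<open>Members of the bidual are norm continuous, so an estimate that is uniform on the unit
  ball of C0(X) passes to every \<open>\<Phi>\<close> at the cost of a factor
  \<open>bnorm \<Phi>\<close>. Finite approximations of functionals reach the bidual only in this
  way.\<close>

lemma BX_approx:
  assumes \<Phi>: "\<Phi> \<in> BX" and \<mu>: "\<mu> \<in> MX" and K: "finite K" "\<And>k. k \<in> K \<Longrightarrow> \<nu> k \<in> MX"
    and le: "\<And>f. unit_ball f \<Longrightarrow> cmod (ev \<mu> f - (\<Sum>k\<in>K. c k * ev (\<nu> k) f)) \<le> e"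
  shows "cmod (\<Phi> \<mu> - (\<Sum>k\<in>K. c k * \<Phi> (\<nu> k))) \<le> bnorm \<Phi> * e"
proof -
  let ?\<xi> = "lincomb K c \<nu>"
  \<comment> \<open>The difference of \<open>\<mu>\<close> and \<open>?\<xi>\<close> is written as a
    combination over the booleans, which reuses the facts on \<open>lincomb\<close>.\<close>
  let ?c = "\<lambda>b. if b then 1 else -1" and ?\<nu> = "\<lambda>b. if b then \<mu> else ?\<xi>"
  let ?\<rho> = "lincomb UNIV ?c ?\<nu>"
  have \<xi>: "?\<xi> \<in> MX" using K(2) by (rule lincomb_MX)
  then have mem: "\<And>b. ?\<nu> b \<in> MX" using \<mu> by simp
  have "mnorm ?\<rho> \<le> e"
  proof (rule mnorm_le)
    fix f assume f: "unit_ball f"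
    have "ev ?\<rho> f = (\<Sum>b\<in>UNIV. ?c b * ev (?\<nu> b) f)"
      using mem unit_ball_c0[OF f] by (rule ev_lincomb)
    also have "\<dots> = ev \<mu> f - ev ?\<xi> f" by (simp add: UNIV_bool)
    also have "ev ?\<xi> f = (\<Sum>k\<in>K. c k * ev (\<nu> k) f)"
      using K(2) unit_ball_c0[OF f] by (rule ev_lincomb)
    finally show "cmod (ev ?\<rho> f) \<le> e" using le[OF f] by (simp only:)
  qed
  then have "cmod (\<Phi> ?\<rho>) \<le> bnorm \<Phi> * e"
    by (rule BX_bound[OF \<Phi> lincomb_MX[OF mem]])
  moreover have "\<Phi> ?\<rho> = (\<Sum>b\<in>UNIV. ?c b * \<Phi> (?\<nu> b))"
    by (rule BX_lincomb[OF \<Phi> finite mem])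
  moreover have "\<dots> = \<Phi> \<mu> - \<Phi> ?\<xi>" by (simp add: UNIV_bool)
  moreover have "\<Phi> ?\<xi> = (\<Sum>k\<in>K. c k * \<Phi> (\<nu> k))"
    by (rule BX_lincomb[OF \<Phi> K])
  ultimately show ?thesis by (simp only:)
qed


section \<open>Bump functions and partitions of unity\<close>

lemma continuous_map_of_real:
  "continuous_map X euclideanreal g \<Longrightarrow> continuous_map X euclidean (\<lambda>x. complex_of_real (g x))"
  unfolding continuous_map_atin limitin_canonical_iff by (auto intro: tendsto_of_real)

lemma bump:
  assumes V: "openin X V" and p: "p \<in> V"
  obtains g :: "'a \<Rightarrow> real" where "continuous_map X euclideanreal g" "c0 (\<lambda>x. complex_of_real (g x))"
    "g p = 1" "\<And>x. x \<in> topspace X \<Longrightarrow> 0 \<le> g x \<and> g x \<le> 1"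
    "\<And>x. x \<in> topspace X \<Longrightarrow> x \<notin> V \<Longrightarrow> g x = 0"
proof -
  have nb: "neighbourhood_base_of (compactin X) X"
    using locally_compact Hausdorff locally_compact_space_neighbourhood_base by blast
  \<comment> \<open>A function that vanishes off \<open>W\<close> vanishes off the compact
    \<open>C\<close>, hence at infinity; and \<open>C\<close> lies in \<open>V\<close>.\<close>
  obtain W C where W: "openin X W" "compactin X C" "p \<in> W" "W \<subseteq> C" "C \<subseteq> V"
    using nb[unfolded neighbourhood_base_of, rule_format, OF conjI[OF V p]] by auto
  have "completely_regular_space X"
    by (rule locally_compact_regular_imp_completely_regular_space[OF locally_compact disjI1[OF Hausdorff]])
  moreover have "closedin X (topspace X - W)" using W(1) by blast
  moreover have "p \<in> topspace X - (topspace X - W)"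
    using W openin_subset by blast
  ultimately obtain f :: "'a \<Rightarrow> real" where f: "continuous_map X (top_of_set {0..1}) f" "f p = 0"
      "f ` (topspace X - W) \<subseteq> {1}"
    unfolding completely_regular_space_def by blast
  have f01: "0 \<le> f x \<and> f x \<le> 1" if "x \<in> topspace X" for x
    using f(1) that by (auto simp: continuous_map_in_subtopology)
  have fc: "continuous_map X euclideanreal f"
    using f(1) by (simp add: continuous_map_in_subtopology)
  let ?g = "\<lambda>x. 1 - f x"
  have gc: "continuous_map X euclideanreal ?g"
    using fc by (intro continuous_map_diff) simp_all
  have g0: "?g x = 0" if "x \<in> topspace X" "x \<notin> W" for x
    using f(3) that by auto
  have "continuous_map X euclidean (\<lambda>x. complex_of_real (?g x))"
    by (rule continuous_map_of_real[OF gc])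
  moreover have "\<forall>e>0. \<forall>x\<in>topspace X - C. cmod (complex_of_real (?g x)) < e"
  proof (intro allI impI ballI)
    fix e :: real and x assume "e > 0" "x \<in> topspace X - C"
    then have "?g x = 0" using g0[of x] W(4) by blast
    then show "cmod (complex_of_real (?g x)) < e" using \<open>e > 0\<close> by (simp only: norm_of_real abs_zero)
  qed
  ultimately have "c0 (\<lambda>x. complex_of_real (?g x))"
    unfolding c0_def using W(2) by blast
  moreover have "?g x = 0" if "x \<in> topspace X" "x \<notin> V" for x
    using g0 W that by blast
  ultimately show ?thesis using gc f(2) f01 by (intro that[of ?g]) auto
qed

text \<open>The cells are labelled by points of \<open>C\<close>, so that a label serves later as a
  sample point of its cell. The sum can equal 1 only on a compact set, since all functions have to
  vanish at infinity.\<close>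

lemma partition_of_unity:
  assumes C: "compactin X C" and V: "\<And>p. p \<in> C \<Longrightarrow> openin X (V p) \<and> p \<in> V p"
  obtains D f where "finite D" "D \<subseteq> C" "\<forall>p\<in>D. c0 (\<lambda>x. complex_of_real (f p x))"
    "\<forall>p\<in>D. \<forall>x\<in>topspace X. 0 \<le> f p x"
    "\<forall>p\<in>D. \<forall>x\<in>topspace X. x \<notin> V p \<longrightarrow> f p x = 0"
    "\<forall>x\<in>topspace X. (\<Sum>p\<in>D. f p x) \<le> (1::real)"
    "\<forall>x\<in>C. (\<Sum>p\<in>D. f p x) = 1"
proof -
  have CX: "C \<subseteq> topspace X" using C by (simp add: compactin_subset_topspace)
  have "\<exists>g. continuous_map X euclideanreal g \<and> c0 (\<lambda>x. complex_of_real (g x)) \<and> g p = 1 \<and>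
      (\<forall>x\<in>topspace X. 0 \<le> g x \<and> g x \<le> 1) \<and> (\<forall>x\<in>topspace X. x \<notin> V p \<longrightarrow> g x = 0)"
    if "p \<in> C" for p
    using V[OF that] bump[of "V p" p] by metis
  then obtain g where g: "\<And>p. p \<in> C \<Longrightarrow> continuous_map X euclideanreal (g p) \<and>
      c0 (\<lambda>x. complex_of_real (g p x)) \<and> g p p = 1 \<and>
      (\<forall>x\<in>topspace X. 0 \<le> g p x \<and> g p x \<le> 1) \<and> (\<forall>x\<in>topspace X. x \<notin> V p \<longrightarrow> g p x = 0)"
    by metis
  let ?O = "\<lambda>p. {x \<in> topspace X. g p x \<in> {1/2<..}}"
  have "openin X (?O p)" if "p \<in> C" for p
    using g[OF that] openin_continuous_map_preimage[of X euclideanreal "g p" "{1/2<..}"] by simp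
  moreover have "C \<subseteq> \<Union> (?O ` C)" using g CX by force
  ultimately obtain F where F: "finite F" "F \<subseteq> ?O ` C" "C \<subseteq> \<Union> F"
    using C unfolding compactin_def by (metis (no_types, lifting) imageE)
  then obtain D where D: "finite D" "D \<subseteq> C" "F = ?O ` D"
    by (meson finite_subset_image)
  let ?G = "\<lambda>x. \<Sum>p\<in>D. g p x"
  \<comment> \<open>Dividing by \<open>?G\<close> itself is impossible where it vanishes. On
    \<open>C\<close> it exceeds 1/2, so the cut-off changes nothing there, and elsewhere it keeps
    the quotients continuous with sum at most 1.\<close>
  let ?m = "\<lambda>x. max (?G x) (1/2)"
  have gD: "0 \<le> g p x" if "p \<in> D" "x \<in> topspace X" for p x
    using g D that by blast
  have G0: "0 \<le> ?G x" if "x \<in> topspace X" for x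
    using gD that by (simp add: sum_nonneg)
  have Gc: "continuous_map X euclideanreal ?G"
    using g D by (intro continuous_map_sum) auto
  have mc: "continuous_map X euclideanreal (\<lambda>x. inverse (?m x))"
    using Gc by (intro continuous_map_real_inverse continuous_map_real_max) auto
  have mpos: "?m x > 0" for x by simp
  show ?thesis
  proof (rule that[of D "\<lambda>p x. g p x * inverse (?m x)"]; (intro ballI impI)?)
    fix p assume p: "p \<in> D"
    have "c0 (\<lambda>x. complex_of_real (g p x) * complex_of_real (inverse (?m x)))"
    proof (rule c0_mult_bounded[where B = 2])
      show "c0 (\<lambda>x. complex_of_real (g p x))" using g p D by blast
      show "continuous_map X euclidean (\<lambda>x. complex_of_real (inverse (?m x)))"
        by (rule continuous_map_of_real[OF mc])
      fix x
      have "inverse (?m x) \<le> inverse (1/2)" by (intro le_imp_inverse_le) auto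
      then show "cmod (complex_of_real (inverse (?m x))) \<le> 2"
        unfolding norm_of_real using mpos[of x] by simp
    qed
    then show "c0 (\<lambda>x. complex_of_real (g p x * inverse (?m x)))" by simp
  next
    fix p x assume "p \<in> D" "x \<in> topspace X"
    then show "0 \<le> g p x * inverse (?m x)"
      using gD mpos[of x] by (intro mult_nonneg_nonneg) auto
  next
    fix p x assume "p \<in> D" "x \<in> topspace X" "x \<notin> V p"
    then show "g p x * inverse (?m x) = 0" using g D by auto
  next
    fix x
    have "?G x * inverse (?m x) \<le> ?m x * inverse (?m x)"
      using mpos[of x] by (intro mult_right_mono) auto
    also have "\<dots> = 1" using mpos[of x] by (intro right_inverse) linarith
    finally show "(\<Sum>p\<in>D. g p x * inverse (?m x)) \<le> 1"
      by (simp only: sum_distrib_right)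
  next
    fix x assume x: "x \<in> C"
    then obtain p where p: "p \<in> D" "g p x > 1/2" using F D by auto
    have "g p x \<le> ?G x"
      using p D gD x CX by (intro member_le_sum) auto
    then have "?m x = ?G x" "?G x > 0" using p by auto
    then have "?G x * inverse (?m x) = 1" by simp
    then show "(\<Sum>p\<in>D. g p x * inverse (?m x)) = 1"
      by (simp only: sum_distrib_right)
  qed (use D in auto)
qed

end

section \<open>A local reflexivity principle\<close>

lemma cmod_add_sq: "(cmod (u + w))\<^sup>2 = (cmod u)\<^sup>2 + 2 * Re (u * cnj w) + (cmod w)\<^sup>2"
  unfolding cmod_power2 by (simp add: algebra_simps power2_eq_square)

text \<open>With \<open>R\<close> rotated into the direction of \<open>P\<close> nothing cancels, so
  that an upper bound on the modulus of the sum turns into a bound on \<open>cmod R\<close>.\<close>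

lemma align_phase:
  fixes P R :: complex and t :: real
  assumes "t \<ge> 0"
  obtains s where "cmod s = 1" "cmod (P + of_real t * s * R) = cmod P + t * cmod R"
proof -
  \<comment> \<open>The value 1 replaces \<open>sgn 0 = 0\<close>, which is not unimodular.\<close>
  define u where "u = (if P = 0 then 1 else sgn P)"
  define v where "v = (if R = 0 then 1 else sgn R)"
  have u: "cmod u = 1" "P = of_real (cmod P) * u"
    by (auto simp: u_def sgn_eq norm_divide)
  have v: "cmod v = 1" "R = of_real (cmod R) * v"
    by (auto simp: v_def sgn_eq norm_divide)
  have vv: "cnj v * v = 1"
    using v(1) complex_norm_square[of v] by (simp add: mult.commute)
  have "P + of_real t * (u * cnj v) * R =
      of_real (cmod P) * u + of_real t * u * of_real (cmod R) * (cnj v * v)"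
    by (subst u(2), subst v(2)) (simp only: ac_simps)
  also have "\<dots> = u * of_real (cmod P + t * cmod R)"
    unfolding vv by (simp add: algebra_simps)
  finally have "cmod (P + of_real t * (u * cnj v) * R) = \<bar>cmod P + t * cmod R\<bar>"
    by (simp only: norm_mult u(1) norm_of_real) simp
  then show ?thesis
    using that[of "u * cnj v"] u(1) v(1) assms by (simp add: norm_mult)
qed

text \<open>First-order terms cancel: to first order the perturbation only rescales \<open>z\<close>.\<close>

lemma perturbed_norm_bound:
  fixes z :: "'k \<Rightarrow> complex"
  assumes G: "finite G" "k0 \<in> G" and z: "(\<Sum>k\<in>G. (cmod (z k))\<^sup>2) \<le> 1"
    and w: "cmod w \<le> t" "t \<le> 1/2"
  shows "(\<Sum>k\<in>G. (cmod (z k + w * ((if k = k0 then 1 else 0) - cnj (z k0) * z k)))\<^sup>2) \<le> 1 + t\<^sup>2"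
proof -
  define q where "q = w * cnj (z k0)"
  define S where "S = (\<Sum>k\<in>G. (cmod (z k))\<^sup>2)"
  have S1: "S \<le> 1" using z by (simp add: S_def)
  have z0: "(cmod (z k0))\<^sup>2 \<le> S"
    unfolding S_def using G by (intro member_le_sum) auto
  then have "(cmod (z k0))\<^sup>2 \<le> 1\<^sup>2" using S1 by simp
  then have z01: "cmod (z k0) \<le> 1" by (rule power2_le_imp_le) simp
  have S0: "0 \<le> S" by (simp add: S_def sum_nonneg)
  have t0: "0 \<le> t" using w(1) norm_ge_zero order_trans by blast
  have q: "cmod q \<le> 1/2"
  proof -
    have "cmod q = cmod w * cmod (z k0)" by (simp add: q_def norm_mult)
    also have "\<dots> \<le> t * 1" using w z01 t0 by (intro mult_mono) auto
    finally show ?thesis using w(2) by simp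
  qed
  \<comment> \<open>Off \<open>k0\<close> the perturbation is the factor \<open>1 - q\<close>. At
    \<open>k0\<close> it also adds \<open>w\<close>, and \<open>z k0 * cnj w = cnj q\<close> leaves
    a cross term in \<open>q\<close> alone.\<close>
  have k: "(cmod (z k + w * ((if k = k0 then 1 else 0) - cnj (z k0) * z k)))\<^sup>2 =
      (cmod (1 - q))\<^sup>2 * (cmod (z k))\<^sup>2 +
      (if k = k0 then 2 * Re (cnj q - q * cnj q) + (cmod w)\<^sup>2 else 0)" for k
  proof (cases "k = k0")
    case False
    then have "z k + w * ((if k = k0 then 1 else 0) - cnj (z k0) * z k) = (1 - q) * z k"
      by (simp add: q_def algebra_simps)
    then show ?thesis using False by (simp only: norm_mult power_mult_distrib) simp
  next
    case True
    then have "z k + w * ((if k = k0 then 1 else 0) - cnj (z k0) * z k) = (1 - q) * z k0 + w"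
      by (simp add: q_def algebra_simps)
    moreover have "(cmod ((1 - q) * z k0 + w))\<^sup>2 =
        (cmod ((1 - q) * z k0))\<^sup>2 + 2 * Re ((1 - q) * z k0 * cnj w) + (cmod w)\<^sup>2"
      by (rule cmod_add_sq)
    moreover have "(1 - q) * z k0 * cnj w = cnj q - q * cnj q"
      by (simp add: q_def algebra_simps)
    ultimately show ?thesis using True by (simp only: norm_mult power_mult_distrib) simp
  qed
  have "(\<Sum>k\<in>G. (cmod (z k + w * ((if k = k0 then 1 else 0) - cnj (z k0) * z k)))\<^sup>2) =
      (cmod (1 - q))\<^sup>2 * S + (2 * Re (cnj q - q * cnj q) + (cmod w)\<^sup>2)"
    unfolding k using G by (simp add: sum.distrib S_def sum_distrib_left)
  also have "(cmod (1 - q))\<^sup>2 = 1 - 2 * Re q + (cmod q)\<^sup>2"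
    unfolding cmod_power2 by (simp add: algebra_simps power2_eq_square)
  also have "Re (cnj q - q * cnj q) = Re q - (cmod q)\<^sup>2"
    unfolding cmod_power2 by (simp add: algebra_simps power2_eq_square)
  also have "(1 - 2 * Re q + (cmod q)\<^sup>2) * S + (2 * (Re q - (cmod q)\<^sup>2) + (cmod w)\<^sup>2) =
      S + (2 * Re q) * (1 - S) + (cmod q)\<^sup>2 * (S - 2) + (cmod w)\<^sup>2"
    by (simp add: algebra_simps)
  \<comment> \<open>Since \<open>2 * Re q\<close> is at most 1 and \<open>S\<close> is at most 1,
    the first-order term is absorbed by the gap \<open>1 - S\<close>.\<close>
  also have "\<dots> \<le> S + 1 * (1 - S) + 0 + t\<^sup>2"
  proof (intro add_mono)
    have "2 * Re q \<le> 1" using q complex_Re_le_cmod[of q] by linarith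
    then show "2 * Re q * (1 - S) \<le> 1 * (1 - S)" using S1 by (intro mult_right_mono) auto
    show "(cmod q)\<^sup>2 * (S - 2) \<le> 0" using S1 by (intro mult_nonneg_nonpos) auto
    show "(cmod w)\<^sup>2 \<le> t\<^sup>2" using w by (intro power_mono) auto
  qed simp
  finally show ?thesis by simp
qed

context lch_space
begin

text \<open>The closed unit ball of the continuous functions vanishing at infinity with values in
  Euclidean space over \<open>G\<close>. The Euclidean norm is what makes the expansion in
  \<open>perturbed_norm_bound\<close> available.\<close>

definition vec_ball :: "(('a \<Rightarrow> complex) \<Rightarrow> complex) set \<Rightarrow> ((('a \<Rightarrow> complex) \<Rightarrow> complex) \<Rightarrow> 'a \<Rightarrow> complex) \<Rightarrow> bool" where
  "vec_ball G b \<longleftrightarrow> (\<forall>\<mu>\<in>G. c0 (b \<mu>)) \<and> (\<forall>x\<in>topspace X. (\<Sum>\<mu>\<in>G. (cmod (b \<mu> x))\<^sup>2) \<le> 1)"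

definition pairing :: "(('a \<Rightarrow> complex) \<Rightarrow> complex) set \<Rightarrow> ((('a \<Rightarrow> complex) \<Rightarrow> complex) \<Rightarrow> 'a \<Rightarrow> complex) \<Rightarrow> complex" where
  "pairing G b = (\<Sum>\<mu>\<in>G. ev \<mu> (b \<mu>))"

lemma vec_ball_component:
  assumes "finite G" "vec_ball G b" "\<mu> \<in> G" "x \<in> topspace X"
  shows "cmod (b \<mu> x) \<le> 1"
proof -
  have "(cmod (b \<mu> x))\<^sup>2 \<le> (\<Sum>\<mu>\<in>G. (cmod (b \<mu> x))\<^sup>2)"
    using assms by (intro member_le_sum) auto
  also have "\<dots> \<le> 1\<^sup>2" using assms by (simp add: vec_ball_def)
  finally show ?thesis by (rule power2_le_imp_le) simp
qed

lemma pairing_norm_exists: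
  assumes "finite G" "G \<subseteq> MX"
  obtains N where "N \<ge> 0" "\<And>b. vec_ball G b \<Longrightarrow> cmod (pairing G b) \<le> N"
    "\<And>e. e > 0 \<Longrightarrow> \<exists>b. vec_ball G b \<and> N - e < cmod (pairing G b)"
proof -
  let ?S = "(\<lambda>b. cmod (pairing G b)) ` Collect (vec_ball G)"
  have "cmod (pairing G b) \<le> (\<Sum>\<mu>\<in>G. mnorm \<mu>)" if "vec_ball G b" for b
    unfolding pairing_def
  proof (rule sum_norm_le)
    fix \<mu> assume "\<mu> \<in> G"
    then show "cmod (ev \<mu> (b \<mu>)) \<le> mnorm \<mu>"
      using assms that vec_ball_component[OF assms(1) that]
      by (intro ev_bound_unit) (auto simp: unit_ball_def vec_ball_def)
  qed
  then have bdd: "bdd_above ?S" by (auto intro!: bdd_aboveI)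
  have z: "vec_ball G (\<lambda>_ _. 0)" by (simp add: vec_ball_def)
  have up: "cmod (pairing G b) \<le> Sup ?S" if "vec_ball G b" for b
    using that by (intro cSup_upper bdd) auto
  show ?thesis
  proof (rule that[OF _ up])
    show "0 \<le> Sup ?S" using up[OF z] norm_ge_zero order_trans by blast
    fix e :: real assume "e > 0"
    then have "Sup ?S - e < Sup ?S" by simp
    moreover have "?S \<noteq> {}" using z by blast
    ultimately obtain y where "y \<in> ?S" "Sup ?S - e < y" using less_cSupE by blast
    then show "\<exists>b. vec_ball G b \<and> Sup ?S - e < cmod (pairing G b)" by blast
  qed
qed

text \<open>First variation at a near-maximiser. The vector \<open>a\<close> is moved by
  \<open>t * s * g\<close> times the basis vector at \<open>\<mu>0\<close> less its component along
  \<open>a\<close>. This raises the squared norm to at most \<open>1 + t\<^sup>2\<close>, but the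
  modulus of the pairing by \<open>t\<close> times the left-hand side; as \<open>a\<close> is
  maximal up to \<open>t\<^sup>2\<close>, that side is of order \<open>t\<close>. For measures this
  is the polar decomposition.\<close>

lemma near_maximal:
  assumes G: "finite G" "G \<subseteq> MX" "\<mu>0 \<in> G"
    and N: "N \<ge> 0" "\<And>b. vec_ball G b \<Longrightarrow> cmod (pairing G b) \<le> N"
    and a: "vec_ball G a" "N - t\<^sup>2 \<le> cmod (pairing G a)"
    and t: "0 < t" "t \<le> 1/2" and g: "unit_ball g"
  shows "cmod (ev \<mu>0 g - (\<Sum>\<mu>\<in>G. ev \<mu> (\<lambda>x. a \<mu> x * (cnj (a \<mu>0 x) * g x)))) \<le> (N + 1) * t"
proof -
  define P where "P = pairing G a"
  define R where "R = ev \<mu>0 g - (\<Sum>\<mu>\<in>G. ev \<mu> (\<lambda>x. a \<mu> x * (cnj (a \<mu>0 x) * g x)))"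
  obtain s where s: "cmod s = 1" "cmod (P + of_real t * s * R) = cmod P + t * cmod R"
    using align_phase[of t P R] t by auto
  let ?w = "\<lambda>x. of_real t * s * g x"
  let ?d = "\<lambda>\<mu>. if \<mu> = \<mu>0 then 1 else (0::complex)"
  define b where "b = (\<lambda>\<mu> x. a \<mu> x + ?w x * (?d \<mu> - cnj (a \<mu>0 x) * a \<mu> x))"
  have ac: "c0 (a \<mu>)" if "\<mu> \<in> G" for \<mu> using a(1) that by (simp add: vec_ball_def)
  have gc: "c0 g" by (rule unit_ball_c0[OF g])
  have prod: "c0 (\<lambda>x. a \<mu> x * (cnj (a \<mu>0 x) * g x))" if "\<mu> \<in> G" for \<mu>
    using ac that G(3) gc by (intro c0_mult c0_cnj) auto
  have b_eq: "b \<mu> = (\<lambda>x. a \<mu> x + of_real t * s * (?d \<mu> * g x - a \<mu> x * (cnj (a \<mu>0 x) * g x)))" for \<mu>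
    by (auto simp: b_def algebra_simps)
  have dc: "c0 (\<lambda>x. ?d \<mu> * g x - a \<mu> x * (cnj (a \<mu>0 x) * g x))" if "\<mu> \<in> G" for \<mu>
    by (rule c0_diff[OF c0_scale[OF gc] prod[OF that]])
  have bc: "c0 (b \<mu>)" if "\<mu> \<in> G" for \<mu>
    unfolding b_eq by (rule c0_add[OF ac[OF that] c0_scale[OF dc[OF that]]])
  have evb: "ev \<mu> (b \<mu>) = ev \<mu> (a \<mu>) + of_real t * s *
      (?d \<mu> * ev \<mu> g - ev \<mu> (\<lambda>x. a \<mu> x * (cnj (a \<mu>0 x) * g x)))" if "\<mu> \<in> G" for \<mu>
  proof -
    have \<mu>: "\<mu> \<in> MX" using G that by blast
    show ?thesis
      unfolding b_eq ev_add[OF \<mu> ac[OF that] c0_scale[OF dc[OF that]]] ev_scale[OF \<mu> dc[OF that]]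
        ev_diff[OF \<mu> c0_scale[OF gc] prod[OF that]] ev_scale[OF \<mu> gc] by (rule refl)
  qed
  have "pairing G b = P + of_real t * s * (\<Sum>\<mu>\<in>G. ?d \<mu> * ev \<mu> g - ev \<mu> (\<lambda>x. a \<mu> x * (cnj (a \<mu>0 x) * g x)))"
    unfolding pairing_def P_def sum_distrib_left by (simp add: evb sum.distrib)
  also have "(\<Sum>\<mu>\<in>G. ?d \<mu> * ev \<mu> g - ev \<mu> (\<lambda>x. a \<mu> x * (cnj (a \<mu>0 x) * g x))) = R"
    unfolding R_def sum_subtractf using G
    by (simp add: if_distrib[of "\<lambda>c. c * _"] cong: if_cong)
  finally have Pb: "pairing G b = P + of_real t * s * R" .
  \<comment> \<open>Dividing by \<open>1 + t\<^sup>2\<close> instead of its square root avoids roots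
    and still costs only second order.\<close>
  let ?r = "complex_of_real (1 / (1 + t\<^sup>2))"
  have t1: "1 + t\<^sup>2 > 0" "1 + t\<^sup>2 \<ge> 1" by (auto intro: add_pos_nonneg)
  have "vec_ball G (\<lambda>\<mu> x. ?r * b \<mu> x)"
    unfolding vec_ball_def
  proof (intro conjI ballI)
    fix \<mu> assume "\<mu> \<in> G"
    then show "c0 (\<lambda>x. ?r * b \<mu> x)" by (rule c0_scale[OF bc])
  next
    fix x assume x: "x \<in> topspace X"
    have "cmod (?w x) \<le> t"
      using g x t s(1) by (simp add: unit_ball_def norm_mult)
    then have le: "(\<Sum>\<mu>\<in>G. (cmod (b \<mu> x))\<^sup>2) \<le> 1 + t\<^sup>2"
      unfolding b_def using a(1) x t G
      by (intro perturbed_norm_bound) (auto simp: vec_ball_def)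
    have "(\<Sum>\<mu>\<in>G. (cmod (?r * b \<mu> x))\<^sup>2) = (1 / (1 + t\<^sup>2))\<^sup>2 * (\<Sum>\<mu>\<in>G. (cmod (b \<mu> x))\<^sup>2)"
      unfolding sum_distrib_left norm_mult norm_of_real power_mult_distrib by simp
    also have "\<dots> \<le> (1 / (1 + t\<^sup>2))\<^sup>2 * (1 + t\<^sup>2)"
      by (intro mult_left_mono le) simp
    also have "\<dots> = 1 / (1 + t\<^sup>2)"
      using t1 by (simp add: power2_eq_square)
    also have "\<dots> \<le> 1" using t1 unfolding divide_le_eq_1 by linarith
    finally show "(\<Sum>\<mu>\<in>G. (cmod (?r * b \<mu> x))\<^sup>2) \<le> 1" .
  qed
  then have "cmod (pairing G (\<lambda>\<mu> x. ?r * b \<mu> x)) \<le> N" by (rule N(2))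
  moreover have "pairing G (\<lambda>\<mu> x. ?r * b \<mu> x) = ?r * pairing G b"
    unfolding pairing_def sum_distrib_left using G bc by (intro sum.cong ev_scale) auto
  ultimately have "cmod (?r * pairing G b) \<le> N" by (simp only:)
  moreover have "cmod (?r * pairing G b) = cmod (pairing G b) / (1 + t\<^sup>2)"
    unfolding norm_mult norm_of_real using t1 by simp
  ultimately have "cmod (pairing G b) / (1 + t\<^sup>2) \<le> N" by (simp only:)
  then have "cmod (pairing G b) \<le> N * (1 + t\<^sup>2)" using t1 by (simp add: field_simps)
  then have "cmod P + t * cmod R \<le> N + N * t\<^sup>2" unfolding Pb s(2) by (simp add: algebra_simps)
  moreover have "N - t\<^sup>2 \<le> cmod P" using a(2) by (simp add: P_def)
  ultimately have "t * cmod R \<le> t * ((N + 1) * t)" by (simp add: algebra_simps power2_eq_square)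
  then have "cmod R \<le> (N + 1) * t" using t(1) by simp
  then show ?thesis by (simp only: R_def)
qed


text \<open>Here \<open>\<rho> = (\<Sum>\<mu>\<in>G. \<mu> (a \<mu> * _))\<close> and \<open>h \<mu> = cnj (a \<mu>)\<close>, where \<open>a\<close> is a vector of functions at which
  the functionals in \<open>G\<close> nearly attain their joint norm. The last property says that \<open>\<rho>\<close> is nearly
  positive.\<close>

lemma approximate_Radon_Nikodym:
  assumes G: "finite G" "G \<subseteq> MX" and e: "e > 0"
  obtains \<rho> h \<eta> where "\<rho> \<in> MX" "\<eta> > 0"
    "\<forall>\<mu>\<in>G. c0 (h \<mu>)" "\<forall>\<mu>\<in>G. \<forall>x\<in>topspace X. cmod (h \<mu> x) \<le> 1"
    "\<forall>\<mu>\<in>G. \<forall>g. unit_ball g \<longrightarrow> cmod (ev \<mu> g - ev \<rho> (\<lambda>x. h \<mu> x * g x)) \<le> e"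
    "\<forall>F. c0 F \<longrightarrow> (\<forall>\<mu>\<in>G. \<forall>x\<in>topspace X. cmod (h \<mu> x) * cmod (1 - F x) \<le> \<eta>) \<longrightarrow>
      mnorm \<rho> - e \<le> cmod (ev \<rho> F)"
proof -
  obtain N where N: "N \<ge> 0" "\<And>b. vec_ball G b \<Longrightarrow> cmod (pairing G b) \<le> N"
    "\<And>e. e > 0 \<Longrightarrow> \<exists>b. vec_ball G b \<and> N - e < cmod (pairing G b)"
    using pairing_norm_exists[OF G] by blast
  \<comment> \<open>The bound 1/2 is asked for by \<open>perturbed_norm_bound\<close>,
    \<open>e / (N + 1)\<close> by the density estimate, and \<open>e / 2\<close> gives
    \<open>t\<^sup>2 \<le> e/2\<close> for near positivity.\<close>
  define t where "t = min (1/2) (min (e/2) (e / (N + 1)))"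
  have t: "0 < t" "t \<le> 1/2" using e N(1) unfolding t_def by (simp, intro min.cobounded1)
  have Nt: "(N + 1) * t \<le> e"
  proof -
    have "(N + 1) * t \<le> (N + 1) * (e / (N + 1))"
      using N(1) by (intro mult_left_mono) (auto simp: t_def)
    then show ?thesis using N(1) by simp
  qed
  have t2: "t\<^sup>2 \<le> e/2"
  proof -
    have "t\<^sup>2 \<le> t * 1" unfolding power2_eq_square using t by (intro mult_left_mono) auto
    then show ?thesis by (simp add: t_def)
  qed
  obtain a where a: "vec_ball G a" "N - t\<^sup>2 < cmod (pairing G a)"
    using N(3)[of "t\<^sup>2"] t by auto
  have ac: "c0 (a \<mu>)" if "\<mu> \<in> G" for \<mu> using a(1) that by (simp add: vec_ball_def)
  have a1: "cmod (a \<mu> x) \<le> 1" if "\<mu> \<in> G" "x \<in> topspace X" for \<mu> x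
    by (rule vec_ball_component[OF G(1) a(1) that])
  let ?L = "\<lambda>f. \<Sum>\<mu>\<in>G. ev \<mu> (\<lambda>x. a \<mu> x * f x)"
  have prod: "c0 (\<lambda>x. a \<mu> x * f x)" if "\<mu> \<in> G" "c0 f" for \<mu> f using ac that by blast
  have L1: "?L (\<lambda>x. f x + g x) = ?L f + ?L g" if "c0 f" "c0 g" for f g
    unfolding distrib_left sum.distrib[symmetric]
    using G that by (intro sum.cong refl ev_add prod) auto
  have L2: "?L (\<lambda>x. c * f x) = c * ?L f" if "c0 f" for f c
    unfolding sum_distrib_left mult.left_commute[of _ c]
    using G that by (intro sum.cong refl ev_scale prod) auto
  have L3: "?L f = ?L g" if "\<And>x. x \<in> topspace X \<Longrightarrow> f x = g x" for f g
    by (intro sum.cong refl ev_cong) (simp add: that)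
  have L4: "cmod (?L f) \<le> N" if f: "unit_ball f" for f
  proof -
    have "vec_ball G (\<lambda>\<mu> x. a \<mu> x * f x)"
      unfolding vec_ball_def
    proof (intro conjI ballI)
      fix x assume x: "x \<in> topspace X"
      have "(\<Sum>\<mu>\<in>G. (cmod (a \<mu> x * f x))\<^sup>2) \<le> (\<Sum>\<mu>\<in>G. (cmod (a \<mu> x))\<^sup>2)"
      proof (rule sum_mono)
        fix \<mu> assume "\<mu> \<in> G"
        have "cmod (a \<mu> x * f x) \<le> cmod (a \<mu> x) * 1"
          unfolding norm_mult using f x by (intro mult_left_mono) (auto simp: unit_ball_def)
        then show "(cmod (a \<mu> x * f x))\<^sup>2 \<le> (cmod (a \<mu> x))\<^sup>2" by (intro power_mono) auto
      qed
      also have "\<dots> \<le> 1" using a(1) x by (simp add: vec_ball_def)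
      finally show "(\<Sum>\<mu>\<in>G. (cmod (a \<mu> x * f x))\<^sup>2) \<le> 1" .
    qed (rule prod[OF _ unit_ball_c0[OF f]])
    from N(2)[OF this] show ?thesis by (simp only: pairing_def)
  qed
  let ?\<rho> = "restrict ?L CX"
  have \<rho>: "?\<rho> \<in> MX" by (rule functional_intro(1)[where L = ?L and B = N]) (fact L1 L2 L3 L4)+
  have ev\<rho>: "ev ?\<rho> f = ?L f" if "c0 f" for f
    by (rule functional_intro(2)[where L = ?L and B = N]) (fact L1 L2 L3 L4 that)+
  have \<rho>N: "mnorm ?\<rho> \<le> N" by (rule functional_intro(3)[where L = ?L and B = N]) (fact L1 L2 L3 L4)+
  define M where "M = (\<Sum>\<mu>\<in>G. mnorm \<mu>)"
  have M: "M \<ge> 0" unfolding M_def using G mnorm_nonneg by (intro sum_nonneg) auto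
  show ?thesis
  proof (rule that[of ?\<rho> "e / (2 * (M + 1))" "\<lambda>\<mu> x. cnj (a \<mu> x)", OF \<rho>]; (intro allI ballI impI)?)
    show "e / (2 * (M + 1)) > 0" using e M by simp
  next
    fix \<mu> assume "\<mu> \<in> G"
    then show "c0 (\<lambda>x. cnj (a \<mu> x))" using ac by blast
  next
    fix \<mu> x assume "\<mu> \<in> G" "x \<in> topspace X"
    then show "cmod (cnj (a \<mu> x)) \<le> 1" using a1 by simp
  next
    fix \<mu> g assume *: "\<mu> \<in> G" "unit_ball g"
    have "cmod (ev \<mu> g - (\<Sum>\<nu>\<in>G. ev \<nu> (\<lambda>x. a \<nu> x * (cnj (a \<mu> x) * g x)))) \<le> (N + 1) * t"
      by (rule near_maximal[OF G *(1) N(1,2) a(1) less_imp_le[OF a(2)] t *(2)])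
    moreover have "c0 (\<lambda>x. cnj (a \<mu> x) * g x)"
      by (rule c0_mult[OF c0_cnj[OF ac[OF *(1)]] unit_ball_c0[OF *(2)]])
    ultimately show "cmod (ev \<mu> g - ev ?\<rho> (\<lambda>x. cnj (a \<mu> x) * g x)) \<le> e"
      using Nt by (simp only: ev\<rho>)
  next
    fix F assume F: "c0 F" and small: "\<forall>\<mu>\<in>G. \<forall>x\<in>topspace X.
      cmod (cnj (a \<mu> x)) * cmod (1 - F x) \<le> e / (2 * (M + 1))"
    \<comment> \<open>\<open>pairing G a\<close> stands for the value of \<rho> at the constant 1,
      which need not vanish at infinity. \<open>F\<close> replaces the constant; by the choice of
      \<eta> as \<open>e / (2 * (M + 1))\<close> this costs at most \<open>e / 2\<close>.\<close>
    have "pairing G a - ?L F = (\<Sum>\<mu>\<in>G. ev \<mu> (\<lambda>x. a \<mu> x - a \<mu> x * F x))"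
      unfolding pairing_def sum_subtractf[symmetric]
    proof (rule sum.cong[OF refl])
      fix \<mu> assume "\<mu> \<in> G"
      then show "ev \<mu> (a \<mu>) - ev \<mu> (\<lambda>x. a \<mu> x * F x) = ev \<mu> (\<lambda>x. a \<mu> x - a \<mu> x * F x)"
        using G by (intro ev_diff[symmetric] ac prod F) auto
    qed
    also have "cmod \<dots> \<le> (\<Sum>\<mu>\<in>G. mnorm \<mu> * (e / (2 * (M + 1))))"
    proof (rule sum_norm_le)
      fix \<mu> assume \<mu>: "\<mu> \<in> G"
      show "cmod (ev \<mu> (\<lambda>x. a \<mu> x - a \<mu> x * F x)) \<le> mnorm \<mu> * (e / (2 * (M + 1)))"
      proof (rule ev_bound)
        fix x assume "x \<in> topspace X"
        moreover have "a \<mu> x - a \<mu> x * F x = a \<mu> x * (1 - F x)" by (simp add: algebra_simps)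
        ultimately show "cmod (a \<mu> x - a \<mu> x * F x) \<le> e / (2 * (M + 1))"
          using small[rule_format, OF \<mu>, of x] by (simp only: norm_mult complex_mod_cnj)
      qed (use \<mu> G F ac prod e M in \<open>auto intro!: c0_diff\<close>)
    qed
    also have "\<dots> = M * (e / (2 * (M + 1)))" by (simp only: M_def sum_distrib_right)
    also have "\<dots> \<le> (M + 1) * (e / (2 * (M + 1)))" using e M by (intro mult_right_mono) auto
    also have "\<dots> = e / 2" using M by (simp add: field_simps)
    finally have "cmod (pairing G a - ?L F) \<le> e / 2" .
    then have "cmod (pairing G a) \<le> cmod (?L F) + e / 2"
      using norm_triangle_sub[of "pairing G a" "?L F"] by linarith
    then show "mnorm ?\<rho> - e \<le> cmod (ev ?\<rho> F)"
      unfolding ev\<rho>[OF F] using a(2) t2 \<rho>N by linarith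
  qed
qed

section \<open>From approximate densities to finite-rank approximation\<close>

lemma c0_small_outside:
  assumes "finite H" "\<And>h. h \<in> H \<Longrightarrow> c0 h" "\<eta> > 0"
  obtains C where "compactin X C" "\<forall>h\<in>H. \<forall>x\<in>topspace X - C. cmod (h x) < \<eta>"
proof -
  have "\<exists>C. compactin X C \<and> (\<forall>x\<in>topspace X - C. cmod (h x) < \<eta>)" if "h \<in> H" for h
    using assms(2)[OF that] assms(3) by (simp add: c0_def)
  then obtain C where C: "\<And>h. h \<in> H \<Longrightarrow> compactin X (C h) \<and> (\<forall>x\<in>topspace X - C h. cmod (h x) < \<eta>)"
    by metis
  show ?thesis
  proof (rule that[of "\<Union> (C ` H)"])
    show "compactin X (\<Union> (C ` H))" using assms(1) C by (intro compactin_Union) auto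
  qed (use C in blast)
qed

lemma open_oscillation:
  assumes "finite H" "\<And>h. h \<in> H \<Longrightarrow> continuous_map X euclidean (h :: 'a \<Rightarrow> complex)"
  shows "openin X {x \<in> topspace X. \<forall>h\<in>H. cmod (h x - h p) < \<eta>}"
proof -
  have "openin X {x \<in> topspace X. h x \<in> ball (h p) \<eta>}" if "h \<in> H" for h
    using openin_continuous_map_preimage[OF assms(2)[OF that], of "ball (h p) \<eta>"] by simp
  then have "openin X (topspace X \<inter> \<Inter> ((\<lambda>h. {x \<in> topspace X. h x \<in> ball (h p) \<eta>}) ` H))"
    using assms(1) by (cases "H = {}") (auto intro!: openin_Int openin_Inter)
  moreover have "topspace X \<inter> \<Inter> ((\<lambda>h. {x \<in> topspace X. h x \<in> ball (h p) \<eta>}) ` H) =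
      {x \<in> topspace X. \<forall>h\<in>H. cmod (h x - h p) < \<eta>}"
    by (auto simp: dist_norm norm_minus_commute)
  ultimately show ?thesis by (simp only:)
qed

end

lemma norm_diff_add_le:
  fixes z :: "'b::real_normed_vector"
  assumes "z = u - v + w" "norm u = a" "norm v \<le> b" "norm w \<le> c"
  shows "norm z \<le> a + b + c"
  unfolding assms(1) using norm_triangle_ineq[of "u - v" w] norm_triangle_ineq4[of u v] assms(2-4) by linarith

context lch_space
begin

text \<open>A conditional expectation: \<open>\<nu> k\<close> is \<open>\<rho> (f k * _)\<close>
  divided by \<open>\<rho> (f k)\<close>. On a small cell the density \<open>h \<mu>\<close> is
  nearly constant, so \<open>\<mu> (f k)\<close> is close to \<open>h \<mu> k\<close> times
  \<open>\<rho> (f k)\<close>, and the sum of the \<open>\<mu> (f k) * \<nu> k g\<close> is close to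
  \<open>\<mu> g\<close>. The members of \<open>H\<close> are nearly constant on the cells as well
  and are almost reproduced. As \<rho> is only nearly positive, some cells need a different
  \<open>\<nu> k\<close>.\<close>

lemma local_reflexivity:
  assumes H: "finite H" "H \<subseteq> CX" and G: "finite G" "G \<subseteq> MX" and e: "e > 0"
  obtains D :: "'a set" and f \<nu> where "finite D"
    "\<forall>k\<in>D. \<nu> k \<in> MX" "\<forall>k\<in>D. mnorm (\<nu> k) \<le> 2" "\<forall>k\<in>D. c0 (\<lambda>x. complex_of_real (f k x))"
    "\<forall>k\<in>D. \<forall>x\<in>topspace X. 0 \<le> f k x" "\<forall>x\<in>topspace X. (\<Sum>k\<in>D. f k x) \<le> 1"
    "\<forall>a\<in>H. \<forall>x\<in>topspace X. cmod ((\<Sum>k\<in>D. ev (\<nu> k) a * of_real (f k x)) - a x) \<le> e"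
    "\<forall>\<mu>\<in>G. \<forall>g. unit_ball g \<longrightarrow>
      cmod (ev \<mu> g - (\<Sum>k\<in>D. ev \<mu> (\<lambda>x. of_real (f k x)) * ev (\<nu> k) g)) \<le> e"
proof -
  \<comment> \<open>The final estimate collects the errors 1, 1, 6 and 2 times \<epsilon>.\<close>
  define \<epsilon> where "\<epsilon> = e / 10"
  have \<epsilon>: "\<epsilon> > 0" using e by (simp add: \<epsilon>_def)
  obtain \<rho> h \<eta>0 where \<rho>: "\<rho> \<in> MX" and \<eta>0: "\<eta>0 > 0"
    and h1: "\<forall>\<mu>\<in>G. c0 (h \<mu>)" and h2: "\<forall>\<mu>\<in>G. \<forall>x\<in>topspace X. cmod (h \<mu> x) \<le> 1"
    and RN0: "\<forall>\<mu>\<in>G. \<forall>g. unit_ball g \<longrightarrow> cmod (ev \<mu> g - ev \<rho> (\<lambda>x. h \<mu> x * g x)) \<le> \<epsilon>"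
    and pos0: "\<forall>F. c0 F \<longrightarrow> (\<forall>\<mu>\<in>G. \<forall>x\<in>topspace X. cmod (h \<mu> x) * cmod (1 - F x) \<le> \<eta>0) \<longrightarrow>
      mnorm \<rho> - \<epsilon> \<le> cmod (ev \<rho> F)"
    by (rule approximate_Radon_Nikodym[OF G \<epsilon>]) (rule that)
  note h = h1[rule_format] h2[rule_format] and RN = RN0[rule_format]
  define M where "M = mnorm \<rho>"
  have M: "M \<ge> 0" unfolding M_def by (rule mnorm_nonneg[OF \<rho>])
  \<comment> \<open>\<open>\<eta>0\<close> is the tolerance for near positivity; the second bound
    gives \<open>\<eta> * M \<le> \<epsilon>\<close>, so that oscillation errors summed over all
    cells stay small.\<close>
  define \<eta> where "\<eta> = min \<eta>0 (min (\<epsilon> / (M + 1)) \<epsilon>)"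
  have \<eta>: "\<eta> > 0" "\<eta> \<le> \<eta>0" "\<eta> \<le> \<epsilon>"
    unfolding \<eta>_def using \<epsilon> M \<eta>0 by (auto intro: min.coboundedI1 min.coboundedI2)
  have \<eta>M: "\<eta> * M \<le> \<epsilon>"
  proof -
    have "\<eta> * M \<le> (\<epsilon> / (M + 1)) * (M + 1)"
      using M \<eta>(1) by (intro mult_mono) (auto simp: \<eta>_def)
    then show ?thesis using M by simp
  qed
  \<comment> \<open>One partition has to control the oscillation of the given functions and of the
    densities together.\<close>
  define A where "A = H \<union> h ` G"
  have A: "finite A" "\<And>a. a \<in> A \<Longrightarrow> c0 a"
    using H G h CX_c0 by (auto simp: A_def)
  obtain C where C1: "compactin X C" and C2: "\<forall>a\<in>A. \<forall>x\<in>topspace X - C. cmod (a x) < \<eta>"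
    by (rule c0_small_outside[OF A \<eta>(1)])
  note C = C1 C2[rule_format, OF _ DiffI]
  have CX: "C \<subseteq> topspace X" using C(1) by (rule compactin_subset_topspace)
  let ?V = "\<lambda>p. {x \<in> topspace X. \<forall>a\<in>A. cmod (a x - a p) < \<eta>}"
  have V: "openin X (?V p) \<and> p \<in> ?V p" if "p \<in> C" for p
    using open_oscillation[OF A(1) c0_continuous[OF A(2)]] that CX \<eta>(1) by auto
  obtain D f where D: "finite D" "D \<subseteq> C"
    and f1: "\<forall>p\<in>D. c0 (\<lambda>x. complex_of_real (f p x))"
    and f2: "\<forall>p\<in>D. \<forall>x\<in>topspace X. 0 \<le> f p x"
    and f3: "\<forall>p\<in>D. \<forall>x\<in>topspace X. x \<notin> ?V p \<longrightarrow> f p x = 0"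
    and f4: "\<forall>x\<in>topspace X. (\<Sum>p\<in>D. f p x) \<le> (1::real)"
    and f5: "\<forall>x\<in>C. (\<Sum>p\<in>D. f p x) = 1"
    by (rule partition_of_unity[OF C(1) V])
  note f = f1[rule_format] f2[rule_format] f3[rule_format] f4[rule_format] f5[rule_format]
  have DX: "k \<in> topspace X" if "k \<in> D" for k using that D(2) CX by blast
  have supp: "cmod (a x - a k) < \<eta>" if "k \<in> D" "x \<in> topspace X" "f k x \<noteq> 0" "a \<in> A" for a k x
    using f(3)[OF that(1,2)] that(3,4) by blast
  let ?S = "\<lambda>x. \<Sum>p\<in>D. f p x"
  have S: "0 \<le> ?S x" "?S x \<le> 1" if "x \<in> topspace X" for x
    using f(2) that f(4)[OF that] by (auto intro: sum_nonneg)
  have tail: "cmod (a x) * cmod (1 - of_real (?S x)) \<le> \<eta>" if "a \<in> A" "x \<in> topspace X" for a x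
  proof (cases "x \<in> C")
    case True
    then show ?thesis using f(5)[OF True] \<eta>(1) by simp
  next
    case False
    have "cmod (1 - complex_of_real (?S x)) = \<bar>1 - ?S x\<bar>"
      by (metis norm_of_real of_real_1 of_real_diff)
    also have "\<dots> \<le> 1" using S[OF that(2)] by linarith
    finally have "cmod (a x) * cmod (1 - complex_of_real (?S x)) \<le> \<eta> * 1"
      using C(2)[OF that False] \<eta>(1) by (intro mult_mono) auto
    then show ?thesis by simp
  qed
  \<comment> \<open>The bound by 1 is asked for only on the support of \<open>f k\<close>. This
    admits the rescaled oscillations \<open>(a x - a k) / \<eta>\<close>, which may be large
    elsewhere.\<close>
  define Q where "Q = (\<lambda>k. {q. continuous_map X euclidean q \<and>
    (\<forall>x\<in>topspace X. f k x \<noteq> 0 \<longrightarrow> cmod (q x) \<le> 1)})"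
  define r where "r = (\<lambda>k q. ev \<rho> (\<lambda>x. of_real (f k x) * q x))"
  have fq: "cmod (of_real (f k x) * q x) \<le> f k x" if "k \<in> D" "q \<in> Q k" "x \<in> topspace X" for k q x
  proof (cases "f k x = 0")
    case False
    have "f k x * cmod (q x) \<le> f k x * 1"
      using f(2)[OF that(1,3)] that False by (intro mult_left_mono) (auto simp: Q_def)
    then show ?thesis using f(2)[OF that(1,3)] by (simp add: norm_mult)
  qed simp
  have fqc: "c0 (\<lambda>x. of_real (f k x) * q x)" if "k \<in> D" "q \<in> Q k" for k q
  proof (rule c0_dominated[OF f(1)[OF that(1)], where B = 1])
    show "continuous_map X euclidean (\<lambda>x. of_real (f k x) * q x)"
      using that(2) by (intro continuous_map_complex_mult[OF c0_continuous[OF f(1)[OF that(1)]]]) (simp add: Q_def)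
    fix x assume "x \<in> topspace X"
    then show "cmod (of_real (f k x) * q x) \<le> 1 * cmod (of_real (f k x))"
      using fq[OF that] f(2)[OF that(1)] by (simp only: norm_of_real abs_of_nonneg mult_1)
  qed
  \<comment> \<open>The test functions may be chosen separately on each cell and the masses still
    add up to at most \<open>M\<close>. Every estimate on bad cells comes from playing this against
    \<open>total\<close>.\<close>
  have superadd: "(\<Sum>k\<in>D. cmod (r k (q k))) \<le> M" if q: "\<And>k. k \<in> D \<Longrightarrow> q k \<in> Q k" for q
    unfolding r_def M_def
  proof (rule sum_cmod_ev_le[OF \<rho>])
    show "c0 (\<lambda>x. of_real (f k x) * q k x)" if "k \<in> D" for k by (rule fqc[OF that q[OF that]])
    fix x assume x: "x \<in> topspace X"
    have "(\<Sum>k\<in>D. cmod (of_real (f k x) * q k x)) \<le> ?S x" by (intro sum_mono fq q x)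
    then show "(\<Sum>k\<in>D. cmod (of_real (f k x) * q k x)) \<le> 1" using S(2)[OF x] by linarith
  qed
  have one: "(\<lambda>x. 1) \<in> Q k" for k by (simp add: Q_def)
  have unitQ: "g \<in> Q k" if "unit_ball g" for g k
    using that by (auto simp: Q_def unit_ball_def c0_continuous)
  have oscQ: "(\<lambda>x. of_real (1/\<eta>) * (a x - a k)) \<in> Q k" if "k \<in> D" "a \<in> A" for a k
    unfolding Q_def
  proof (intro CollectI conjI ballI impI)
    show "continuous_map X euclidean (\<lambda>x. of_real (1/\<eta>) * (a x - a k))"
      using c0_continuous[OF A(2)[OF that(2)]]
      by (intro continuous_map_complex_mult continuous_map_diff) simp_all
    fix x assume "x \<in> topspace X" "f k x \<noteq> 0"
    then have "cmod (a x - a k) < \<eta>" using supp that by blast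
    then show "cmod (of_real (1/\<eta>) * (a x - a k)) \<le> 1"
      using \<eta>(1) unfolding norm_mult norm_of_real by (simp add: field_simps)
  qed
  have QQ: "(\<lambda>x. q x * g x) \<in> Q k" if "q \<in> Q k" "unit_ball g" for q g k
    unfolding Q_def
  proof (intro CollectI conjI ballI impI)
    show "continuous_map X euclidean (\<lambda>x. q x * g x)"
      using that(1)
      by (intro continuous_map_complex_mult[OF _ c0_continuous[OF unit_ball_c0[OF that(2)]]]) (simp add: Q_def)
    fix x assume "x \<in> topspace X" "f k x \<noteq> 0"
    then have "cmod (q x) * cmod (g x) \<le> 1 * 1"
      using that by (intro mult_mono) (auto simp: Q_def unit_ball_def)
    then show "cmod (q x * g x) \<le> 1" by (simp add: norm_mult)
  qed
  \<comment> \<open>The indices where \<open>\<rho>\<close> is far from positive on the support of \<open>f k\<close> carry little mass.\<close>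
  define good where "good = (\<lambda>k. r k (\<lambda>x. 1) \<noteq> 0 \<and> (\<forall>q\<in>Q k. cmod (r k q) \<le> 2 * cmod (r k (\<lambda>x. 1))))"
  let ?one = "\<lambda>k. cmod (r k (\<lambda>x. 1))"
  let ?B = "{k \<in> D. \<not> good k}"
  have split: "(\<Sum>k\<in>D. if good k then u k else v k) = sum u D - sum u ?B + sum v ?B" for u v :: "'a \<Rightarrow> real"
  proof -
    have "(\<Sum>k\<in>D. if good k then u k else v k) = (\<Sum>k\<in>D. u k - (if good k then 0 else u k) + (if good k then 0 else v k))"
      by (intro sum.cong) auto
    also have "\<dots> = sum u D - (\<Sum>k\<in>D. if \<not> good k then u k else 0) + (\<Sum>k\<in>D. if \<not> good k then v k else 0)"
      unfolding sum.distrib sum_subtractf by (intro arg_cong2[where f = plus] arg_cong2[where f = minus] sum.cong) auto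
    finally show ?thesis using D(1) by (simp add: sum.inter_filter)
  qed
  \<comment> \<open>Near positivity tested at the sum of the partition, which differs from 1 only
    off \<open>C\<close>, where all densities are small.\<close>
  have total: "M - \<epsilon> \<le> sum ?one D"
  proof -
    have "c0 (\<lambda>x. of_real (?S x))" unfolding of_real_sum by (intro c0_sum f(1))
    then have "mnorm \<rho> - \<epsilon> \<le> cmod (ev \<rho> (\<lambda>x. of_real (?S x)))"
    proof (rule pos0[rule_format])
      fix \<mu> x assume "\<mu> \<in> G" "x \<in> topspace X"
      then show "cmod (h \<mu> x) * cmod (1 - of_real (?S x)) \<le> \<eta>0"
        using tail[of "h \<mu>" x] \<eta>(2) by (auto simp: A_def)
    qed
    also have "ev \<rho> (\<lambda>x. of_real (?S x)) = (\<Sum>k\<in>D. r k (\<lambda>x. 1))"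
      unfolding of_real_sum r_def mult_1_right by (intro ev_sum \<rho> f(1))
    finally show ?thesis
      using norm_sum[of "\<lambda>k. r k (\<lambda>x. 1)" D] unfolding M_def by linarith
  qed
  \<comment> \<open>A bad cell has a test function with at least twice the mass of the constant 1.
    Using these functions on the bad cells would push the sum above \<open>M\<close> if the bad
    cells carried more than \<epsilon>.\<close>
  have "\<exists>q. q \<in> Q k \<and> 2 * ?one k \<le> cmod (r k q)" if "k \<in> ?B" for k
  proof (cases "r k (\<lambda>x. 1) = 0")
    case True
    then show ?thesis using one by (intro exI[of _ "\<lambda>x. 1"]) simp
  next
    case False
    with that show ?thesis by (auto simp: good_def not_le intro: less_imp_le)
  qed
  then obtain q where q: "\<And>k. k \<in> ?B \<Longrightarrow> q k \<in> Q k \<and> 2 * ?one k \<le> cmod (r k (q k))"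
    by metis
  have bad1: "sum ?one ?B \<le> \<epsilon>"
  proof -
    have "(\<Sum>k\<in>D. cmod (r k (if good k then (\<lambda>x. 1) else q k))) \<le> M"
      using q one by (intro superadd) auto
    also have "(\<Sum>k\<in>D. cmod (r k (if good k then (\<lambda>x. 1) else q k))) =
        (\<Sum>k\<in>D. if good k then ?one k else cmod (r k (q k)))"
      by (intro sum.cong) auto
    finally have "sum ?one D - sum ?one ?B + (\<Sum>k\<in>?B. cmod (r k (q k))) \<le> M"
      unfolding split .
    moreover have "(\<Sum>k\<in>?B. 2 * ?one k) \<le> (\<Sum>k\<in>?B. cmod (r k (q k)))"
      using q by (intro sum_mono) blast
    ultimately show ?thesis using total unfolding sum_distrib_left[symmetric] by linarith
  qed
  \<comment> \<open>Replacing the constant by \<open>g\<close> on bad cells only: the good cells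
    already account for \<open>M\<close> up to \<open>2 * \<epsilon>\<close>.\<close>
  have bad2: "(\<Sum>k\<in>?B. cmod (r k g)) \<le> 2 * \<epsilon>" if "unit_ball g" for g
  proof -
    have "(\<Sum>k\<in>D. cmod (r k (if good k then (\<lambda>x. 1) else g))) \<le> M"
      using unitQ[OF that] one by (intro superadd) auto
    also have "(\<Sum>k\<in>D. cmod (r k (if good k then (\<lambda>x. 1) else g))) =
        (\<Sum>k\<in>D. if good k then ?one k else cmod (r k g))"
      by (intro sum.cong) auto
    finally have "sum ?one D - sum ?one ?B + (\<Sum>k\<in>?B. cmod (r k g)) \<le> M"
      unfolding split .
    then show ?thesis using total bad1 by linarith
  qed
  have r_add: "r k (\<lambda>x. p x + q x) = r k p + r k q"
    if "k \<in> D" "c0 (\<lambda>x. of_real (f k x) * p x)" "c0 (\<lambda>x. of_real (f k x) * q x)" for k p q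
    unfolding r_def distrib_left by (rule ev_add[OF \<rho> that(2,3)])
  have r_scale: "r k (\<lambda>x. c * q x) = c * r k q" if "c0 (\<lambda>x. of_real (f k x) * q x)" for k c q
    unfolding r_def mult.left_commute[of _ c] by (rule ev_scale[OF \<rho> that])
  \<comment> \<open>On a bad cell the evaluation at the sample point is a harmless substitute: it
    has norm at most 1, gives exactly \<open>a k\<close>, and its other effects are weighted by the
    small masses in \<open>bad1\<close> and \<open>bad2\<close>.\<close>
  define \<nu> where "\<nu> = (\<lambda>k. if good k then restrict (\<lambda>g. r k g / r k (\<lambda>x. 1)) CX else dirac k)"
  have \<nu>_good: "\<nu> k \<in> MX \<and> (\<forall>g. c0 g \<longrightarrow> ev (\<nu> k) g = r k g / r k (\<lambda>x. 1)) \<and> mnorm (\<nu> k) \<le> 2"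
    if k: "k \<in> D" "good k" for k
  proof -
    let ?L = "\<lambda>g. r k g / r k (\<lambda>x. 1)"
    have fg: "c0 (\<lambda>x. of_real (f k x) * g x)" if "c0 g" for g
      by (rule c0_mult[OF f(1)[OF k(1)] that])
    have L1: "?L (\<lambda>x. p x + g x) = ?L p + ?L g" if "c0 p" "c0 g" for p g
      unfolding r_add[OF k(1) fg[OF that(1)] fg[OF that(2)]] by (rule add_divide_distrib)
    have L2: "?L (\<lambda>x. c * p x) = c * ?L p" if "c0 p" for p c
      unfolding r_scale[OF fg[OF that]] by simp
    have L3: "?L p = ?L g" if "\<And>x. x \<in> topspace X \<Longrightarrow> p x = g x" for p g
      unfolding r_def by (intro arg_cong2[where f = divide] refl ev_cong) (simp only: that)
    have L4: "cmod (?L g) \<le> 2" if "unit_ball g" for g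
      using k(2) unitQ[OF that, of k] unfolding good_def norm_divide
      by (simp add: divide_le_eq)
    show ?thesis
    proof (intro conjI allI impI)
      show "\<nu> k \<in> MX" unfolding \<nu>_def if_P[OF k(2)]
        by (rule functional_intro(1)[where L = ?L and B = 2]) (fact L1 L2 L3 L4)+
      show "ev (\<nu> k) g = ?L g" if "c0 g" for g unfolding \<nu>_def if_P[OF k(2)]
        by (rule functional_intro(2)[where L = ?L and B = 2]) (fact L1 L2 L3 L4 that)+
      show "mnorm (\<nu> k) \<le> 2" unfolding \<nu>_def if_P[OF k(2)]
        by (rule functional_intro(3)[where L = ?L and B = 2]) (fact L1 L2 L3 L4)+
    qed
  qed
  have \<nu>_bad: "\<nu> k \<in> MX \<and> (\<forall>g. c0 g \<longrightarrow> ev (\<nu> k) g = g k) \<and> mnorm (\<nu> k) \<le> 2"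
    if "k \<in> D" "\<not> good k" for k
    unfolding \<nu>_def if_not_P[OF that(2)]
    using dirac_MX ev_dirac mnorm_dirac DX[OF that(1)] by force
  have \<nu>: "\<nu> k \<in> MX" "mnorm (\<nu> k) \<le> 2" if "k \<in> D" for k
    using \<nu>_good[OF that] \<nu>_bad[OF that] by blast+
  have \<nu>2: "cmod (ev (\<nu> k) g) \<le> 2" if "k \<in> D" "unit_ball g" for k g
    using ev_bound_unit[OF \<nu>(1)[OF that(1)] that(2)] \<nu>(2)[OF that(1)] by linarith
  have osc: "r k a - a k * r k (\<lambda>x. 1) = of_real \<eta> * r k (\<lambda>x. of_real (1/\<eta>) * (a x - a k))"
    if "k \<in> D" "a \<in> A" for a k
  proof -
    have c: "c0 (\<lambda>x. of_real (f k x) * (of_real (1/\<eta>) * (a x - a k)))"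
      by (rule fqc[OF that(1) oscQ[OF that]])
    have 1: "c0 (\<lambda>x. of_real (f k x) * 1)" by (rule fqc[OF that(1) one])
    have "r k a = r k (\<lambda>x. a k * 1 + of_real \<eta> * (of_real (1/\<eta>) * (a x - a k)))"
      using \<eta>(1) by (intro arg_cong[where f = "r k"]) (auto simp: fun_eq_iff)
    also have "\<dots> = r k (\<lambda>x. a k * 1) + r k (\<lambda>x. of_real \<eta> * (of_real (1/\<eta>) * (a x - a k)))"
      using c0_scale[OF 1, of "a k"] c0_scale[OF c, of "of_real \<eta>"]
      by (intro r_add that(1)) (simp_all only: mult.left_commute)
    also have "\<dots> = a k * r k (\<lambda>x. 1) + of_real \<eta> * r k (\<lambda>x. of_real (1/\<eta>) * (a x - a k))"
      by (intro arg_cong2[where f = plus] r_scale c 1)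
    finally show ?thesis by simp
  qed
  \<comment> \<open>After the value at the sample point is split off, \<eta> times a member of
    \<open>Q k\<close> remains, which goodness bounds by twice the mass of the cell.\<close>
  have \<nu>_osc: "cmod (ev (\<nu> k) a - a k) \<le> 2 * \<eta>" if "k \<in> D" "a \<in> A" for a k
  proof (cases "good k")
    case False
    then show ?thesis using \<nu>_bad[OF that(1) False] A(2)[OF that(2)] \<eta>(1) by simp
  next
    case True
    let ?q = "\<lambda>x. of_real (1/\<eta>) * (a x - a k)"
    have nz: "r k (\<lambda>x. 1) \<noteq> 0" using True by (simp add: good_def)
    have "ev (\<nu> k) a - a k = (r k a - a k * r k (\<lambda>x. 1)) / r k (\<lambda>x. 1)"
      using \<nu>_good[OF that(1) True] A(2)[OF that(2)] nz by (simp add: field_simps)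
    also have "cmod \<dots> = \<eta> * cmod (r k ?q) / ?one k"
      unfolding osc[OF that] norm_divide norm_mult norm_of_real using \<eta>(1) by simp
    also have "\<dots> \<le> \<eta> * (2 * ?one k) / ?one k"
      using oscQ[OF that] True \<eta>(1) by (intro divide_right_mono mult_left_mono) (auto simp: good_def)
    also have "\<dots> = 2 * \<eta>" using nz by simp
    finally show ?thesis .
  qed
  show ?thesis
  proof (rule that[of D \<nu> f]; (intro allI ballI impI)?)
    fix a x assume a: "a \<in> H" and x: "x \<in> topspace X"
    have aA: "a \<in> A" using a by (simp add: A_def)
    have "(\<Sum>k\<in>D. ev (\<nu> k) a * of_real (f k x)) - a x =
        (\<Sum>k\<in>D. (ev (\<nu> k) a - a x) * of_real (f k x)) - a x * (1 - of_real (?S x))"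
      by (simp add: left_diff_distrib sum_subtractf sum_distrib_left right_diff_distrib)
    also have "cmod \<dots> \<le> cmod (\<Sum>k\<in>D. (ev (\<nu> k) a - a x) * of_real (f k x)) + cmod (a x * (1 - of_real (?S x)))"
      by (rule norm_triangle_ineq4)
    also have "cmod (\<Sum>k\<in>D. (ev (\<nu> k) a - a x) * of_real (f k x)) \<le> (\<Sum>k\<in>D. 3 * \<eta> * f k x)"
    proof (rule sum_norm_le)
      fix k assume k: "k \<in> D"
      show "cmod ((ev (\<nu> k) a - a x) * of_real (f k x)) \<le> 3 * \<eta> * f k x"
      proof (cases "f k x = 0")
        case False
        have "cmod (ev (\<nu> k) a - a x) \<le> cmod (ev (\<nu> k) a - a k) + cmod (a k - a x)"
          using norm_triangle_ineq[of "ev (\<nu> k) a - a k" "a k - a x"] by simp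
        also have "\<dots> \<le> 3 * \<eta>"
          using \<nu>_osc[OF k aA] supp[OF k x False aA] by (simp add: norm_minus_commute)
        finally show ?thesis
          unfolding norm_mult norm_of_real using f(2)[OF k x] by (simp add: mult_right_mono)
      qed simp
    qed
    also have "\<dots> = 3 * \<eta> * ?S x" by (simp only: sum_distrib_left)
    also have "\<dots> \<le> 3 * \<eta> * 1" using S[OF x] \<eta>(1) by (intro mult_left_mono) auto
    also have "cmod (a x * (1 - of_real (?S x))) \<le> \<eta>"
      using tail[OF aA x] by (simp only: norm_mult)
    finally show "cmod ((\<Sum>k\<in>D. ev (\<nu> k) a * of_real (f k x)) - a x) \<le> e"
      using \<eta>(3) \<epsilon>_def e by linarith
  next
    fix \<mu> g assume \<mu>: "\<mu> \<in> G" and g: "unit_ball g"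
    have \<mu>M: "\<mu> \<in> MX" using G \<mu> by blast
    have hA: "h \<mu> \<in> A" using \<mu> by (simp add: A_def)
    have hc: "c0 (h \<mu>)" by (rule h(1)[OF \<mu>])
    have gc: "c0 g" by (rule unit_ball_c0[OF g])
    let ?n = "\<lambda>k. ev (\<nu> k) g"
    let ?fc = "\<lambda>k x. complex_of_real (f k x)"
    let ?q = "\<lambda>k x. of_real (1/\<eta>) * (h \<mu> x - h \<mu> k)"
    \<comment> \<open>The conditional expectation of \<open>g\<close>; the claim is that
      \<open>\<mu>\<close> hardly distinguishes it from \<open>g\<close>.\<close>
    let ?T = "\<lambda>x. \<Sum>k\<in>D. ?n k * ?fc k x"
    have Tc: "c0 ?T" by (intro c0_sum c0_scale f(1))
    have evT: "ev \<mu> ?T = (\<Sum>k\<in>D. ev \<mu> (?fc k) * ?n k)"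
    proof -
      have "ev \<mu> ?T = (\<Sum>k\<in>D. ev \<mu> (\<lambda>x. ?n k * ?fc k x))"
        by (intro ev_sum \<mu>M c0_scale f(1))
      also have "\<dots> = (\<Sum>k\<in>D. ?n k * ev \<mu> (?fc k))"
        by (intro sum.cong refl ev_scale \<mu>M f(1))
      finally show ?thesis by (simp only: mult.commute)
    qed
    have evhT: "ev \<rho> (\<lambda>x. h \<mu> x * ?T x) = (\<Sum>k\<in>D. r k (h \<mu>) * ?n k)"
    proof -
      have c: "c0 (\<lambda>x. ?fc k x * h \<mu> x)" if "k \<in> D" for k by (rule c0_mult[OF f(1)[OF that] hc])
      have "ev \<rho> (\<lambda>x. h \<mu> x * ?T x) = ev \<rho> (\<lambda>x. \<Sum>k\<in>D. ?n k * (?fc k x * h \<mu> x))"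
        by (intro ev_cong) (simp add: sum_distrib_left mult_ac)
      also have "\<dots> = (\<Sum>k\<in>D. ?n k * r k (h \<mu>))"
        unfolding r_def by (simp only: ev_sum[OF \<rho> c0_scale[OF c]] ev_scale[OF \<rho> c] cong: sum.cong)
      finally show ?thesis by (simp only: mult.commute)
    qed
    have E1: "cmod (ev \<mu> g - ev \<rho> (\<lambda>x. h \<mu> x * g x)) \<le> \<epsilon>" by (rule RN[OF \<mu> g])
    \<comment> \<open>The norms of the \<open>\<nu> k\<close> are bounded by 2, so half of
      \<open>?T\<close> is in the unit ball and the density estimate applies to it with doubled
      error.\<close>
    have E2: "cmod (ev \<mu> ?T - ev \<rho> (\<lambda>x. h \<mu> x * ?T x)) \<le> 2 * \<epsilon>"
    proof -
      let ?U = "\<lambda>x. (1/2) * ?T x"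
      have "unit_ball ?U"
        unfolding unit_ball_def
      proof (intro conjI ballI)
        show "c0 ?U" by (rule c0_scale[OF Tc])
        fix x assume x: "x \<in> topspace X"
        have "cmod (?T x) \<le> (\<Sum>k\<in>D. 2 * f k x)"
        proof (rule sum_norm_le)
          fix k assume k: "k \<in> D"
          show "cmod (?n k * ?fc k x) \<le> 2 * f k x"
            unfolding norm_mult norm_of_real using \<nu>2[OF k g] f(2)[OF k x] by (simp add: mult_right_mono)
        qed
        also have "\<dots> \<le> 2" using S[OF x] by (simp add: sum_distrib_left[symmetric])
        finally show "cmod (?U x) \<le> 1" by (simp add: norm_mult)
      qed
      then have "cmod (ev \<mu> ?U - ev \<rho> (\<lambda>x. h \<mu> x * ?U x)) \<le> \<epsilon>" by (rule RN[OF \<mu>])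
      moreover have "ev \<rho> (\<lambda>x. h \<mu> x * ?U x) = (1/2) * ev \<rho> (\<lambda>x. h \<mu> x * ?T x)"
        unfolding mult.left_commute[of _ "1/2"] by (rule ev_scale[OF \<rho> c0_mult[OF hc Tc]])
      moreover have "ev \<mu> ?U = (1/2) * ev \<mu> ?T" by (rule ev_scale[OF \<mu>M Tc])
      ultimately have "cmod ((1/2) * (ev \<mu> ?T - ev \<rho> (\<lambda>x. h \<mu> x * ?T x))) \<le> \<epsilon>"
        by (simp only: right_diff_distrib)
      then show ?thesis unfolding norm_mult by simp
    qed
    have rhg: "r k (\<lambda>x. h \<mu> x * g x) = h \<mu> k * r k g + of_real \<eta> * r k (\<lambda>x. ?q k x * g x)" if k: "k \<in> D" for k
    proof -
      have c: "c0 (\<lambda>x. ?fc k x * (?q k x * g x))" by (rule fqc[OF k QQ[OF oscQ[OF k hA] g]])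
      have c': "c0 (\<lambda>x. ?fc k x * g x)" by (rule c0_mult[OF f(1)[OF k] gc])
      have "r k (\<lambda>x. h \<mu> x * g x) = r k (\<lambda>x. h \<mu> k * g x + of_real \<eta> * (?q k x * g x))"
        using \<eta>(1) by (intro arg_cong[where f = "r k"]) (auto simp: fun_eq_iff field_simps)
      also have "\<dots> = r k (\<lambda>x. h \<mu> k * g x) + r k (\<lambda>x. of_real \<eta> * (?q k x * g x))"
        using c0_scale[OF c', of "h \<mu> k"] c0_scale[OF c, of "of_real \<eta>"]
        by (intro r_add k) (simp_all only: mult.left_commute)
      also have "\<dots> = h \<mu> k * r k g + of_real \<eta> * r k (\<lambda>x. ?q k x * g x)"
        by (intro arg_cong2[where f = plus] r_scale c c')
      finally show ?thesis .
    qed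
    have E3: "cmod (ev \<rho> (\<lambda>x. h \<mu> x * g x) - (\<Sum>k\<in>D. r k (\<lambda>x. h \<mu> x * g x))) \<le> \<epsilon>"
    proof -
      have hg: "c0 (\<lambda>x. h \<mu> x * g x)" by (rule c0_mult[OF hc gc])
      have c: "c0 (\<lambda>x. ?fc k x * (h \<mu> x * g x))" if "k \<in> D" for k by (rule c0_mult[OF f(1)[OF that] hg])
      have "(\<Sum>k\<in>D. r k (\<lambda>x. h \<mu> x * g x)) = ev \<rho> (\<lambda>x. \<Sum>k\<in>D. ?fc k x * (h \<mu> x * g x))"
        unfolding r_def by (intro ev_sum[symmetric] \<rho> c)
      then have "ev \<rho> (\<lambda>x. h \<mu> x * g x) - (\<Sum>k\<in>D. r k (\<lambda>x. h \<mu> x * g x)) =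
          ev \<rho> (\<lambda>x. h \<mu> x * g x - (\<Sum>k\<in>D. ?fc k x * (h \<mu> x * g x)))"
        by (simp only: ev_diff[OF \<rho> hg c0_sum[OF c]])
      also have "cmod \<dots> \<le> M * \<eta>"
        unfolding M_def
      proof (rule ev_bound[OF \<rho>])
        show "c0 (\<lambda>x. h \<mu> x * g x - (\<Sum>k\<in>D. ?fc k x * (h \<mu> x * g x)))"
          by (intro c0_diff hg c0_sum c)
        fix x assume x: "x \<in> topspace X"
        have "h \<mu> x * g x - (\<Sum>k\<in>D. ?fc k x * (h \<mu> x * g x)) = h \<mu> x * (1 - of_real (?S x)) * g x"
          by (simp add: sum_distrib_left right_diff_distrib left_diff_distrib mult_ac)
        also have "cmod \<dots> \<le> \<eta> * 1"
          unfolding norm_mult using tail[OF hA x] g x \<eta>(1)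
          by (intro mult_mono) (auto simp: unit_ball_def)
        finally show "cmod (h \<mu> x * g x - (\<Sum>k\<in>D. ?fc k x * (h \<mu> x * g x))) \<le> \<eta>" by simp
      qed (use \<eta> in simp)
      finally show ?thesis using \<eta>M by (simp add: mult.commute)
    qed
    \<comment> \<open>On a good cell \<open>r k g\<close> equals
      \<open>r k (\<lambda>x. 1) * ?n k\<close>, so only oscillation terms survive: one for
      \<open>h \<mu> * g\<close> and one, doubled by the bound 2 on \<open>?n k\<close>, for
      \<open>h \<mu>\<close>. They sum to at most \<open>3 * (\<eta> * M)\<close>; the bad cells add
      \<open>3 * \<epsilon>\<close>.\<close>
    have E4: "cmod ((\<Sum>k\<in>D. r k (\<lambda>x. h \<mu> x * g x)) - (\<Sum>k\<in>D. r k (h \<mu>) * ?n k)) \<le> 6 * \<epsilon>"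
    proof -
      have summand: "cmod (r k (\<lambda>x. h \<mu> x * g x) - r k (h \<mu>) * ?n k) \<le>
          \<eta> * cmod (r k (\<lambda>x. ?q k x * g x)) + 2 * (\<eta> * cmod (r k (?q k))) +
          (if good k then 0 else cmod (r k g) + ?one k)" if k: "k \<in> D" for k
      proof -
        have "r k (h \<mu>) = h \<mu> k * r k (\<lambda>x. 1) + of_real \<eta> * r k (?q k)"
          using osc[OF k hA] by (simp add: algebra_simps)
        then have "r k (\<lambda>x. h \<mu> x * g x) - r k (h \<mu>) * ?n k =
            of_real \<eta> * r k (\<lambda>x. ?q k x * g x) - of_real \<eta> * r k (?q k) * ?n k +
            h \<mu> k * (r k g - r k (\<lambda>x. 1) * ?n k)"
          unfolding rhg[OF k] by (simp only: algebra_simps)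
        moreover have "cmod (of_real \<eta> * r k (\<lambda>x. ?q k x * g x)) = \<eta> * cmod (r k (\<lambda>x. ?q k x * g x))"
          unfolding norm_mult norm_of_real using \<eta>(1) by simp
        moreover have "cmod (of_real \<eta> * r k (?q k) * ?n k) \<le> 2 * (\<eta> * cmod (r k (?q k)))"
        proof -
          have "cmod (of_real \<eta> * r k (?q k) * ?n k) = (\<eta> * cmod (r k (?q k))) * cmod (?n k)"
            unfolding norm_mult norm_of_real using \<eta>(1) by simp
          also have "\<dots> \<le> (\<eta> * cmod (r k (?q k))) * 2"
            using \<nu>2[OF k g] \<eta>(1) by (intro mult_left_mono) auto
          finally show ?thesis by simp
        qed
        moreover have "cmod (h \<mu> k * (r k g - r k (\<lambda>x. 1) * ?n k)) \<le> (if good k then 0 else cmod (r k g) + ?one k)"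
        proof (cases "good k")
          case True
          then show ?thesis using \<nu>_good[OF k True] gc by (simp add: good_def)
        next
          case False
          have "?n k = g k" using \<nu>_bad[OF k False] gc by blast
          then have n1: "cmod (?n k) \<le> 1" using g DX[OF k] by (simp add: unit_ball_def)
          have "cmod (h \<mu> k) * cmod (r k g - r k (\<lambda>x. 1) * ?n k) \<le> 1 * (cmod (r k g) + ?one k * cmod (?n k))"
            using h(2)[OF \<mu> DX[OF k]] norm_triangle_ineq4[of "r k g" "r k (\<lambda>x. 1) * ?n k"]
            by (intro mult_mono) (auto simp: norm_mult)
          also have "\<dots> \<le> cmod (r k g) + ?one k"
            using mult_left_mono[OF n1, of "?one k"] by simp
          finally show ?thesis using False by (simp only: norm_mult if_False)
        qed
        ultimately show ?thesis by (rule norm_diff_add_le)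
      qed
      have "cmod (\<Sum>k\<in>D. r k (\<lambda>x. h \<mu> x * g x) - r k (h \<mu>) * ?n k) \<le>
          (\<Sum>k\<in>D. \<eta> * cmod (r k (\<lambda>x. ?q k x * g x)) + 2 * (\<eta> * cmod (r k (?q k))) +
            (if good k then 0 else cmod (r k g) + ?one k))"
        by (rule sum_norm_le) (rule summand)
      also have "\<dots> = \<eta> * (\<Sum>k\<in>D. cmod (r k (\<lambda>x. ?q k x * g x))) + 2 * (\<eta> * (\<Sum>k\<in>D. cmod (r k (?q k)))) +
          ((\<Sum>k\<in>?B. cmod (r k g)) + sum ?one ?B)"
        using split[of "\<lambda>_. 0" "\<lambda>k. cmod (r k g) + ?one k"]
        by (simp add: sum.distrib sum_distrib_left)
      also have "\<dots> \<le> \<eta> * M + 2 * (\<eta> * M) + (2 * \<epsilon> + \<epsilon>)"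
        using \<eta>(1) by (intro add_mono mult_left_mono superadd bad1 bad2 g QQ oscQ hA) auto
      also have "\<dots> \<le> 6 * \<epsilon>" using \<eta>M by linarith
      finally show ?thesis by (simp only: sum_subtractf)
    qed
    \<comment> \<open>A chain from \<open>\<mu>\<close> to its density, to the sum over cells, to
      conditional values on the cells, and back to \<open>\<mu>\<close>.\<close>
    have "ev \<mu> g - ev \<mu> ?T = (ev \<mu> g - ev \<rho> (\<lambda>x. h \<mu> x * g x)) +
        (ev \<rho> (\<lambda>x. h \<mu> x * g x) - (\<Sum>k\<in>D. r k (\<lambda>x. h \<mu> x * g x))) +
        ((\<Sum>k\<in>D. r k (\<lambda>x. h \<mu> x * g x)) - (\<Sum>k\<in>D. r k (h \<mu>) * ?n k)) -
        (ev \<mu> ?T - ev \<rho> (\<lambda>x. h \<mu> x * ?T x))"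
      unfolding evhT by simp
    also have "cmod \<dots> \<le> \<epsilon> + \<epsilon> + 6 * \<epsilon> + 2 * \<epsilon>"
      by (intro norm_triangle_mono order_trans[OF norm_triangle_ineq4 add_mono] E1 E2 E3 E4)
    finally show "cmod (ev \<mu> g - (\<Sum>k\<in>D. ev \<mu> (?fc k) * ?n k)) \<le> e"
      unfolding evT by (simp add: \<epsilon>_def)
  qed (use D f \<nu> in auto)
qed

end

section \<open>Ultrapowers\<close>

lemma linf_ops [simp]:
  "vadd (linf E I) x y = (\<lambda>i\<in>I. vadd E (x i) (y i))"
  "vscale (linf E I) c x = (\<lambda>i\<in>I. vscale E c (x i))"
  by (simp_all only: linf_def normed_space.select_convs)

lemma vnorm_linf: "vnorm (linf E I) x = (SUP i\<in>I. vnorm E (x i))"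
  by (simp only: linf_def normed_space.select_convs)

locale C0_ultrapower = lch_space +
  fixes I :: "'i set" and U :: "'i filter"
  assumes admissible: "admissible_ultrafilter I U"
begin

abbreviation "LX \<equiv> vecs (linf (C0 X) I)"
abbreviation "rel \<equiv> ultra_rel (C0 X) I U"
abbreviation "cls \<equiv> ultra_class (C0 X) I U"

lemma ultra_U: "ultra U"
  using admissible by (simp add: admissible_ultrafilter_def ultra_def)

lemma U_not_bot: "U \<noteq> bot"
  using ultra_U by (simp add: ultra_def)

lemma eventually_I: "eventually (\<lambda>i. i \<in> I) U"
  using admissible by (simp add: admissible_ultrafilter_def)

lemma I_nonempty: "I \<noteq> {}"
  using eventually_I U_not_bot by (auto simp: trivial_limit_def)

text \<open>Suprema of norms are replaced by pointwise bounds, which are easier to check for plain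
  functions; \<open>null_families_iff\<close> does the same for null families.\<close>

lemma LX_iff:
  "x \<in> LX \<longleftrightarrow> x \<in> I \<rightarrow>\<^sub>E CX \<and> (\<exists>B. \<forall>i\<in>I. \<forall>t\<in>topspace X. cmod (x i t) \<le> B)"
proof -
  have "(\<exists>B. \<forall>i\<in>I. vnorm (C0 X) (x i) \<le> B) \<longleftrightarrow> (\<exists>B. \<forall>i\<in>I. \<forall>t\<in>topspace X. cmod (x i t) \<le> B)"
    if x: "x \<in> I \<rightarrow>\<^sub>E CX"
  proof
    assume "\<exists>B. \<forall>i\<in>I. vnorm (C0 X) (x i) \<le> B"
    then obtain B where "\<And>i. i \<in> I \<Longrightarrow> vnorm (C0 X) (x i) \<le> B" by blast
    then have "cmod (x i t) \<le> B" if "i \<in> I" "t \<in> topspace X" for i t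
      using CX_norm_bound[of "x i" t] PiE_mem[OF x that(1)] that by force
    then show "\<exists>B. \<forall>i\<in>I. \<forall>t\<in>topspace X. cmod (x i t) \<le> B" by blast
  next
    assume "\<exists>B. \<forall>i\<in>I. \<forall>t\<in>topspace X. cmod (x i t) \<le> B"
    then obtain B where B: "\<And>i t. i \<in> I \<Longrightarrow> t \<in> topspace X \<Longrightarrow> cmod (x i t) \<le> B" by blast
    have "vnorm (C0 X) (x i) \<le> max B 0" if "i \<in> I" for i
      using CX_norm_le_iff[OF PiE_mem[OF x that], of "max B 0"] B[OF that] by (simp add: le_max_iff_disj)
    then show "\<exists>B. \<forall>i\<in>I. vnorm (C0 X) (x i) \<le> B" by blast
  qed
  moreover have "x \<in> LX \<longleftrightarrow> x \<in> I \<rightarrow>\<^sub>E CX \<and> (\<exists>B. \<forall>i\<in>I. vnorm (C0 X) (x i) \<le> B)"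
    unfolding linf_def normed_space.select_convs mem_Collect_eq bdd_above.unfold by blast
  ultimately show ?thesis by blast
qed

lemma LX_D:
  assumes "x \<in> LX"
  shows "i \<in> I \<Longrightarrow> x i \<in> CX" "i \<in> I \<Longrightarrow> c0 (x i)"
    "\<exists>B>0. \<forall>i\<in>I. \<forall>t\<in>topspace X. cmod (x i t) \<le> B"
proof -
  have x: "x \<in> I \<rightarrow>\<^sub>E CX" using assms LX_iff by blast
  show "x i \<in> CX" if "i \<in> I" using PiE_mem[OF x that] .
  then show "c0 (x i)" if "i \<in> I" using CX_c0 that by blast
  obtain B where "\<forall>i\<in>I. \<forall>t\<in>topspace X. cmod (x i t) \<le> B" using assms LX_iff by blast
  then have "\<forall>i\<in>I. \<forall>t\<in>topspace X. cmod (x i t) \<le> max B 1" by (simp add: le_max_iff_disj)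
  then show "\<exists>B>0. \<forall>i\<in>I. \<forall>t\<in>topspace X. cmod (x i t) \<le> B"
    by (intro exI[of _ "max B 1"]) simp
qed

definition fam :: "('i \<Rightarrow> 'a \<Rightarrow> complex) \<Rightarrow> 'i \<Rightarrow> 'a \<Rightarrow> complex" where
  "fam T = (\<lambda>i\<in>I. restrict (T i) (topspace X))"

lemma fam_LX:
  assumes "\<And>i. i \<in> I \<Longrightarrow> c0 (T i)" "\<And>i t. i \<in> I \<Longrightarrow> t \<in> topspace X \<Longrightarrow> cmod (T i t) \<le> B"
  shows "fam T \<in> LX"
  unfolding LX_iff using assms by (auto simp: fam_def PiE_iff intro!: exI[of _ B])

lemma fam_apply [simp]: "i \<in> I \<Longrightarrow> t \<in> topspace X \<Longrightarrow> fam T i t = T i t"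
  by (simp add: fam_def)

lemma ev_fam: "i \<in> I \<Longrightarrow> ev \<mu> (fam T i) = ev \<mu> (T i)"
  by (intro ev_cong) simp

lemma vadd_LX: "vadd (linf (C0 X) I) x y = fam (\<lambda>i t. x i t + y i t)"
  by (simp add: fam_def)

lemma vscale_LX: "vscale (linf (C0 X) I) c x = fam (\<lambda>i t. c * x i t)"
  by (simp add: fam_def)

lemma null_families_iff:
  "x \<in> null_families (C0 X) I U \<longleftrightarrow> x \<in> LX \<and>
    (\<forall>e>0. eventually (\<lambda>i. \<forall>t\<in>topspace X. cmod (x i t) \<le> e) U)"
proof -
  have "((\<lambda>i. vnorm (C0 X) (x i)) \<longlongrightarrow> 0) U \<longleftrightarrow> (\<forall>e>0. eventually (\<lambda>i. \<forall>t\<in>topspace X. cmod (x i t) \<le> e) U)"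
    if x: "x \<in> LX"
  proof -
    have le: "vnorm (C0 X) (x i) \<le> e \<longleftrightarrow> (\<forall>t\<in>topspace X. cmod (x i t) \<le> e)" if "i \<in> I" "e > 0" for i e
      using CX_norm_le_iff[OF LX_D(1)[OF x that(1)], of e] that by simp
    have nn: "dist (vnorm (C0 X) (x i)) 0 = vnorm (C0 X) (x i)" if "i \<in> I" for i
      using CX_norm_nonneg[OF LX_D(1)[OF x that]] by simp
    show ?thesis
      unfolding tendsto_iff
    proof (intro iffI allI impI)
      fix e :: real
      assume "\<forall>e>0. eventually (\<lambda>i. dist (vnorm (C0 X) (x i)) 0 < e) U" and e: "e > 0"
      then have "eventually (\<lambda>i. dist (vnorm (C0 X) (x i)) 0 < e) U" by blast
      with eventually_I show "eventually (\<lambda>i. \<forall>t\<in>topspace X. cmod (x i t) \<le> e) U"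
        by eventually_elim (use le[OF _ e] nn in force)
    next
      fix e :: real
      assume *: "\<forall>e>0. eventually (\<lambda>i. \<forall>t\<in>topspace X. cmod (x i t) \<le> e) U" and e: "e > 0"
      from e have e2: "e / 2 > 0" by simp
      with * have "eventually (\<lambda>i. \<forall>t\<in>topspace X. cmod (x i t) \<le> e / 2) U" by blast
      with eventually_I show "eventually (\<lambda>i. dist (vnorm (C0 X) (x i)) 0 < e) U"
        by eventually_elim (use le[OF _ e2] nn e in force)
    qed
  qed
  then show ?thesis unfolding null_families_def by blast
qed

lemma rel_iff:
  "(x, y) \<in> rel \<longleftrightarrow> x \<in> LX \<and> y \<in> LX \<and>
    (\<forall>e>0. eventually (\<lambda>i. \<forall>t\<in>topspace X. cmod (x i t - y i t) \<le> e) U)"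
proof -
  have "vadd (linf (C0 X) I) x (vscale (linf (C0 X) I) (-1) y) \<in> null_families (C0 X) I U \<longleftrightarrow>
      (\<forall>e>0. eventually (\<lambda>i. \<forall>t\<in>topspace X. cmod (x i t - y i t) \<le> e) U)"
    if x: "x \<in> LX" and y: "y \<in> LX"
  proof -
    let ?z = "vadd (linf (C0 X) I) x (vscale (linf (C0 X) I) (-1) y)"
    have z: "?z = fam (\<lambda>i t. x i t - y i t)"
      by (auto simp: fam_def fun_eq_iff)
    obtain B where B: "\<forall>i\<in>I. \<forall>t\<in>topspace X. cmod (x i t) \<le> B" using LX_D(3)[OF x] by blast
    obtain C where C: "\<forall>i\<in>I. \<forall>t\<in>topspace X. cmod (y i t) \<le> C" using LX_D(3)[OF y] by blast
    have "?z \<in> LX"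
      unfolding z
    proof (rule fam_LX)
      fix i t assume "i \<in> I" "t \<in> topspace X"
      then have "cmod (x i t) \<le> B" "cmod (y i t) \<le> C" using B C by auto
      then show "cmod (x i t - y i t) \<le> B + C"
        by (rule order_trans[OF norm_triangle_ineq4 add_mono])
    qed (use LX_D(2)[OF x] LX_D(2)[OF y] in \<open>rule c0_diff\<close>)
    moreover have "eventually (\<lambda>i. \<forall>t\<in>topspace X. cmod (?z i t) \<le> e) U \<longleftrightarrow>
        eventually (\<lambda>i. \<forall>t\<in>topspace X. cmod (x i t - y i t) \<le> e) U" for e
      unfolding z by (rule eventually_cong[OF eventually_I]) simp
    ultimately show ?thesis unfolding null_families_iff by blast
  qed
  then show ?thesis unfolding ultra_rel_def by blast
qed

lemma equiv_rel: "equiv LX rel"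
proof (rule equivI)
  show "rel \<subseteq> LX \<times> LX" unfolding ultra_rel_def by blast
  show "refl_on LX rel" by (simp add: refl_on_def rel_iff less_imp_le)
  show "sym rel" by (rule symI) (simp only: rel_iff norm_minus_commute, blast)
  show "trans rel"
  proof (rule transI)
    fix x y z assume xy: "(x, y) \<in> rel" and yz: "(y, z) \<in> rel"
    have "eventually (\<lambda>i. \<forall>t\<in>topspace X. cmod (x i t - z i t) \<le> e) U" if e: "e > 0" for e
    proof -
      have e2: "e / 2 > 0" using e by simp
      have 1: "eventually (\<lambda>i. \<forall>t\<in>topspace X. cmod (x i t - y i t) \<le> e / 2) U"
        using xy e2 rel_iff by blast
      have 2: "eventually (\<lambda>i. \<forall>t\<in>topspace X. cmod (y i t - z i t) \<le> e / 2) U"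
        using yz e2 rel_iff by blast
      from 1 2 show ?thesis
      proof eventually_elim
        case (elim i)
        show ?case
        proof
          fix t assume "t \<in> topspace X"
          then have "cmod (x i t - y i t) \<le> e / 2" "cmod (y i t - z i t) \<le> e / 2" using elim by blast+
          then show "cmod (x i t - z i t) \<le> e"
            using norm_triangle_ineq[of "x i t - y i t" "y i t - z i t"] by simp
        qed
      qed
    qed
    then show "(x, z) \<in> rel" using xy yz rel_iff by blast
  qed
qed

lemma cls_eq: "(x, y) \<in> rel \<Longrightarrow> cls x = cls y"
  unfolding ultra_class_def by (rule equiv_class_eq[OF equiv_rel])

lemma cls_mem: "x \<in> LX \<Longrightarrow> y \<in> cls x \<longleftrightarrow> (x, y) \<in> rel"
  unfolding ultra_class_def by blast

lemma cls_self: "x \<in> LX \<Longrightarrow> x \<in> cls x"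
  unfolding ultra_class_def by (rule equiv_class_self[OF equiv_rel])

lemma ultrapower_vecs: "vecs (ultrapower (C0 X) I U) = LX // rel"
  by (simp only: ultrapower_def normed_space.select_convs)

lemma ultrapowerE:
  assumes "p \<in> vecs (ultrapower (C0 X) I U)"
  obtains x where "x \<in> LX" "p = cls x"
  using assms unfolding ultrapower_vecs ultra_class_def by (blast elim: quotientE)

lemma cls_vecs: "x \<in> LX \<Longrightarrow> cls x \<in> vecs (ultrapower (C0 X) I U)"
  unfolding ultrapower_vecs ultra_class_def by (rule quotientI)

lemma fam_rel:
  assumes LX: "fam S \<in> LX" "fam T \<in> LX"
    and le: "\<And>e. e > 0 \<Longrightarrow> eventually (\<lambda>i. \<forall>t\<in>topspace X. cmod (S i t - T i t) \<le> e) U"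
  shows "(fam S, fam T) \<in> rel"
proof -
  have "eventually (\<lambda>i. \<forall>t\<in>topspace X. cmod (fam S i t - fam T i t) \<le> e) U" if "e > 0" for e
    using le[OF that] eventually_I by eventually_elim simp
  then show ?thesis using LX rel_iff by blast
qed

lemma LX_add: "x \<in> LX \<Longrightarrow> y \<in> LX \<Longrightarrow> fam (\<lambda>i t. x i t + y i t) \<in> LX"
proof -
  assume x: "x \<in> LX" and y: "y \<in> LX"
  obtain B where B: "\<forall>i\<in>I. \<forall>t\<in>topspace X. cmod (x i t) \<le> B" using LX_D(3)[OF x] by blast
  obtain C where C: "\<forall>i\<in>I. \<forall>t\<in>topspace X. cmod (y i t) \<le> C" using LX_D(3)[OF y] by blast
  show ?thesis
  proof (rule fam_LX)
    fix i t assume "i \<in> I" "t \<in> topspace X"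
    then have "cmod (x i t) \<le> B" "cmod (y i t) \<le> C" using B C by auto
    then show "cmod (x i t + y i t) \<le> B + C" by (rule norm_triangle_mono)
  qed (use LX_D(2)[OF x] LX_D(2)[OF y] in \<open>rule c0_add\<close>)
qed

lemma LX_scale: "x \<in> LX \<Longrightarrow> fam (\<lambda>i t. c * x i t) \<in> LX"
proof -
  assume x: "x \<in> LX"
  obtain B where B: "\<forall>i\<in>I. \<forall>t\<in>topspace X. cmod (x i t) \<le> B" using LX_D(3)[OF x] by blast
  show ?thesis
  proof (rule fam_LX)
    fix i t assume "i \<in> I" "t \<in> topspace X"
    then show "cmod (c * x i t) \<le> cmod c * B" using B by (simp add: norm_mult mult_left_mono)
  qed (use LX_D(2)[OF x] in \<open>rule c0_scale\<close>)
qed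

lemma LX_mult: "x \<in> LX \<Longrightarrow> y \<in> LX \<Longrightarrow> fam (\<lambda>i t. x i t * y i t) \<in> LX"
proof -
  assume x: "x \<in> LX" and y: "y \<in> LX"
  obtain B where B: "B > 0" "\<forall>i\<in>I. \<forall>t\<in>topspace X. cmod (x i t) \<le> B" using LX_D(3)[OF x] by blast
  obtain C where C: "\<forall>i\<in>I. \<forall>t\<in>topspace X. cmod (y i t) \<le> C" using LX_D(3)[OF y] by blast
  show ?thesis
  proof (rule fam_LX)
    fix i t assume "i \<in> I" "t \<in> topspace X"
    then have "cmod (x i t) \<le> B" "cmod (y i t) \<le> C" using B C by auto
    then show "cmod (x i t * y i t) \<le> B * C" unfolding norm_mult using B(1) by (intro mult_mono) auto
  qed (use LX_D(2)[OF x] LX_D(2)[OF y] in \<open>rule c0_mult\<close>)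
qed

text \<open>Operations on classes are unions over all representatives. Once the resulting class is
  known not to depend on them, the union collapses to a single class; \<open>cls_scale\<close> and
  \<open>cls_mult\<close> follow the same scheme.\<close>

lemma cls_add:
  assumes "x \<in> LX" "y \<in> LX"
  shows "vadd (ultrapower (C0 X) I U) (cls x) (cls y) = cls (fam (\<lambda>i t. x i t + y i t))"
proof -
  let ?f = "\<lambda>x y. cls (fam (\<lambda>i t. x i t + y i t))"
  have "congruent2 rel rel ?f"
  proof (rule congruent2I')
    fix x x' y y' assume *: "(x, x') \<in> rel" "(y, y') \<in> rel"
    then have L: "x \<in> LX" "x' \<in> LX" "y \<in> LX" "y' \<in> LX" using rel_iff by blast+
    show "?f x y = ?f x' y'"
    proof (rule cls_eq, rule fam_rel[OF LX_add[OF L(1,3)] LX_add[OF L(2,4)]])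
      fix e :: real assume "e > 0"
      then have e2: "e / 2 > 0" by simp
      have 1: "eventually (\<lambda>i. \<forall>t\<in>topspace X. cmod (x i t - x' i t) \<le> e / 2) U"
        using *(1) e2 rel_iff by blast
      have 2: "eventually (\<lambda>i. \<forall>t\<in>topspace X. cmod (y i t - y' i t) \<le> e / 2) U"
        using *(2) e2 rel_iff by blast
      from 1 2 show "eventually (\<lambda>i. \<forall>t\<in>topspace X. cmod (x i t + y i t - (x' i t + y' i t)) \<le> e) U"
      proof eventually_elim
        case (elim i)
        show ?case
        proof
          fix t assume "t \<in> topspace X"
          then have "cmod (x i t - x' i t) \<le> e / 2" "cmod (y i t - y' i t) \<le> e / 2" using elim by blast+
          then show "cmod (x i t + y i t - (x' i t + y' i t)) \<le> e"
            using norm_diff_triangle_ineq[of "x i t" "y i t" "x' i t" "y' i t"] by linarith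
        qed
      qed
    qed
  qed
  from UN_equiv_class2[OF equiv_rel equiv_rel this assms] show ?thesis
    unfolding ultrapower_def normed_space.select_convs vadd_LX ultra_class_def .
qed

lemma cls_scale:
  assumes "x \<in> LX"
  shows "vscale (ultrapower (C0 X) I U) c (cls x) = cls (fam (\<lambda>i t. c * x i t))"
proof -
  let ?f = "\<lambda>x. cls (fam (\<lambda>i t. c * x i t))"
  have "?f respects rel"
  proof (rule congruentI)
    fix x x' assume *: "(x, x') \<in> rel"
    then have L: "x \<in> LX" "x' \<in> LX" using rel_iff by blast+
    show "?f x = ?f x'"
    proof (rule cls_eq, rule fam_rel[OF LX_scale[OF L(1)] LX_scale[OF L(2)]])
      fix e :: real assume "e > 0"
      then have e2: "e / (cmod c + 1) > 0" by (simp add: add_nonneg_pos)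
      have "eventually (\<lambda>i. \<forall>t\<in>topspace X. cmod (x i t - x' i t) \<le> e / (cmod c + 1)) U"
        using * e2 rel_iff by blast
      then show "eventually (\<lambda>i. \<forall>t\<in>topspace X. cmod (c * x i t - c * x' i t) \<le> e) U"
      proof eventually_elim
        case (elim i)
        show ?case
        proof
          fix t assume "t \<in> topspace X"
          then have le: "cmod (x i t - x' i t) \<le> e / (cmod c + 1)" using elim by blast
          have "cmod (c * x i t - c * x' i t) = cmod c * cmod (x i t - x' i t)"
            by (simp only: norm_mult right_diff_distrib[symmetric])
          also have "\<dots> \<le> (cmod c + 1) * (e / (cmod c + 1))" using le by (intro mult_mono) auto
          also have "\<dots> = e" using norm_ge_zero[of c] by (simp add: add_nonneg_eq_0_iff)
          finally show "cmod (c * x i t - c * x' i t) \<le> e" .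
        qed
      qed
    qed
  qed
  from UN_equiv_class[OF equiv_rel this assms] show ?thesis
    unfolding ultrapower_def normed_space.select_convs vscale_LX ultra_class_def .
qed

lemma cls_mult:
  assumes "x \<in> LX" "y \<in> LX"
  shows "ultra_mult (C0 X) I U (cls x) (cls y) = cls (fam (\<lambda>i t. x i t * y i t))"
proof -
  let ?f = "\<lambda>x y. cls (fam (\<lambda>i t. x i t * y i t))"
  have "congruent2 rel rel ?f"
  proof (rule congruent2I')
    fix x x' y y' assume *: "(x, x') \<in> rel" "(y, y') \<in> rel"
    then have L: "x \<in> LX" "x' \<in> LX" "y \<in> LX" "y' \<in> LX" using rel_iff by blast+
    \<comment> \<open>A product respects null differences because one factor of each product in the
      splitting below is bounded uniformly in the index.\<close>
    obtain B where B: "B > 0" "\<forall>i\<in>I. \<forall>t\<in>topspace X. cmod (x' i t) \<le> B" using LX_D(3)[OF L(2)] by blast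
    obtain C where C: "C > 0" "\<forall>i\<in>I. \<forall>t\<in>topspace X. cmod (y i t) \<le> C" using LX_D(3)[OF L(3)] by blast
    show "?f x y = ?f x' y'"
    proof (rule cls_eq, rule fam_rel[OF LX_mult[OF L(1,3)] LX_mult[OF L(2,4)]])
      fix e :: real assume e: "e > 0"
      then have e2: "e / (B + C) > 0" using B C by simp
      have 1: "eventually (\<lambda>i. \<forall>t\<in>topspace X. cmod (x i t - x' i t) \<le> e / (B + C)) U"
        using *(1) e2 rel_iff by blast
      have 2: "eventually (\<lambda>i. \<forall>t\<in>topspace X. cmod (y i t - y' i t) \<le> e / (B + C)) U"
        using *(2) e2 rel_iff by blast
      from 1 2 eventually_I show "eventually (\<lambda>i. \<forall>t\<in>topspace X. cmod (x i t * y i t - x' i t * y' i t) \<le> e) U"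
      proof eventually_elim
        case (elim i)
        show ?case
        proof
          fix t assume t: "t \<in> topspace X"
          have le: "cmod (x i t - x' i t) \<le> e / (B + C)" "cmod (y i t - y' i t) \<le> e / (B + C)"
            using elim(1,2) t by blast+
          have bd: "cmod (x' i t) \<le> B" "cmod (y i t) \<le> C" using B C elim(3) t by blast+
          have "x i t * y i t - x' i t * y' i t = (x i t - x' i t) * y i t + x' i t * (y i t - y' i t)"
            by (simp add: algebra_simps)
          also have "cmod \<dots> \<le> e / (B + C) * C + B * (e / (B + C))"
            unfolding norm_mult using le bd B(1) C(1) e2
            by (intro norm_triangle_mono; unfold norm_mult; intro mult_mono) simp_all
          also have "\<dots> = e * (B + C) / (B + C)" by (simp only: times_divide_eq_left times_divide_eq_right
              add_divide_distrib[symmetric] distrib_left mult.commute[of B] add.commute)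
          also have "\<dots> = e" using B(1) C(1) by simp
          finally show "cmod (x i t * y i t - x' i t * y' i t) \<le> e" .
        qed
      qed
    qed
  qed
  moreover have "(\<lambda>i\<in>I. vmult (C0 X) (x i) (y i)) = fam (\<lambda>i t. x i t * y i t)" for x y :: "'i \<Rightarrow> 'a \<Rightarrow> complex"
    by (simp add: fam_def)
  ultimately show ?thesis
    using UN_equiv_class2[OF equiv_rel equiv_rel _ assms, of ?f]
    unfolding ultra_mult_def ultra_class_def by (simp only:)
qed

text \<open>The quotient norm is an infimum over the class, so a single representative bounds it
  from above; the infimum is a genuine one because the norms are bounded below by 0.\<close>

lemma cls_norm_le:
  assumes "x \<in> LX" "B \<ge> 0" "\<And>i t. i \<in> I \<Longrightarrow> t \<in> topspace X \<Longrightarrow> cmod (x i t) \<le> B"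
  shows "vnorm (ultrapower (C0 X) I U) (cls x) \<le> B"
proof -
  have nn: "0 \<le> vnorm (linf (C0 X) I) y" if y: "y \<in> LX" for y
  proof -
    obtain i where i: "i \<in> I" using I_nonempty by blast
    obtain C where C: "C > 0" "\<forall>i\<in>I. \<forall>t\<in>topspace X. cmod (y i t) \<le> C" using LX_D(3)[OF y] by blast
    have "vnorm (C0 X) (y j) \<le> C" if "j \<in> I" for j
      using CX_norm_le_iff[OF LX_D(1)[OF y that], of C] C that by simp
    then have "bdd_above ((\<lambda>i. vnorm (C0 X) (y i)) ` I)" by (rule bdd_aboveI2)
    then have "vnorm (C0 X) (y i) \<le> vnorm (linf (C0 X) I) y"
      unfolding vnorm_linf by (intro cSUP_upper i)
    then show ?thesis using CX_norm_nonneg[OF LX_D(1)[OF y i]] by linarith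
  qed
  have "vnorm (ultrapower (C0 X) I U) (cls x) = (INF y\<in>cls x. vnorm (linf (C0 X) I) y)"
    by (simp only: ultrapower_def normed_space.select_convs)
  also have "\<dots> \<le> vnorm (linf (C0 X) I) x"
  proof (rule cINF_lower[OF _ cls_self[OF assms(1)]])
    show "bdd_below ((\<lambda>y. vnorm (linf (C0 X) I) y) ` cls x)"
      using nn cls_mem[OF assms(1)] rel_iff by (intro bdd_belowI2[of _ 0]) blast
  qed
  also have "\<dots> \<le> B"
    unfolding vnorm_linf
  proof (rule cSUP_least[OF I_nonempty])
    fix i assume "i \<in> I"
    then show "vnorm (C0 X) (x i) \<le> B"
      using CX_norm_le_iff[OF LX_D(1)[OF assms(1)] assms(2)] assms(3) by simp
  qed
  finally show ?thesis .
qed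

text \<open>Representatives of a class differ by a null family, on which the bounded
  \<open>\<mu>\<close> tends to 0. Hence the limit found for \<open>x\<close> is shared by the whole
  class and the definite description returns it.\<close>

lemma sigma_cls:
  assumes x: "x \<in> LX" and \<mu>: "\<mu> \<in> MX" and lim: "((\<lambda>i. ev \<mu> (x i)) \<longlongrightarrow> l) U"
  shows "ultra_sigma (C0 X) I U (cls x) \<mu> = l"
proof -
  have all: "((\<lambda>i. \<mu> (y i)) \<longlongrightarrow> l) U" if y: "y \<in> cls x" for y
  proof -
    have xy: "(x, y) \<in> rel" and yL: "y \<in> LX" using y cls_mem[OF x] rel_iff by blast+
    have "((\<lambda>i. ev \<mu> (x i) - ev \<mu> (y i)) \<longlongrightarrow> 0) U"
      unfolding tendsto_iff
    proof (intro allI impI)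
      fix e :: real assume e: "e > 0"
      let ?d = "e / (2 * (mnorm \<mu> + 1))"
      have m: "mnorm \<mu> \<ge> 0" by (rule mnorm_nonneg[OF \<mu>])
      then have d: "?d > 0" using e by simp
      then have "eventually (\<lambda>i. \<forall>t\<in>topspace X. cmod (x i t - y i t) \<le> ?d) U"
        using xy rel_iff by blast
      with eventually_I show "eventually (\<lambda>i. dist (ev \<mu> (x i) - ev \<mu> (y i)) 0 < e) U"
      proof eventually_elim
        case (elim i)
        have xi: "c0 (x i)" "c0 (y i)" using LX_D(2) x yL elim(1) by blast+
        have "cmod (ev \<mu> (x i) - ev \<mu> (y i)) = cmod (ev \<mu> (\<lambda>t. x i t - y i t))"
          by (simp only: ev_diff[OF \<mu> xi])
        also have "\<dots> \<le> mnorm \<mu> * ?d"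
          using elim(2) d by (intro ev_bound \<mu> c0_diff xi) auto
        also have "\<dots> \<le> (mnorm \<mu> + 1) * ?d" using d by (intro mult_right_mono) auto
        also have "\<dots> = e / 2" using m by (simp add: field_simps)
        finally have "cmod (ev \<mu> (x i) - ev \<mu> (y i)) \<le> e / 2" .
        then show ?case using e unfolding dist_norm diff_0_right by linarith
      qed
    qed
    from tendsto_diff[OF lim this] have "((\<lambda>i. ev \<mu> (y i)) \<longlongrightarrow> l) U" by simp
    moreover have "eventually (\<lambda>i. ev \<mu> (y i) = \<mu> (y i)) U"
      using eventually_I by eventually_elim (simp add: ev_CX[OF LX_D(1)[OF yL]])
    ultimately show ?thesis using tendsto_cong by fast
  qed
  have "(THE l. \<forall>y\<in>cls x. ((\<lambda>i. \<mu> (y i)) \<longlongrightarrow> l) U) = l"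
  proof (rule the_equality)
    show "\<forall>y\<in>cls x. ((\<lambda>i. \<mu> (y i)) \<longlongrightarrow> l) U" using all by blast
    fix l' assume "\<forall>y\<in>cls x. ((\<lambda>i. \<mu> (y i)) \<longlongrightarrow> l') U"
    then show "l' = l" using tendsto_unique[OF U_not_bot] all cls_self[OF x] by blast
  qed
  then show ?thesis using \<mu> unfolding ultra_sigma_def by simp
qed

lemma ev_tendsto_sigma:
  assumes x: "x \<in> LX" and \<mu>: "\<mu> \<in> MX"
  shows "((\<lambda>i. ev \<mu> (x i)) \<longlongrightarrow> ultra_sigma (C0 X) I U (cls x) \<mu>) U"
proof -
  obtain B where B: "B > 0" "\<forall>i\<in>I. \<forall>t\<in>topspace X. cmod (x i t) \<le> B" using LX_D(3)[OF x] by blast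
  have "eventually (\<lambda>i. dist 0 (ev \<mu> (x i)) \<le> mnorm \<mu> * B) U"
    using eventually_I
  proof eventually_elim
    case (elim i)
    then have "cmod (ev \<mu> (x i)) \<le> mnorm \<mu> * B"
      using B LX_D(2)[OF x] by (intro ev_bound \<mu>) auto
    then show ?case by simp
  qed
  from ultra_bounded_tendsto_Lim[OF ultra_U this]
  have "((\<lambda>i. ev \<mu> (x i)) \<longlongrightarrow> Lim U (\<lambda>i. ev \<mu> (x i))) U" .
  then show ?thesis using sigma_cls[OF x \<mu>] by simp
qed

lemma sigma_extensional: "ultra_sigma (C0 X) I U p \<in> extensional MX"
  unfolding ultra_sigma_def by (rule restrict_extensional)

end

section \<open>Functionals on scattered spaces\<close>

context lch_space
begin

text \<open>Acts on arbitrary functions instead of being a member of \<open>MX\<close>, so that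
  multiplying the argument by any weight gives an atomic functional again.\<close>

definition atomic :: "(('a \<Rightarrow> complex) \<Rightarrow> complex) \<Rightarrow> bool" where
  "atomic L \<longleftrightarrow> (\<exists>D c. finite D \<and> D \<subseteq> topspace X \<and> L = (\<lambda>g. \<Sum>x\<in>D. c x * g x))"

lemma atomic_zero: "atomic (\<lambda>g. 0)"
  unfolding atomic_def by (intro exI[of _ "{}"]) simp

lemma atomic_point: "p \<in> topspace X \<Longrightarrow> atomic (\<lambda>g. c * g p)"
  unfolding atomic_def by (intro exI[of _ "{p}"] exI[of _ "\<lambda>_. c"]) simp

lemma atomic_add:
  assumes "atomic L" "atomic M"
  shows "atomic (\<lambda>g. L g + M g)"
proof -
  obtain D c where D: "finite D" "D \<subseteq> topspace X" "L = (\<lambda>g. \<Sum>x\<in>D. c x * g x)"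
    using assms(1) unfolding atomic_def by blast
  obtain E d where E: "finite E" "E \<subseteq> topspace X" "M = (\<lambda>g. \<Sum>x\<in>E. d x * g x)"
    using assms(2) unfolding atomic_def by blast
  let ?c = "\<lambda>x. (if x \<in> D then c x else 0) + (if x \<in> E then d x else 0)"
  have "L g + M g = (\<Sum>x\<in>D \<union> E. ?c x * g x)" for g
  proof -
    have "(\<Sum>x\<in>D. c x * g x) = (\<Sum>x\<in>D \<union> E. (if x \<in> D then c x else 0) * g x)"
      using D(1) E(1) by (intro sum.mono_neutral_cong_left) auto
    moreover have "(\<Sum>x\<in>E. d x * g x) = (\<Sum>x\<in>D \<union> E. (if x \<in> E then d x else 0) * g x)"
      using D(1) E(1) by (intro sum.mono_neutral_cong_left) auto
    ultimately show ?thesis unfolding D(3) E(3) by (simp only: sum.distrib distrib_right)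
  qed
  then show ?thesis
    unfolding atomic_def using D(1,2) E(1,2) by (intro exI[of _ "D \<union> E"] exI[of _ ?c]) auto
qed

lemma atomic_sum: "(\<And>k. k \<in> K \<Longrightarrow> atomic (L k)) \<Longrightarrow> atomic (\<lambda>g. \<Sum>k\<in>K. L k g)"
  by (induction K rule: infinite_finite_induct) (simp_all add: atomic_zero atomic_add)

lemma atomic_weight: "atomic L \<Longrightarrow> atomic (\<lambda>g. L (\<lambda>x. w x * g x))"
proof -
  assume "atomic L"
  then obtain D c where D: "finite D" "D \<subseteq> topspace X" "L = (\<lambda>g. \<Sum>x\<in>D. c x * g x)"
    unfolding atomic_def by blast
  then show ?thesis
    unfolding atomic_def by (intro exI[of _ D] exI[of _ "\<lambda>x. c x * w x"]) (simp add: mult.assoc)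
qed

lemma atomic_linear:
  assumes "atomic L"
  shows "L (\<lambda>x. c * (g x - d * h x)) = c * (L g - d * L h)"
proof -
  obtain D a where D: "L = (\<lambda>g. \<Sum>x\<in>D. a x * g x)"
    using assms unfolding atomic_def by blast
  show ?thesis
    unfolding D by (simp add: right_diff_distrib sum_subtractf sum_distrib_left mult.left_commute)
qed

text \<open>In terms of measures: the part of \<open>\<mu>\<close> on \<open>W\<close> is purely
  atomic. Atoms of \<open>L\<close> may lie outside \<open>W\<close>, because the test functions
  vanish there.\<close>

definition approx_atomic_on :: "(('a \<Rightarrow> complex) \<Rightarrow> complex) \<Rightarrow> 'a set \<Rightarrow> bool" where
  "approx_atomic_on \<mu> W \<longleftrightarrow> (\<forall>e>0. \<exists>L. atomic L \<and>
    (\<forall>g. unit_ball g \<and> (\<forall>x\<in>topspace X - W. g x = 0) \<longrightarrow> cmod (ev \<mu> g - L g) \<le> e))"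

text \<open>A bump \<open>b\<close> at \<open>p\<close> reduces \<open>V\<close> to
  \<open>W\<close>: the function \<open>g - g p * b\<close> vanishes at \<open>p\<close>, hence
  everywhere off \<open>W\<close>.\<close>

lemma approx_atomic_on_insert:
  assumes \<mu>: "\<mu> \<in> MX" and W: "approx_atomic_on \<mu> W"
    and V: "openin X V" "p \<in> V" "V - W \<subseteq> {p}"
  shows "approx_atomic_on \<mu> V"
  unfolding approx_atomic_on_def
proof (intro allI impI)
  fix e :: real assume "e > 0"
  then obtain L where L: "atomic L" "\<And>g. unit_ball g \<Longrightarrow> \<forall>x\<in>topspace X - W. g x = 0 \<Longrightarrow> cmod (ev \<mu> g - L g) \<le> e / 2"
    using W unfolding approx_atomic_on_def by (metis half_gt_zero)
  have p: "p \<in> topspace X" using V openin_subset by blast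
  obtain b :: "'a \<Rightarrow> real" where b: "c0 (\<lambda>x. complex_of_real (b x))" "b p = 1"
    "\<And>x. x \<in> topspace X \<Longrightarrow> 0 \<le> b x \<and> b x \<le> 1" "\<And>x. x \<in> topspace X \<Longrightarrow> x \<notin> V \<Longrightarrow> b x = 0"
    using bump[OF V(1,2)] by metis
  let ?b = "\<lambda>x. complex_of_real (b x)"
  \<comment> \<open>The atom at \<open>p\<close> receives the value of \<open>\<mu> - L\<close> at
    the bump, which makes up exactly for the part \<open>g p * b\<close> that is split off.\<close>
  let ?L = "\<lambda>g. L g + (ev \<mu> ?b - L ?b) * g p"
  have "cmod (ev \<mu> g - ?L g) \<le> e" if g: "unit_ball g" "\<forall>x\<in>topspace X - V. g x = 0" for g
  proof -
    \<comment> \<open>The factor 1/2 brings the difference back to the unit ball and is paid for by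
      the precision \<open>e / 2\<close>.\<close>
    let ?h = "\<lambda>x. (1/2) * (g x - g p * ?b x)"
    have gc: "c0 g" by (rule unit_ball_c0[OF g(1)])
    have hc: "c0 (\<lambda>x. g x - g p * ?b x)" by (intro c0_diff gc c0_scale b(1))
    have "unit_ball ?h"
      unfolding unit_ball_def
    proof (intro conjI ballI)
      show "c0 ?h" by (rule c0_scale[OF hc])
      fix x assume x: "x \<in> topspace X"
      have "cmod (g x - g p * ?b x) \<le> 1 + 1 * 1"
      proof (rule order_trans[OF norm_triangle_ineq4 add_mono])
        show "cmod (g x) \<le> 1" using g(1) x by (simp add: unit_ball_def)
        show "cmod (g p * ?b x) \<le> 1 * 1" unfolding norm_mult norm_of_real
          using g(1) p b(3)[OF x] by (intro mult_mono) (auto simp: unit_ball_def)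
      qed
      then show "cmod (?h x) \<le> 1" unfolding norm_mult by simp
    qed
    moreover have "\<forall>x\<in>topspace X - W. ?h x = 0"
    proof
      fix x assume x: "x \<in> topspace X - W"
      show "?h x = 0"
      proof (cases "x \<in> V")
        case True
        then have "x = p" using x V(3) by blast
        then show ?thesis using b(2) by simp
      next
        case False
        then show ?thesis using g(2) b(4)[of x] x by simp
      qed
    qed
    ultimately have "cmod (ev \<mu> ?h - L ?h) \<le> e / 2" by (rule L(2))
    moreover have "ev \<mu> ?h = (1/2) * (ev \<mu> g - g p * ev \<mu> ?b)"
      by (simp only: ev_scale[OF \<mu> hc] ev_diff[OF \<mu> gc c0_scale[OF b(1)]] ev_scale[OF \<mu> b(1)])
    moreover have "L ?h = (1/2) * (L g - g p * L ?b)" by (rule atomic_linear[OF L(1)])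
    moreover have "(1/2) * (ev \<mu> g - g p * ev \<mu> ?b) - (1/2) * (L g - g p * L ?b) = (1/2) * (ev \<mu> g - ?L g)"
      by (simp add: algebra_simps)
    ultimately have "cmod ((1/2) * (ev \<mu> g - ?L g)) \<le> e / 2" by (simp only:)
    then show ?thesis unfolding norm_mult by simp
  qed
  moreover have "atomic ?L" by (intro atomic_add L(1) atomic_point p)
  ultimately show "\<exists>L. atomic L \<and> (\<forall>g. unit_ball g \<and> (\<forall>x\<in>topspace X - V. g x = 0) \<longrightarrow> cmod (ev \<mu> g - L g) \<le> e)"
    by blast
qed

text \<open>Takes the place of inner regularity. If \<open>g0\<close> nearly attains the norm of
  \<open>\<mu>\<close> on functions living on the union, then \<open>\<mu>\<close> is small on
  functions that vanish where \<open>g0\<close> is not small, since adding one of them to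
  \<open>g0\<close> hardly raises the norm. So almost all of \<open>\<mu>\<close> sits on a compact
  set, which finitely many members of \<open>\<W>\<close> cover.\<close>

lemma approx_atomic_on_Union:
  assumes \<mu>: "\<mu> \<in> MX" and \<W>: "\<And>W. W \<in> \<W> \<Longrightarrow> openin X W \<and> approx_atomic_on \<mu> W"
  shows "approx_atomic_on \<mu> (\<Union>\<W>)"
  unfolding approx_atomic_on_def
proof (intro allI impI)
  fix e :: real assume e: "e > 0"
  let ?F = "{g. unit_ball g \<and> (\<forall>x\<in>topspace X - \<Union>\<W>. g x = 0)}"
  define N where "N = (SUP g\<in>?F. cmod (ev \<mu> g))"
  have bdd: "bdd_above ((\<lambda>g. cmod (ev \<mu> g)) ` ?F)"
    by (rule bdd_aboveI2[of _ _ "mnorm \<mu>"]) (use ev_bound_unit[OF \<mu>] in blast)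
  have up: "cmod (ev \<mu> g) \<le> N" if "g \<in> ?F" for g
    unfolding N_def by (rule cSUP_upper[OF that bdd])
  have z: "(\<lambda>x. 0) \<in> ?F" by (simp add: unit_ball_def)
  have N0: "N \<ge> 0" using up[OF z] norm_ge_zero order_trans by blast
  have "\<exists>g\<in>?F. N - e / 3 < cmod (ev \<mu> g)"
  proof (rule ccontr)
    assume "\<not> ?thesis"
    then have "N \<le> N - e / 3" unfolding N_def using z by (intro cSUP_least) (auto simp: not_less)
    then show False using e by simp
  qed
  then obtain g0 where g0: "unit_ball g0" "\<forall>x\<in>topspace X - \<Union>\<W>. g0 x = 0" "N - e / 3 < cmod (ev \<mu> g0)"
    by blast
  have g0c: "c0 g0" by (rule unit_ball_c0[OF g0(1)])
  \<comment> \<open>Gives \<open>N * \<delta> \<le> e / 3\<close>; near maximality of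
    \<open>g0\<close> and the finitely many atomic approximations take the other two thirds.\<close>
  define \<delta> where "\<delta> = e / (3 * (N + 1))"
  have \<delta>: "\<delta> > 0" using e N0 by (simp add: \<delta>_def)
  have N\<delta>: "N * \<delta> \<le> e / 3"
  proof -
    have "N * \<delta> \<le> (N + 1) * \<delta>" using \<delta> by (intro mult_right_mono) auto
    also have "\<dots> = e / 3" using N0 by (simp add: \<delta>_def field_simps)
    finally show ?thesis .
  qed
  obtain C1 where C1: "compactin X C1" "\<forall>x\<in>topspace X - C1. cmod (g0 x) < \<delta>"
    using g0c \<delta> unfolding c0_def by blast
  let ?C = "{x \<in> topspace X. cmod (g0 x) \<in> {\<delta>..}}"
  have "closedin X ?C"
    by (rule closedin_continuous_map_preimage[OF continuous_map_norm[OF c0_continuous[OF g0c]]]) simp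
  moreover have "?C \<subseteq> C1" using C1(2) by force
  ultimately have C: "compactin X ?C" using C1(1) closed_compactin by blast
  have "\<exists>W. W \<in> \<W> \<and> x \<in> W" if "x \<in> ?C" for x
  proof -
    have "g0 x \<noteq> 0" using that \<delta> by auto
    then show ?thesis using g0(2) that by auto
  qed
  then obtain V where V: "\<And>x. x \<in> ?C \<Longrightarrow> V x \<in> \<W> \<and> x \<in> V x" by metis
  have Vo: "openin X (V x) \<and> x \<in> V x" if "x \<in> ?C" for x using V[OF that] \<W> by blast
  obtain D \<zeta> where D: "finite D" "D \<subseteq> ?C" and \<zeta>1: "\<forall>p\<in>D. c0 (\<lambda>x. complex_of_real (\<zeta> p x))"
    and \<zeta>2: "\<forall>p\<in>D. \<forall>x\<in>topspace X. 0 \<le> \<zeta> p x"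
    and \<zeta>3: "\<forall>p\<in>D. \<forall>x\<in>topspace X. x \<notin> V p \<longrightarrow> \<zeta> p x = 0"
    and \<zeta>4: "\<forall>x\<in>topspace X. (\<Sum>p\<in>D. \<zeta> p x) \<le> (1::real)"
    and \<zeta>5: "\<forall>x\<in>?C. (\<Sum>p\<in>D. \<zeta> p x) = 1"
    by (rule partition_of_unity[OF C Vo])
  let ?c = "\<lambda>p x. complex_of_real (\<zeta> p x)"
  let ?\<psi> = "\<lambda>x. complex_of_real (1 - (\<Sum>p\<in>D. \<zeta> p x))"
  have \<zeta>le: "\<zeta> p x \<le> 1" if "p \<in> D" "x \<in> topspace X" for p x
  proof -
    have "\<zeta> p x \<le> (\<Sum>p\<in>D. \<zeta> p x)" using \<zeta>2 that D(1) by (intro member_le_sum) auto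
    then show ?thesis using \<zeta>4 that by force
  qed
  have \<psi>01: "0 \<le> 1 - (\<Sum>p\<in>D. \<zeta> p x)" "1 - (\<Sum>p\<in>D. \<zeta> p x) \<le> 1" if "x \<in> topspace X" for x
    using \<zeta>4 \<zeta>2 that by (auto intro: sum_nonneg)
  \<comment> \<open>The \<open>+ 1\<close> provides for an empty \<open>D\<close>.\<close>
  let ?e = "e / (3 * (real (card D) + 1))"
  have "?e > 0" using e by (simp add: add_nonneg_pos)
  moreover have "approx_atomic_on \<mu> (V p)" if "p \<in> D" for p using V[of p] \<W> D(2) that by blast
  ultimately have "\<exists>L. atomic L \<and> (\<forall>g. unit_ball g \<and> (\<forall>x\<in>topspace X - V p. g x = 0) \<longrightarrow> cmod (ev \<mu> g - L g) \<le> ?e)"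
    if "p \<in> D" for p using that unfolding approx_atomic_on_def by blast
  then obtain L where L: "\<And>p. p \<in> D \<Longrightarrow> atomic (L p) \<and>
      (\<forall>g. unit_ball g \<and> (\<forall>x\<in>topspace X - V p. g x = 0) \<longrightarrow> cmod (ev \<mu> g - L p g) \<le> ?e)"
    by metis
  let ?L = "\<lambda>g. \<Sum>p\<in>D. L p (\<lambda>x. ?c p x * g x)"
  have "atomic ?L" by (intro atomic_sum atomic_weight) (use L in blast)
  moreover have "cmod (ev \<mu> g - ?L g) \<le> e" if g: "unit_ball g" "\<forall>x\<in>topspace X - \<Union>\<W>. g x = 0" for g
  proof -
    have gc: "c0 g" by (rule unit_ball_c0[OF g(1)])
    have g1: "cmod (g x) \<le> 1" if "x \<in> topspace X" for x using g(1) that by (simp add: unit_ball_def)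
    have cg: "c0 (\<lambda>x. ?c p x * g x)" if "p \<in> D" for p by (rule c0_mult[OF \<zeta>1[rule_format, OF that] gc])
    have \<psi>eq: "?\<psi> x * g x = g x - (\<Sum>p\<in>D. ?c p x * g x)" for x
      by (simp add: left_diff_distrib sum_distrib_right)
    have \<psi>g: "c0 (\<lambda>x. ?\<psi> x * g x)" unfolding \<psi>eq by (intro c0_diff gc c0_sum cg)
    have ev\<psi>: "ev \<mu> (\<lambda>x. ?\<psi> x * g x) = ev \<mu> g - (\<Sum>p\<in>D. ev \<mu> (\<lambda>x. ?c p x * g x))"
      unfolding \<psi>eq by (simp only: ev_diff[OF \<mu> gc c0_sum[OF cg]] ev_sum[OF \<mu> cg])
    have E1: "cmod (ev \<mu> (\<lambda>x. ?\<psi> x * g x)) \<le> 2 * e / 3"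
    proof -
      \<comment> \<open>After alignment the two moduli add up, while \<open>?h\<close> stays below
        \<open>1 + \<delta>\<close>: on \<open>?C\<close> the second summand vanishes, and off
        \<open>?C\<close> the first is below \<delta>. Subtracting \<open>N - e / 3\<close> from
        \<open>N * (1 + \<delta>)\<close> leaves \<open>2 * e / 3\<close>.\<close>
      obtain s where s: "cmod s = 1" "cmod (ev \<mu> g0 + of_real 1 * s * ev \<mu> (\<lambda>x. ?\<psi> x * g x)) =
          cmod (ev \<mu> g0) + 1 * cmod (ev \<mu> (\<lambda>x. ?\<psi> x * g x))"
        by (rule align_phase[of 1]) simp
      let ?h = "\<lambda>x. g0 x + s * (?\<psi> x * g x)"
      let ?r = "complex_of_real (1 / (1 + \<delta>))"
      have hc: "c0 ?h" by (intro c0_add g0c c0_scale \<psi>g)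
      have "(\<lambda>x. ?r * ?h x) \<in> ?F"
      proof (intro CollectI conjI ballI)
        fix x assume "x \<in> topspace X - \<Union>\<W>"
        then show "?r * ?h x = 0" using g0(2) g(2) by simp
      next
        show "unit_ball (\<lambda>x. ?r * ?h x)"
          unfolding unit_ball_def
        proof (intro conjI ballI)
          show "c0 (\<lambda>x. ?r * ?h x)" by (rule c0_scale[OF hc])
          fix x assume x: "x \<in> topspace X"
          have "cmod (?h x) \<le> 1 + \<delta>"
          proof (cases "x \<in> ?C")
            case True
            then have h: "?h x = g0 x" using \<zeta>5 by simp
            have "cmod (g0 x) \<le> 1" using g0(1) x by (simp add: unit_ball_def)
            then show ?thesis unfolding h using \<delta> by linarith
          next
            case False
            have "cmod (?\<psi> x) * cmod (g x) \<le> 1 * 1"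
              unfolding norm_of_real using \<psi>01[OF x] g1[OF x] by (intro mult_mono) auto
            moreover have "cmod (g0 x) < \<delta>" using False x by simp
            ultimately show ?thesis
              using norm_triangle_ineq[of "g0 x" "s * (?\<psi> x * g x)"] unfolding norm_mult s(1) by linarith
          qed
          then show "cmod (?r * ?h x) \<le> 1" unfolding norm_mult norm_of_real using \<delta> by simp
        qed
      qed
      then have "cmod (ev \<mu> (\<lambda>x. ?r * ?h x)) \<le> N" by (rule up)
      moreover have "ev \<mu> (\<lambda>x. ?r * ?h x) = ?r * (ev \<mu> g0 + of_real 1 * s * ev \<mu> (\<lambda>x. ?\<psi> x * g x))"
        by (simp only: ev_scale[OF \<mu> hc] ev_add[OF \<mu> g0c c0_scale[OF \<psi>g]] ev_scale[OF \<mu> \<psi>g] of_real_1 mult_1)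
      ultimately have "cmod (?r * (ev \<mu> g0 + of_real 1 * s * ev \<mu> (\<lambda>x. ?\<psi> x * g x))) \<le> N" by (simp only:)
      then have "\<bar>1 / (1 + \<delta>)\<bar> * (cmod (ev \<mu> g0) + 1 * cmod (ev \<mu> (\<lambda>x. ?\<psi> x * g x))) \<le> N"
        by (simp only: norm_mult[of ?r] s(2) norm_of_real)
      then have "cmod (ev \<mu> g0) + cmod (ev \<mu> (\<lambda>x. ?\<psi> x * g x)) \<le> N * (1 + \<delta>)"
        using \<delta> by (simp add: field_simps)
      then show ?thesis using g0(3) N\<delta> by (simp add: distrib_left)
    qed
    have E2: "cmod (\<Sum>p\<in>D. ev \<mu> (\<lambda>x. ?c p x * g x) - L p (\<lambda>x. ?c p x * g x)) \<le> e / 3"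
    proof -
      have "cmod (\<Sum>p\<in>D. ev \<mu> (\<lambda>x. ?c p x * g x) - L p (\<lambda>x. ?c p x * g x)) \<le> (\<Sum>p\<in>D. ?e)"
      proof (rule sum_norm_le)
        fix p assume p: "p \<in> D"
        have "unit_ball (\<lambda>x. ?c p x * g x)"
          unfolding unit_ball_def
        proof (intro conjI ballI cg p)
          fix x assume x: "x \<in> topspace X"
          have "cmod (?c p x) * cmod (g x) \<le> 1 * 1"
            unfolding norm_of_real using \<zeta>le[OF p x] \<zeta>2 p x g1[OF x] by (intro mult_mono) auto
          then show "cmod (?c p x * g x) \<le> 1" by (simp add: norm_mult)
        qed
        moreover have "\<forall>x\<in>topspace X - V p. ?c p x * g x = 0" using \<zeta>3 p by simp
        ultimately show "cmod (ev \<mu> (\<lambda>x. ?c p x * g x) - L p (\<lambda>x. ?c p x * g x)) \<le> ?e"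
          using L[OF p] by blast
      qed
      also have "\<dots> = real (card D) * ?e" by simp
      also have "\<dots> \<le> (real (card D) + 1) * ?e" using \<open>?e > 0\<close> by (intro mult_right_mono) auto
      also have "\<dots> = e / 3" by (simp add: field_simps add_nonneg_eq_0_iff)
      finally show ?thesis .
    qed
    have "ev \<mu> g - ?L g = ev \<mu> (\<lambda>x. ?\<psi> x * g x) + (\<Sum>p\<in>D. ev \<mu> (\<lambda>x. ?c p x * g x) - L p (\<lambda>x. ?c p x * g x))"
      unfolding ev\<psi> sum_subtractf by simp
    also have "cmod \<dots> \<le> 2 * e / 3 + e / 3" by (rule norm_triangle_mono[OF E1 E2])
    finally show ?thesis by simp
  qed
  ultimately show "\<exists>L. atomic L \<and> (\<forall>g. unit_ball g \<and> (\<forall>x\<in>topspace X - \<Union>\<W>. g x = 0) \<longrightarrow> cmod (ev \<mu> g - L g) \<le> e)"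
    by blast
qed

lemma scattered_approx_atomic:
  assumes X: "scattered_space X" and \<mu>: "\<mu> \<in> MX" and e: "e > 0"
  obtains D c where "finite D" "D \<subseteq> topspace X"
    "\<forall>g. unit_ball g \<longrightarrow> cmod (ev \<mu> g - (\<Sum>x\<in>D. c x * g x)) \<le> e"
proof -
  define W where "W = \<Union>{W. openin X W \<and> approx_atomic_on \<mu> W}"
  have un: "approx_atomic_on \<mu> W"
    unfolding W_def by (rule approx_atomic_on_Union[OF \<mu>]) simp
  have upper: "V \<subseteq> W" if "openin X V" "approx_atomic_on \<mu> V" for V
    unfolding W_def using that by (intro Union_upper) simp
  have all: "topspace X - W = {}"
  proof (rule ccontr)
    assume "topspace X - W \<noteq> {}"
    then have "\<exists>p\<in>topspace X - W. openin (subtopology X (topspace X - W)) {p}"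
      using X[unfolded scattered_space_def, rule_format, of "topspace X - W"] by simp
    then obtain p V where p: "p \<in> topspace X - W" and V: "openin X V" "{p} = V \<inter> (topspace X - W)"
      unfolding openin_subtopology by (elim bexE exE conjE) (rule that)
    have "p \<in> V" using V(2) by auto
    moreover have "V - W \<subseteq> {p}" using V(2) openin_subset[OF V(1)] by auto
    ultimately have "approx_atomic_on \<mu> V" by (rule approx_atomic_on_insert[OF \<mu> un V(1)])
    then show False using upper[OF V(1)] \<open>p \<in> V\<close> p by auto
  qed
  obtain L where L: "atomic L" "\<forall>g. unit_ball g \<and> (\<forall>x\<in>topspace X - W. g x = 0) \<longrightarrow> cmod (ev \<mu> g - L g) \<le> e"
    using un[unfolded approx_atomic_on_def, rule_format, OF e] by (elim exE conjE) (rule that)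
  obtain D c where D: "finite D" "D \<subseteq> topspace X" "L = (\<lambda>g. \<Sum>x\<in>D. c x * g x)"
    using L(1) unfolding atomic_def by blast
  show ?thesis
  proof (rule that[OF D(1,2)], intro allI impI)
    fix g assume "unit_ball g"
    then show "cmod (ev \<mu> g - (\<Sum>x\<in>D. c x * g x)) \<le> e"
      using L(2) unfolding all D(3) by simp
  qed
qed

section \<open>The Arens product at approximately atomic functionals\<close>

lemma dual_act_MX:
  assumes \<mu>: "\<mu> \<in> MX" and a: "c0 a"
  shows "dual_act (C0 X) \<mu> a \<in> MX" "c0 f \<Longrightarrow> ev (dual_act (C0 X) \<mu> a) f = ev \<mu> (\<lambda>x. a x * f x)"
proof -
  let ?L = "\<lambda>f. ev \<mu> (\<lambda>x. a x * f x)"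
  have af: "c0 (\<lambda>x. a x * f x)" if "c0 f" for f by (rule c0_mult[OF a that])
  obtain B where B: "B > 0" "\<And>x. x \<in> topspace X \<Longrightarrow> cmod (a x) \<le> B"
    using c0_bounded[OF a] by blast
  have 1: "?L (\<lambda>x. f x + g x) = ?L f + ?L g" if "c0 f" "c0 g" for f g
    unfolding distrib_left by (rule ev_add[OF \<mu> af[OF that(1)] af[OF that(2)]])
  have 2: "?L (\<lambda>x. d * f x) = d * ?L f" if "c0 f" for f d
    unfolding mult.left_commute[of _ d] by (rule ev_scale[OF \<mu> af[OF that]])
  have 3: "?L f = ?L g" if "\<And>x. x \<in> topspace X \<Longrightarrow> f x = g x" for f g
    by (rule ev_cong) (simp only: that)
  have 4: "cmod (?L f) \<le> mnorm \<mu> * B" if f: "unit_ball f" for f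
  proof (rule ev_bound[OF \<mu> af[OF unit_ball_c0[OF f]]])
    fix x assume x: "x \<in> topspace X"
    have "cmod (a x) * cmod (f x) \<le> B * 1"
      using B(2)[OF x] f x B(1) by (intro mult_mono) (auto simp: unit_ball_def)
    then show "cmod (a x * f x) \<le> B" by (simp add: norm_mult)
  qed (use B in simp)
  have eq: "dual_act (C0 X) \<mu> a = restrict ?L CX"
    unfolding dual_act_def C0_ops ev_def ..
  show "dual_act (C0 X) \<mu> a \<in> MX"
    unfolding eq by (rule functional_intro(1)[where L = ?L and B = "mnorm \<mu> * B"]) (fact 1 2 3 4)+
  show "ev (dual_act (C0 X) \<mu> a) f = ?L f" if "c0 f"
    unfolding eq by (rule functional_intro(2)[where L = ?L and B = "mnorm \<mu> * B"]) (fact 1 2 3 4 that)+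
qed

lemma vadd_MX:
  assumes "\<mu> \<in> MX" "\<nu> \<in> MX"
  shows "vadd (dual (C0 X)) \<mu> \<nu> \<in> MX" "c0 f \<Longrightarrow> ev (vadd (dual (C0 X)) \<mu> \<nu>) f = ev \<mu> f + ev \<nu> f"
proof -
  let ?\<nu> = "\<lambda>b. if b then \<mu> else \<nu>"
  have eq: "vadd (dual (C0 X)) \<mu> \<nu> = lincomb UNIV (\<lambda>_. 1) ?\<nu>"
    unfolding dual_ops lincomb_def by (rule restrict_ext) (simp add: UNIV_bool)
  have m: "\<And>b. ?\<nu> b \<in> MX" using assms by simp
  show "vadd (dual (C0 X)) \<mu> \<nu> \<in> MX" unfolding eq by (rule lincomb_MX[OF m])
  show "ev (vadd (dual (C0 X)) \<mu> \<nu>) f = ev \<mu> f + ev \<nu> f" if "c0 f"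
    unfolding eq ev_lincomb[OF m that] by (simp add: UNIV_bool)
qed

lemma vscale_MX:
  assumes "\<mu> \<in> MX"
  shows "vscale (dual (C0 X)) c \<mu> \<in> MX" "c0 f \<Longrightarrow> ev (vscale (dual (C0 X)) c \<mu>) f = c * ev \<mu> f"
proof -
  have eq: "vscale (dual (C0 X)) c \<mu> = lincomb {()} (\<lambda>_. c) (\<lambda>_. \<mu>)"
    unfolding dual_ops lincomb_def by (rule restrict_ext) simp
  show "vscale (dual (C0 X)) c \<mu> \<in> MX" unfolding eq using assms by (rule lincomb_MX)
  show "ev (vscale (dual (C0 X)) c \<mu>) f = c * ev \<mu> f" if "c0 f"
    unfolding eq using ev_lincomb[of "{()}" "\<lambda>_. \<mu>" f "\<lambda>_. c"] assms that by simp
qed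

lemma bidual_act_MX:
  assumes \<Psi>: "\<Psi> \<in> BX" and \<mu>: "\<mu> \<in> MX"
  shows "bidual_act (C0 X) \<Psi> \<mu> \<in> MX" "c0 f \<Longrightarrow> ev (bidual_act (C0 X) \<Psi> \<mu>) f = \<Psi> (dual_act (C0 X) \<mu> f)"
proof -
  let ?L = "\<lambda>f. \<Psi> (dual_act (C0 X) \<mu> f)"
  have 1: "?L (\<lambda>x. f x + g x) = ?L f + ?L g" if fg: "c0 f" "c0 g" for f g
  proof -
    have "dual_act (C0 X) \<mu> (\<lambda>x. f x + g x) = vadd (dual (C0 X)) (dual_act (C0 X) \<mu> f) (dual_act (C0 X) \<mu> g)"
    proof (rule MX_eqI)
      fix h assume h: "c0 h"
      show "ev (dual_act (C0 X) \<mu> (\<lambda>x. f x + g x)) h = ev (vadd (dual (C0 X)) (dual_act (C0 X) \<mu> f) (dual_act (C0 X) \<mu> g)) h"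
        by (simp only: dual_act_MX[OF \<mu>] c0_add fg vadd_MX h distrib_right ev_add[OF \<mu>] c0_mult)
    qed (intro dual_act_MX \<mu> c0_add fg vadd_MX)+
    then show ?thesis using BX_add[OF \<Psi> dual_act_MX(1)[OF \<mu> fg(1)] dual_act_MX(1)[OF \<mu> fg(2)]] by (simp only:)
  qed
  have 2: "?L (\<lambda>x. d * f x) = d * ?L f" if f: "c0 f" for f d
  proof -
    have "dual_act (C0 X) \<mu> (\<lambda>x. d * f x) = vscale (dual (C0 X)) d (dual_act (C0 X) \<mu> f)"
    proof (rule MX_eqI)
      fix h assume h: "c0 h"
      show "ev (dual_act (C0 X) \<mu> (\<lambda>x. d * f x)) h = ev (vscale (dual (C0 X)) d (dual_act (C0 X) \<mu> f)) h"
        by (simp only: dual_act_MX[OF \<mu>] c0_scale f vscale_MX h mult.assoc ev_scale[OF \<mu>] c0_mult)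
    qed (intro dual_act_MX \<mu> c0_scale f vscale_MX)+
    then show ?thesis using BX_scale[OF \<Psi> dual_act_MX(1)[OF \<mu> f]] by (simp only:)
  qed
  have 3: "?L f = ?L g" if "\<And>x. x \<in> topspace X \<Longrightarrow> f x = g x" for f g
  proof -
    have "dual_act (C0 X) \<mu> f = dual_act (C0 X) \<mu> g"
      unfolding dual_act_def C0_ops
      by (rule restrict_ext, rule arg_cong[where f = \<mu>], rule restrict_ext) (simp only: that)
    then show ?thesis by (simp only:)
  qed
  have 4: "cmod (?L f) \<le> bnorm \<Psi> * mnorm \<mu>" if f: "unit_ball f" for f
  proof (rule BX_bound[OF \<Psi> dual_act_MX(1)[OF \<mu> unit_ball_c0[OF f]]], rule mnorm_le)
    fix g assume g: "unit_ball g"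
    have "unit_ball (\<lambda>x. f x * g x)" by (rule unit_ball_mult[OF f g])
    then show "cmod (ev (dual_act (C0 X) \<mu> f) g) \<le> mnorm \<mu>"
      unfolding dual_act_MX(2)[OF \<mu> unit_ball_c0[OF f] unit_ball_c0[OF g]] by (rule ev_bound_unit[OF \<mu>])
  qed
  show "bidual_act (C0 X) \<Psi> \<mu> \<in> MX"
    unfolding bidual_act_def by (rule functional_intro(1)[where L = ?L and B = "bnorm \<Psi> * mnorm \<mu>"]) (fact 1 2 3 4)+
  show "ev (bidual_act (C0 X) \<Psi> \<mu>) f = ?L f" if "c0 f"
    unfolding bidual_act_def by (rule functional_intro(2)[where L = ?L and B = "bnorm \<Psi> * mnorm \<mu>"]) (fact 1 2 3 4 that)+
qed

text \<open>\<open>BX_approx\<close> is used twice: for \<open>\<Psi>\<close> at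
  \<open>dual_act (C0 X) \<mu> f\<close>, whose approximating atoms are those for
  \<open>\<mu>\<close> weighted by \<open>f\<close>, and then for \<open>\<Phi>\<close> at
  \<open>bidual_act (C0 X) \<Psi> \<mu>\<close>. Each use costs one norm.\<close>

lemma arens_approx:
  assumes \<Phi>: "\<Phi> \<in> BX" and \<Psi>: "\<Psi> \<in> BX" and \<mu>: "\<mu> \<in> MX" and D: "finite D" "D \<subseteq> topspace X" and e: "e \<ge> 0"
    and le: "\<And>g. unit_ball g \<Longrightarrow> cmod (ev \<mu> g - (\<Sum>x\<in>D. c x * g x)) \<le> e"
  shows "cmod (arens (C0 X) \<Phi> \<Psi> \<mu> - (\<Sum>x\<in>D. c x * (\<Phi> (dirac x) * \<Psi> (dirac x)))) \<le> bnorm \<Phi> * (bnorm \<Psi> * e)"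
proof -
  have d: "dirac x \<in> MX" if "x \<in> D" for x using D(2) that dirac_MX by blast
  have evd: "ev (dirac x) f = f x" if "x \<in> D" "c0 f" for x f using D(2) that ev_dirac by blast
  have "cmod (\<Phi> (bidual_act (C0 X) \<Psi> \<mu>) - (\<Sum>x\<in>D. (c x * \<Psi> (dirac x)) * \<Phi> (dirac x))) \<le> bnorm \<Phi> * (bnorm \<Psi> * e)"
  proof (rule BX_approx[OF \<Phi> bidual_act_MX(1)[OF \<Psi> \<mu>] D(1) d])
    fix f assume f: "unit_ball f"
    have fc: "c0 f" by (rule unit_ball_c0[OF f])
    have "cmod (\<Psi> (dual_act (C0 X) \<mu> f) - (\<Sum>x\<in>D. (c x * f x) * \<Psi> (dirac x))) \<le> bnorm \<Psi> * e"
    proof (rule BX_approx[OF \<Psi> dual_act_MX(1)[OF \<mu> fc] D(1) d])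
      fix g assume g: "unit_ball g"
      have gc: "c0 g" by (rule unit_ball_c0[OF g])
      have "unit_ball (\<lambda>x. f x * g x)" by (rule unit_ball_mult[OF f g])
      from le[OF this] show "cmod (ev (dual_act (C0 X) \<mu> f) g - (\<Sum>x\<in>D. c x * f x * ev (dirac x) g)) \<le> e"
        by (simp only: dual_act_MX(2)[OF \<mu> fc gc] evd gc mult.assoc cong: sum.cong)
    qed
    moreover have "(\<Sum>x\<in>D. c x * \<Psi> (dirac x) * ev (dirac x) f) = (\<Sum>x\<in>D. (c x * f x) * \<Psi> (dirac x))"
      by (intro sum.cong) (simp_all add: evd fc)
    ultimately show "cmod (ev (bidual_act (C0 X) \<Psi> \<mu>) f - (\<Sum>x\<in>D. c x * \<Psi> (dirac x) * ev (dirac x) f)) \<le> bnorm \<Psi> * e"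
      by (simp only: bidual_act_MX(2)[OF \<Psi> \<mu> fc])
  qed
  moreover have "arens (C0 X) \<Phi> \<Psi> \<mu> = \<Phi> (bidual_act (C0 X) \<Psi> \<mu>)"
    using \<mu> by (simp add: arens_def)
  ultimately show ?thesis by (simp only: mult.assoc mult.commute[of "\<Psi> _"])
qed

end

context C0_ultrapower
begin

text \<open>At a single point the limit of products is the product of limits. The atomic
  approximation carries this over to \<open>\<mu>\<close>, with an error uniform in \<open>i\<close>
  because the family of products is bounded.\<close>

lemma scattered_imp_product:
  assumes X: "scattered_space X" and x: "x \<in> LX" and y: "y \<in> LX"
    and \<Phi>: "ultra_sigma (C0 X) I U (cls x) \<in> BX" and \<Psi>: "ultra_sigma (C0 X) I U (cls y) \<in> BX"
  shows "ultra_sigma (C0 X) I U (ultra_mult (C0 X) I U (cls x) (cls y)) =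
    arens (C0 X) (ultra_sigma (C0 X) I U (cls x)) (ultra_sigma (C0 X) I U (cls y))" (is "?l = arens (C0 X) ?\<Phi> ?\<Psi>")
proof (rule extensionalityI[OF sigma_extensional])
  show "arens (C0 X) ?\<Phi> ?\<Psi> \<in> extensional MX" unfolding arens_def by (rule restrict_extensional)
  fix \<mu> assume \<mu>: "\<mu> \<in> MX"
  let ?z = "fam (\<lambda>i t. x i t * y i t)"
  have z: "?z \<in> LX" by (rule LX_mult[OF x y])
  obtain B where B: "B > 0" "\<forall>i\<in>I. \<forall>t\<in>topspace X. cmod (?z i t) \<le> B" using LX_D(3)[OF z] by blast
  let ?b = "bnorm ?\<Phi> * bnorm ?\<Psi>"
  have b: "?b \<ge> 0" using bnorm_nonneg \<Phi> \<Psi> by simp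
  have lim: "((\<lambda>i. ev \<mu> (?z i)) \<longlongrightarrow> ?l \<mu>) U"
    unfolding cls_mult[OF x y] by (rule ev_tendsto_sigma[OF z \<mu>])
  have "cmod (?l \<mu> - arens (C0 X) ?\<Phi> ?\<Psi> \<mu>) \<le> (B + ?b) * e" if e: "e > 0" for e
  proof -
    obtain D c where D: "finite D" "D \<subseteq> topspace X"
      and le: "\<forall>g. unit_ball g \<longrightarrow> cmod (ev \<mu> g - (\<Sum>x\<in>D. c x * g x)) \<le> e"
      by (rule scattered_approx_atomic[OF X \<mu> e])
    have pt: "((\<lambda>i. w i t) \<longlongrightarrow> ultra_sigma (C0 X) I U (cls w) (dirac t)) U" if "w \<in> LX" "t \<in> D" for w t
    proof -
      have t: "t \<in> topspace X" using that D(2) by blast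
      have "((\<lambda>i. ev (dirac t) (w i)) \<longlongrightarrow> ultra_sigma (C0 X) I U (cls w) (dirac t)) U"
        by (rule ev_tendsto_sigma[OF that(1) dirac_MX[OF t]])
      moreover have "eventually (\<lambda>i. ev (dirac t) (w i) = w i t) U"
        using eventually_I by eventually_elim (rule ev_dirac[OF t LX_D(2)[OF that(1)]])
      ultimately show ?thesis using tendsto_cong by fast
    qed
    let ?s = "\<Sum>t\<in>D. c t * (?\<Phi> (dirac t) * ?\<Psi> (dirac t))"
    have "((\<lambda>i. \<Sum>t\<in>D. c t * (x i t * y i t)) \<longlongrightarrow> ?s) U"
      by (intro tendsto_sum tendsto_mult tendsto_const pt x y)
    with lim have "((\<lambda>i. cmod (ev \<mu> (?z i) - (\<Sum>t\<in>D. c t * (x i t * y i t)))) \<longlongrightarrow> cmod (?l \<mu> - ?s)) U"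
      by (intro tendsto_norm tendsto_diff)
    moreover have "eventually (\<lambda>i. cmod (ev \<mu> (?z i) - (\<Sum>t\<in>D. c t * (x i t * y i t))) \<le> B * e) U"
      using eventually_I
    proof eventually_elim
      case (elim i)
      \<comment> \<open>The approximation is known on the unit ball only, so the product is scaled
        down by its bound \<open>B\<close>.\<close>
      let ?g = "\<lambda>t. complex_of_real (1/B) * ?z i t"
      have zc: "c0 (?z i)" by (rule LX_D(2)[OF z elim])
      have "unit_ball ?g"
        unfolding unit_ball_def
      proof (intro conjI ballI c0_scale zc)
        fix t assume "t \<in> topspace X"
        then have "cmod (?z i t) \<le> B" using B(2) elim by blast
        then show "cmod (?g t) \<le> 1" unfolding norm_mult norm_of_real using B(1) by simp
      qed
      then have "cmod (ev \<mu> ?g - (\<Sum>t\<in>D. c t * ?g t)) \<le> e" using le by blast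
      moreover have "(\<Sum>t\<in>D. c t * ?g t) = complex_of_real (1/B) * (\<Sum>t\<in>D. c t * (x i t * y i t))"
        unfolding sum_distrib_left
      proof (rule sum.cong[OF refl])
        fix t assume "t \<in> D"
        then have "?z i t = x i t * y i t" using D(2) elim by (intro fam_apply) blast+
        then show "c t * ?g t = complex_of_real (1/B) * (c t * (x i t * y i t))"
          by (simp only: mult.left_commute)
      qed
      ultimately have "cmod (complex_of_real (1/B) * (ev \<mu> (?z i) - (\<Sum>t\<in>D. c t * (x i t * y i t)))) \<le> e"
        by (simp only: ev_scale[OF \<mu> zc] right_diff_distrib)
      then have "cmod (ev \<mu> (?z i) - (\<Sum>t\<in>D. c t * (x i t * y i t))) / B \<le> e"
        unfolding norm_mult norm_of_real using B(1) by simp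
      then show ?case using B(1) by (simp add: field_simps)
    qed
    ultimately have "cmod (?l \<mu> - ?s) \<le> B * e"
      using tendsto_upperbound U_not_bot by blast
    moreover have "cmod (arens (C0 X) ?\<Phi> ?\<Psi> \<mu> - ?s) \<le> bnorm ?\<Phi> * (bnorm ?\<Psi> * e)"
      using le by (intro arens_approx \<Phi> \<Psi> \<mu> D less_imp_le[OF e]) blast
    ultimately show ?thesis
      using norm_triangle_ineq4[of "?l \<mu> - ?s" "arens (C0 X) ?\<Phi> ?\<Psi> \<mu> - ?s"] by (simp add: algebra_simps)
  qed
  then have *: "cmod (?l \<mu> - arens (C0 X) ?\<Phi> ?\<Psi> \<mu>) \<le> (B + ?b) * e" if "e > 0" for e using that .
  have "cmod (?l \<mu> - arens (C0 X) ?\<Phi> ?\<Psi> \<mu>) \<le> 0 + e" if e: "e > 0" for e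
  proof -
    have "B + ?b > 0" using B(1) b by linarith
    then show ?thesis using *[of "e / (B + ?b)"] e by simp
  qed
  then have "cmod (?l \<mu> - arens (C0 X) ?\<Phi> ?\<Psi> \<mu>) \<le> 0" by (rule field_le_epsilon)
  then show "?l \<mu> = arens (C0 X) ?\<Phi> ?\<Psi> \<mu>" by simp
qed

end

section \<open>Liftings of the bidual\<close>

lemma dual_I:
  assumes "\<mu> \<in> extensional (vecs E)"
    and "\<And>x y. x \<in> vecs E \<Longrightarrow> y \<in> vecs E \<Longrightarrow> \<mu> (vadd E x y) = \<mu> x + \<mu> y"
    and "\<And>c x. x \<in> vecs E \<Longrightarrow> \<mu> (vscale E c x) = c * \<mu> x"
    and "\<And>x. x \<in> vecs E \<Longrightarrow> cmod (\<mu> x) \<le> B * vnorm E x"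
  shows "\<mu> \<in> vecs (dual E)"
  using assms(1-3) exI[of "\<lambda>B. \<forall>x\<in>vecs E. cmod (\<mu> x) \<le> B * vnorm E x" B] assms(4)
  by (simp add: dual_def bounded_linear_map_def scalars_def)

context lch_space
begin

lemma BX_I:
  assumes add: "\<And>\<mu> \<nu>. \<mu> \<in> MX \<Longrightarrow> \<nu> \<in> MX \<Longrightarrow> L (vadd (dual (C0 X)) \<mu> \<nu>) = L \<mu> + L \<nu>"
    and scale: "\<And>c \<mu>. \<mu> \<in> MX \<Longrightarrow> L (vscale (dual (C0 X)) c \<mu>) = c * L \<mu>"
    and bound: "\<And>\<mu>. \<mu> \<in> MX \<Longrightarrow> cmod (L \<mu>) \<le> B * mnorm \<mu>"
  shows "restrict L MX \<in> BX"
proof (rule dual_I)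
  show "restrict L MX \<in> extensional MX" by (rule restrict_extensional)
  fix \<mu> assume \<mu>: "\<mu> \<in> MX"
  show "restrict L MX (vadd (dual (C0 X)) \<mu> \<nu>) = restrict L MX \<mu> + restrict L MX \<nu>" if "\<nu> \<in> MX" for \<nu>
    by (simp only: restrict_apply' \<mu> that vadd_MX(1) add)
  show "restrict L MX (vscale (dual (C0 X)) c \<mu>) = c * restrict L MX \<mu>" for c
    by (simp only: restrict_apply' \<mu> vscale_MX(1) scale)
  show "cmod (restrict L MX \<mu>) \<le> B * mnorm \<mu>"
    by (simp only: restrict_apply' \<mu> bound)
qed

lemma canonical_BX:
  assumes a: "a \<in> CX"
  shows "canonical_embedding (C0 X) a \<in> BX"
proof -
  have ac: "c0 a" by (rule CX_c0[OF a])
  obtain B where B: "B > 0" "\<And>x. x \<in> topspace X \<Longrightarrow> cmod (a x) \<le> B"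
    using c0_bounded[OF ac] by blast
  have "restrict (\<lambda>\<mu>. ev \<mu> a) MX \<in> BX"
  proof (rule BX_I)
    fix \<mu> assume \<mu>: "\<mu> \<in> MX"
    show "ev (vadd (dual (C0 X)) \<mu> \<nu>) a = ev \<mu> a + ev \<nu> a" if "\<nu> \<in> MX" for \<nu>
      by (rule vadd_MX(2)[OF \<mu> that ac])
    show "ev (vscale (dual (C0 X)) c \<mu>) a = c * ev \<mu> a" for c
      by (rule vscale_MX(2)[OF \<mu> ac])
    show "cmod (ev \<mu> a) \<le> B * mnorm \<mu>"
      using ev_bound[OF \<mu> ac B(2) less_imp_le[OF B(1)]] by (simp only: mult.commute)
  qed
  moreover have "canonical_embedding (C0 X) a = restrict (\<lambda>\<mu>. ev \<mu> a) MX"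
    unfolding canonical_embedding_def by (rule restrict_ext) (simp only: ev_CX[OF a])
  ultimately show ?thesis by (simp only:)
qed

lemma canonical_apply: "a \<in> CX \<Longrightarrow> \<mu> \<in> MX \<Longrightarrow> canonical_embedding (C0 X) a \<mu> = ev \<mu> a"
  unfolding canonical_embedding_def by (simp only: restrict_apply' ev_CX)

end

context C0_ultrapower
begin

text \<open>Linearity and a common bound are asked of every \<open>T i\<close>, the two lifting
  conditions only in the limit: weak* convergence \<open>weak\<close> makes the map a right inverse
  of \<open>ultra_sigma\<close>, and norm convergence \<open>const\<close> on the canonical image
  gives the constant classes.\<close>

lemma lifting_of_approximations:
  fixes T :: "'i \<Rightarrow> ((('a \<Rightarrow> complex) \<Rightarrow> complex) \<Rightarrow> complex) \<Rightarrow> 'a \<Rightarrow> complex"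
  assumes c: "\<And>i \<Phi>. i \<in> I \<Longrightarrow> \<Phi> \<in> BX \<Longrightarrow> c0 (T i \<Phi>)"
    and add: "\<And>i \<Phi> \<Psi> t. i \<in> I \<Longrightarrow> \<Phi> \<in> BX \<Longrightarrow> \<Psi> \<in> BX \<Longrightarrow> t \<in> topspace X \<Longrightarrow>
      T i (vadd (bidual (C0 X)) \<Phi> \<Psi>) t = T i \<Phi> t + T i \<Psi> t"
    and scale: "\<And>i \<Phi> d t. i \<in> I \<Longrightarrow> \<Phi> \<in> BX \<Longrightarrow> t \<in> topspace X \<Longrightarrow>
      T i (vscale (bidual (C0 X)) d \<Phi>) t = d * T i \<Phi> t"
    and bound: "\<And>i \<Phi> t. i \<in> I \<Longrightarrow> \<Phi> \<in> BX \<Longrightarrow> t \<in> topspace X \<Longrightarrow> cmod (T i \<Phi> t) \<le> B * bnorm \<Phi>"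
    and B: "B \<ge> 0"
    and weak: "\<And>\<Phi> \<mu>. \<Phi> \<in> BX \<Longrightarrow> \<mu> \<in> MX \<Longrightarrow> ((\<lambda>i. ev \<mu> (T i \<Phi>)) \<longlongrightarrow> \<Phi> \<mu>) U"
    and const: "\<And>a e. a \<in> CX \<Longrightarrow> e > 0 \<Longrightarrow>
      eventually (\<lambda>i. \<forall>t\<in>topspace X. cmod (T i (canonical_embedding (C0 X) a) t - a t) \<le> e) U"
  shows "\<And>\<Phi>. \<Phi> \<in> BX \<Longrightarrow> fam (\<lambda>i. T i \<Phi>) \<in> LX"
    "bounded_linear_map (bidual (C0 X)) (ultrapower (C0 X) I U) (\<lambda>\<Phi>. cls (fam (\<lambda>i. T i \<Phi>)))"
    "\<And>\<Phi>. \<Phi> \<in> BX \<Longrightarrow> ultra_sigma (C0 X) I U (cls (fam (\<lambda>i. T i \<Phi>))) = \<Phi>"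
    "\<And>a. a \<in> CX \<Longrightarrow> cls (fam (\<lambda>i. T i (canonical_embedding (C0 X) a))) = ultra_const (C0 X) I U a"
proof -
  show LX: "fam (\<lambda>i. T i \<Phi>) \<in> LX" if "\<Phi> \<in> BX" for \<Phi>
    by (rule fam_LX[OF c[OF _ that] bound[OF _ that]])
  show "bounded_linear_map (bidual (C0 X)) (ultrapower (C0 X) I U) (\<lambda>\<Phi>. cls (fam (\<lambda>i. T i \<Phi>)))"
    unfolding bounded_linear_map_def
  proof (intro conjI ballI allI exI)
    fix \<Phi> assume \<Phi>: "\<Phi> \<in> BX"
    show "cls (fam (\<lambda>i. T i \<Phi>)) \<in> vecs (ultrapower (C0 X) I U)"
      by (rule cls_vecs[OF LX[OF \<Phi>]])
    show "vnorm (ultrapower (C0 X) I U) (cls (fam (\<lambda>i. T i \<Phi>))) \<le> B * bnorm \<Phi>"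
    proof (rule cls_norm_le[OF LX[OF \<Phi>]])
      show "0 \<le> B * bnorm \<Phi>" using B bnorm_nonneg[OF \<Phi>] by simp
      fix i t assume "i \<in> I" "t \<in> topspace X"
      then show "cmod (fam (\<lambda>i. T i \<Phi>) i t) \<le> B * bnorm \<Phi>" using bound \<Phi> by simp
    qed
    fix d
    show "cls (fam (\<lambda>i. T i (vscale (bidual (C0 X)) d \<Phi>))) =
        vscale (ultrapower (C0 X) I U) d (cls (fam (\<lambda>i. T i \<Phi>)))"
      unfolding cls_scale[OF LX[OF \<Phi>]]
    proof (rule arg_cong[where f = cls])
      show "fam (\<lambda>i. T i (vscale (bidual (C0 X)) d \<Phi>)) = fam (\<lambda>i t. d * fam (\<lambda>i. T i \<Phi>) i t)"
        unfolding fam_def by (intro restrict_ext) (simp only: restrict_apply' scale \<Phi>)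
    qed
  next
    fix \<Phi> \<Psi> assume \<Phi>: "\<Phi> \<in> BX" and \<Psi>: "\<Psi> \<in> BX"
    show "cls (fam (\<lambda>i. T i (vadd (bidual (C0 X)) \<Phi> \<Psi>))) =
        vadd (ultrapower (C0 X) I U) (cls (fam (\<lambda>i. T i \<Phi>))) (cls (fam (\<lambda>i. T i \<Psi>)))"
      unfolding cls_add[OF LX[OF \<Phi>] LX[OF \<Psi>]]
    proof (rule arg_cong[where f = cls])
      show "fam (\<lambda>i. T i (vadd (bidual (C0 X)) \<Phi> \<Psi>)) =
          fam (\<lambda>i t. fam (\<lambda>i. T i \<Phi>) i t + fam (\<lambda>i. T i \<Psi>) i t)"
        unfolding fam_def by (intro restrict_ext) (simp only: restrict_apply' add \<Phi> \<Psi>)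
    qed
  qed
  show "ultra_sigma (C0 X) I U (cls (fam (\<lambda>i. T i \<Phi>))) = \<Phi>" if \<Phi>: "\<Phi> \<in> BX" for \<Phi>
  proof (rule extensionalityI[OF sigma_extensional dual_D(4)[OF \<Phi>]])
    fix \<mu> assume \<mu>: "\<mu> \<in> MX"
    have "eventually (\<lambda>i. ev \<mu> (T i \<Phi>) = ev \<mu> (fam (\<lambda>i. T i \<Phi>) i)) U"
      using eventually_I by eventually_elim (simp only: ev_fam)
    then have "((\<lambda>i. ev \<mu> (fam (\<lambda>i. T i \<Phi>) i)) \<longlongrightarrow> \<Phi> \<mu>) U"
      by (rule Lim_transform_eventually[OF weak[OF \<Phi> \<mu>]])
    then show "ultra_sigma (C0 X) I U (cls (fam (\<lambda>i. T i \<Phi>))) \<mu> = \<Phi> \<mu>"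
      by (rule sigma_cls[OF LX[OF \<Phi>] \<mu>])
  qed
  show "cls (fam (\<lambda>i. T i (canonical_embedding (C0 X) a))) = ultra_const (C0 X) I U a" if a: "a \<in> CX" for a
  proof -
    have eq: "(\<lambda>i\<in>I. a) = fam (\<lambda>i. a)" unfolding fam_def by (simp only: CX_restrict[OF a])
    obtain C where C: "C > 0" "\<And>x. x \<in> topspace X \<Longrightarrow> cmod (a x) \<le> C"
      using c0_bounded[OF CX_c0[OF a]] by blast
    have "fam (\<lambda>i. a) \<in> LX" by (rule fam_LX[OF CX_c0[OF a] C(2)])
    then show ?thesis
      unfolding ultra_const_def eq
      by (intro cls_eq fam_rel LX canonical_BX a const)
  qed
qed

end

section \<open>Weakly null nets with non-null squares\<close>

text \<open>For independent random signs the left-hand side has the right-hand side as its mean,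
  because cross terms average out. The induction fixes one sign at a time: by the parallelogram
  identity one of the two choices does not exceed the mean. The same signs serve all
  \<open>m\<close> in \<open>F\<close>.\<close>

lemma exists_signs:
  fixes v :: "'m \<Rightarrow> 'k \<Rightarrow> complex"
  assumes "finite S"
  shows "\<exists>\<sigma> :: 'k \<Rightarrow> real. (\<forall>k. \<sigma> k = 1 \<or> \<sigma> k = -1) \<and>
    (\<Sum>m\<in>F. (cmod (\<Sum>k\<in>S. of_real (\<sigma> k) * v m k))\<^sup>2) \<le> (\<Sum>m\<in>F. \<Sum>k\<in>S. (cmod (v m k))\<^sup>2)"
  using assms
proof (induction S)
  case empty
  show ?case by (intro exI[of _ "\<lambda>_. 1"]) simp
next
  case (insert j S)
  then obtain \<sigma> :: "'k \<Rightarrow> real" where \<sigma>: "\<forall>k. \<sigma> k = 1 \<or> \<sigma> k = -1"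
    "(\<Sum>m\<in>F. (cmod (\<Sum>k\<in>S. of_real (\<sigma> k) * v m k))\<^sup>2) \<le> (\<Sum>m\<in>F. \<Sum>k\<in>S. (cmod (v m k))\<^sup>2)"
    by blast
  let ?u = "\<lambda>m. \<Sum>k\<in>S. of_real (\<sigma> k) * v m k"
  let ?f = "\<lambda>s. \<Sum>m\<in>F. (cmod (of_real s * v m j + ?u m))\<^sup>2"
  have half: "a \<le> c \<or> b \<le> c" if "a + b \<le> 2 * c" for a b c :: real using that by linarith
  have par: "(cmod (z + w))\<^sup>2 + (cmod (- z + w))\<^sup>2 = 2 * (cmod z)\<^sup>2 + 2 * (cmod w)\<^sup>2" for z w :: complex
    unfolding cmod_power2 by (simp add: power2_eq_square algebra_simps)
  have "?f 1 + ?f (-1) = (\<Sum>m\<in>F. 2 * (cmod (v m j))\<^sup>2 + 2 * (cmod (?u m))\<^sup>2)"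
    unfolding sum.distrib[symmetric] 
    by (intro sum.cong refl) (simp only: of_real_minus of_real_1 mult_1 mult_minus1 par)
  also have "\<dots> = 2 * ((\<Sum>m\<in>F. (cmod (v m j))\<^sup>2) + (\<Sum>m\<in>F. (cmod (?u m))\<^sup>2))"
    by (simp add: sum.distrib sum_distrib_left)
  finally have "?f 1 + ?f (-1) \<le> 2 * (\<Sum>m\<in>F. \<Sum>k\<in>insert j S. (cmod (v m k))\<^sup>2)"
    using \<sigma>(2) insert.hyps by (simp add: sum.distrib)
  then have "?f 1 \<le> (\<Sum>m\<in>F. \<Sum>k\<in>insert j S. (cmod (v m k))\<^sup>2) \<or>
      ?f (-1) \<le> (\<Sum>m\<in>F. \<Sum>k\<in>insert j S. (cmod (v m k))\<^sup>2)"
    by (rule half)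
  then obtain s :: real where s: "s = 1 \<or> s = -1" "?f s \<le> (\<Sum>m\<in>F. \<Sum>k\<in>insert j S. (cmod (v m k))\<^sup>2)"
  proof
    assume "?f 1 \<le> (\<Sum>m\<in>F. \<Sum>k\<in>insert j S. (cmod (v m k))\<^sup>2)"
    then show ?thesis by (intro that[of 1] disjI1 refl)
  next
    assume "?f (-1) \<le> (\<Sum>m\<in>F. \<Sum>k\<in>insert j S. (cmod (v m k))\<^sup>2)"
    then show ?thesis by (intro that[of "-1"] disjI2 refl)
  qed
  let ?\<sigma> = "\<sigma>(j := s)"
  have "(\<Sum>k\<in>insert j S. of_real (?\<sigma> k) * v m k) = of_real s * v m j + ?u m" for m
  proof -
    have "(\<Sum>k\<in>S. of_real (?\<sigma> k) * v m k) = ?u m" using insert.hyps by (intro sum.cong) auto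
    then show ?thesis using insert.hyps by simp
  qed
  then have "(\<Sum>m\<in>F. (cmod (\<Sum>k\<in>insert j S. of_real (?\<sigma> k) * v m k))\<^sup>2) \<le> (\<Sum>m\<in>F. \<Sum>k\<in>insert j S. (cmod (v m k))\<^sup>2)"
    using s(2) by (simp only:)
  moreover have "\<forall>k. ?\<sigma> k = 1 \<or> ?\<sigma> k = -1" using \<sigma>(1) s(1) by simp
  ultimately show ?case by blast
qed

context lch_space
begin

text \<open>One branching step of the Cantor scheme, with existential quantifiers inside so that
  \<open>A\<close>, \<open>B\<close> and \<open>g\<close> can be chosen as functions of
  \<open>V\<close>. As \<open>g\<close> is 1 on both branches, mass placed further down the tree
  counts in full for \<open>g\<close>.\<close>

lemma dense_in_itself_split:
  assumes P: "P \<subseteq> topspace X" "\<forall>p\<in>P. \<not> openin (subtopology X P) {p}"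
    and V: "openin X V" "V \<inter> P \<noteq> {}"
  shows "\<exists>A B g. openin X A \<and> openin X B \<and> A \<inter> P \<noteq> {} \<and> B \<inter> P \<noteq> {} \<and> A \<inter> B = {} \<and> A \<subseteq> V \<and> B \<subseteq> V \<and>
    c0 (\<lambda>x. complex_of_real (g x)) \<and> (\<forall>x\<in>topspace X. 0 \<le> g x \<and> g x \<le> 1) \<and>
    (\<forall>x\<in>topspace X - V. g x = 0) \<and> (\<forall>x\<in>A \<union> B. g x = (1::real))"
proof -
  obtain p where p: "p \<in> V" "p \<in> P" using V by blast
  have "V \<inter> P \<noteq> {p}"
  proof
    assume "V \<inter> P = {p}"
    then have "openin (subtopology X P) {p}" using V(1) unfolding openin_subtopology by blast
    then show False using P(2) p by blast
  qed
  then obtain q where q: "q \<in> V" "q \<in> P" "q \<noteq> p" using p by blast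
  obtain S T where ST: "openin X S" "openin X T" "p \<in> S" "q \<in> T" "disjnt S T"
    using Hausdorff p q P(1) unfolding Hausdorff_space_def by (metis subsetD)
  have "openin X (V \<inter> S)" "p \<in> V \<inter> S" using V(1) ST p by (auto intro: openin_Int)
  then obtain f :: "'a \<Rightarrow> real" where f: "continuous_map X euclideanreal f" "c0 (\<lambda>x. complex_of_real (f x))" "f p = 1"
    "\<And>x. x \<in> topspace X \<Longrightarrow> 0 \<le> f x \<and> f x \<le> 1" "\<And>x. x \<in> topspace X \<Longrightarrow> x \<notin> V \<inter> S \<Longrightarrow> f x = 0"
    using bump by metis
  have "openin X (V \<inter> T)" "q \<in> V \<inter> T" using V(1) ST q by (auto intro: openin_Int)
  then obtain h :: "'a \<Rightarrow> real" where h: "continuous_map X euclideanreal h" "c0 (\<lambda>x. complex_of_real (h x))" "h q = 1"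
    "\<And>x. x \<in> topspace X \<Longrightarrow> 0 \<le> h x \<and> h x \<le> 1" "\<And>x. x \<in> topspace X \<Longrightarrow> x \<notin> V \<inter> T \<Longrightarrow> h x = 0"
    using bump by metis
  define A where "A = {x \<in> topspace X. f x \<in> {1/2<..}}"
  define B where "B = {x \<in> topspace X. h x \<in> {1/2<..}}"
  \<comment> \<open>\<open>f\<close> exceeds 1/2 on \<open>A\<close> and \<open>h\<close> does on
    \<open>B\<close>, so doubling and cutting at 1 gives the value 1 there; off \<open>V\<close>
    both summands vanish.\<close>
  define g where "g = (\<lambda>x. min 1 (2 * (f x + h x)))"
  have AVS: "A \<subseteq> V \<inter> S" unfolding A_def using f(5) by force
  have BVT: "B \<subseteq> V \<inter> T" unfolding B_def using h(5) by force
  have Ao: "openin X A" unfolding A_def by (rule openin_continuous_map_preimage[OF f(1)]) simp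
  have Bo: "openin X B" unfolding B_def by (rule openin_continuous_map_preimage[OF h(1)]) simp
  have pA: "A \<inter> P \<noteq> {}" using p P(1) f(3) by (auto simp: A_def)
  have qB: "B \<inter> P \<noteq> {}" using q P(1) h(3) by (auto simp: B_def)
  have AB: "A \<inter> B = {}" using AVS BVT ST(5) unfolding disjnt_def by blast
  have gc: "c0 (\<lambda>x. complex_of_real (g x))"
  proof (rule c0_dominated[where B = 2])
    show "c0 (\<lambda>x. complex_of_real (f x) + complex_of_real (h x))" by (rule c0_add[OF f(2) h(2)])
    have "continuous_map X euclideanreal g"
      unfolding g_def by (intro continuous_map_real_min continuous_map_real_mult_left continuous_map_add f(1) h(1)) simp
    then show "continuous_map X euclidean (\<lambda>x. complex_of_real (g x))" by (rule continuous_map_of_real)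
    fix x assume x: "x \<in> topspace X"
    then have "0 \<le> f x + h x" using f(4) h(4) by (simp add: add_nonneg_nonneg)
    then have "\<bar>g x\<bar> \<le> 2 * \<bar>f x + h x\<bar>" by (simp add: g_def min_def)
    then show "cmod (complex_of_real (g x)) \<le> 2 * cmod (complex_of_real (f x) + complex_of_real (h x))"
      unfolding of_real_add[symmetric] norm_of_real .
  qed
  have g01: "\<forall>x\<in>topspace X. 0 \<le> g x \<and> g x \<le> 1"
    using f(4) h(4) by (auto simp: g_def)
  have g0: "\<forall>x\<in>topspace X - V. g x = 0" using f(5) h(5) by (auto simp: g_def)
  have g1: "\<forall>x\<in>A \<union> B. g x = 1"
  proof
    fix x assume x: "x \<in> A \<union> B"
    then have "x \<in> topspace X" by (auto simp: A_def B_def)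
    then have "0 \<le> f x" "0 \<le> h x" using f(4) h(4) by blast+
    then show "g x = 1" using x by (auto simp: g_def A_def B_def)
  qed
  have "A \<subseteq> V" "B \<subseteq> V" using AVS BVT by auto
  then show ?thesis
    using Ao Bo pA qB AB gc g01 g0 g1
    by (intro exI[of _ A] exI[of _ B] exI[of _ g] conjI)
qed

lemma card_bool_lists: "card {s :: bool list. length s = n} = 2 ^ n" "finite {s :: bool list. length s = n}"
  using card_lists_length_eq[of "UNIV :: bool set" n] finite_lists_length_eq[of "UNIV :: bool set" n] by simp_all

text \<open>\<open>\<mu>\<close> is a cluster point of the uniform measures on the levels.\<close>

lemma Cantor_scheme:
  assumes X: "\<not> scattered_space X"
  obtains \<mu> and g :: "bool list \<Rightarrow> 'a \<Rightarrow> real" where "\<mu> \<in> MX"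
    "\<forall>s. c0 (\<lambda>x. complex_of_real (g s x))" "\<forall>s. \<forall>x\<in>topspace X. 0 \<le> g s x \<and> g s x \<le> 1"
    "\<forall>s t. \<forall>x\<in>topspace X. length s = length t \<and> s \<noteq> t \<longrightarrow> g s x * g t x = 0"
    "\<forall>s. 1 / 2 ^ length s \<le> Re (ev \<mu> (\<lambda>x. of_real (g s x * g s x)))"
proof -
  obtain P where P: "P \<subseteq> topspace X" "P \<noteq> {}" "\<forall>p\<in>P. \<not> openin (subtopology X P) {p}"
    using X unfolding scattered_space_def by blast
  define Q where "Q = (\<lambda>V A B g. openin X A \<and> openin X B \<and> A \<inter> P \<noteq> {} \<and> B \<inter> P \<noteq> {} \<and> A \<inter> B = {} \<and>
    A \<subseteq> V \<and> B \<subseteq> V \<and> c0 (\<lambda>x. complex_of_real (g x)) \<and> (\<forall>x\<in>topspace X. 0 \<le> g x \<and> g x \<le> 1) \<and>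
    (\<forall>x\<in>topspace X - V. g x = 0) \<and> (\<forall>x\<in>A \<union> B. g x = (1::real)))"
  have "\<exists>A B g. Q V A B g" if "openin X V" "V \<inter> P \<noteq> {}" for V
    unfolding Q_def by (rule dense_in_itself_split[OF P(1,3) that])
  then obtain A B G where ABG: "\<And>V. openin X V \<Longrightarrow> V \<inter> P \<noteq> {} \<Longrightarrow> Q V (A V) (B V) (G V)"
    by metis
  \<comment> \<open>The head of a list is the latest choice, so the descendants of \<open>s\<close>
    are the lists \<open>u @ s\<close>.\<close>
  define tr where "tr = (\<lambda>s. foldr (\<lambda>b V. if b then A V else B V) s (topspace X))"
  have tr_simps: "tr [] = topspace X" "tr (b # s) = (if b then A (tr s) else B (tr s))" for b s
    by (simp_all add: tr_def)
  have tr: "openin X (tr s) \<and> tr s \<inter> P \<noteq> {}" for s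
  proof (induction s)
    case Nil
    show ?case using P by (simp add: tr_simps) blast
  next
    case (Cons b s)
    then show ?case using ABG[of "tr s"] by (simp add: tr_simps Q_def)
  qed
  have at: "Q (tr s) (A (tr s)) (B (tr s)) (G (tr s))" for s using ABG tr by blast
  have sub1: "tr (b # s) \<subseteq> tr s" for b s using at[of s] by (simp add: tr_simps Q_def)
  have sub: "tr (u @ s) \<subseteq> tr s" for u s
    by (induction u) (use sub1 in \<open>auto\<close>)
  have disj: "length s = length t \<Longrightarrow> s \<noteq> t \<Longrightarrow> tr s \<inter> tr t = {}" for s t
  proof (induction s arbitrary: t)
    case (Cons b s)
    then obtain c t' where t: "t = c # t'" "length s = length t'" by (cases t) auto
    show ?case
    proof (cases "s = t'")
      case True
      then have "b \<noteq> c" using Cons.prems t by simp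
      then show ?thesis unfolding t(1) True[symmetric] using at[of s] by (cases b; cases c) (auto simp: tr_simps Q_def)
    next
      case False
      then have "tr s \<inter> tr t' = {}" using Cons.IH t by blast
      then show ?thesis unfolding t(1) using sub1 by blast
    qed
  qed simp
  define g where "g = (\<lambda>s. G (tr s))"
  have gc: "c0 (\<lambda>x. complex_of_real (g s x))" for s using at[of s] by (simp add: g_def Q_def)
  have g01: "0 \<le> g s x \<and> g s x \<le> 1" if "x \<in> topspace X" for s x using at[of s] that by (simp add: g_def Q_def)
  have g0: "g s x = 0" if "x \<in> topspace X" "x \<notin> tr s" for s x using at[of s] that by (simp add: g_def Q_def)
  have g1: "g s x = 1" if "x \<in> tr (b # s)" for b s x
    using at[of s] that by (cases b) (auto simp: g_def tr_simps Q_def)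
  have "\<exists>x. x \<in> tr s" for s using tr[of s] by blast
  then obtain x where x: "\<And>s. x s \<in> tr s" by metis
  have xX: "x s \<in> topspace X" for s using x[of s] tr[of s] openin_subset by blast
  let ?S = "\<lambda>m. {s :: bool list. length s = m}"
  define avg where "avg = (\<lambda>m f. (\<Sum>s\<in>?S m. f (x s)) / (2 ^ m :: complex))"
  have avg_bound: "cmod (avg m f) \<le> C" if "\<And>t. t \<in> topspace X \<Longrightarrow> cmod (f t) \<le> C" for m f C
  proof -
    have "cmod (\<Sum>s\<in>?S m. f (x s)) \<le> (\<Sum>s\<in>?S m. C)" by (rule sum_norm_le) (rule that[OF xX])
    also have "\<dots> = 2 ^ m * C" by (simp add: card_bool_lists)
    finally show ?thesis by (simp add: avg_def norm_divide norm_power field_simps)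
  qed
  \<comment> \<open>Averages over the levels need not converge; an ultrafilter beyond
    \<open>sequentially\<close> picks a cluster point that is linear in the function.\<close>
  obtain W where W: "ultra W" "W \<le> sequentially" using ultra_exists[of sequentially] by auto
  have Wb: "W \<noteq> bot" using W(1) by (simp add: ultra_def)
  let ?L = "\<lambda>f. Lim W (\<lambda>m. avg m f)"
  have lim: "((\<lambda>m. avg m f) \<longlongrightarrow> ?L f) W" if fc: "c0 f" for f
  proof -
    obtain C where "C > 0" "\<And>t. t \<in> topspace X \<Longrightarrow> cmod (f t) \<le> C" using c0_bounded[OF fc] by blast
    then have "eventually (\<lambda>m. dist 0 (avg m f) \<le> C) W" using avg_bound by (intro always_eventually) simp
    then show ?thesis by (rule ultra_bounded_tendsto_Lim[OF W(1)])
  qed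
  have L1: "?L (\<lambda>t. f t + h t) = ?L f + ?L h" if "c0 f" "c0 h" for f h
  proof (rule tendsto_Lim[OF Wb])
    have "avg m (\<lambda>t. f t + h t) = avg m f + avg m h" for m
      by (simp add: avg_def sum.distrib add_divide_distrib)
    then show "((\<lambda>m. avg m (\<lambda>t. f t + h t)) \<longlongrightarrow> ?L f + ?L h) W"
      using tendsto_add[OF lim[OF that(1)] lim[OF that(2)]] by (simp only:)
  qed
  have L2: "?L (\<lambda>t. d * f t) = d * ?L f" if "c0 f" for f d
  proof (rule tendsto_Lim[OF Wb])
    have "avg m (\<lambda>t. d * f t) = d * avg m f" for m
      by (simp add: avg_def sum_distrib_left)
    then show "((\<lambda>m. avg m (\<lambda>t. d * f t)) \<longlongrightarrow> d * ?L f) W"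
      using tendsto_mult_left[OF lim[OF that]] by (simp only:)
  qed
  have L3: "?L f = ?L h" if "\<And>t. t \<in> topspace X \<Longrightarrow> f t = h t" for f h
  proof -
    have "(\<lambda>m. avg m f) = (\<lambda>m. avg m h)" unfolding avg_def by (simp only: that xX)
    then show ?thesis by (simp only:)
  qed
  have L4: "cmod (?L f) \<le> 1" if "unit_ball f" for f
  proof (rule Lim_norm_ubound[OF Wb lim[OF unit_ball_c0[OF that]]])
    show "eventually (\<lambda>m. cmod (avg m f) \<le> 1) W"
      using that by (intro always_eventually allI avg_bound) (simp add: unit_ball_def)
  qed
  let ?\<mu> = "restrict ?L CX"
  show ?thesis
  proof (rule that[of ?\<mu> g])
    show "?\<mu> \<in> MX" by (rule functional_intro(1)[where L = ?L and B = 1]) (fact L1 L2 L3 L4)+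
    show "\<forall>s. c0 (\<lambda>x. complex_of_real (g s x))" using gc by blast
    show "\<forall>s. \<forall>x\<in>topspace X. 0 \<le> g s x \<and> g s x \<le> 1" using g01 by blast
    show "\<forall>s t. \<forall>x\<in>topspace X. length s = length t \<and> s \<noteq> t \<longrightarrow> g s x * g t x = 0"
    proof (intro allI ballI impI)
      fix s t :: "bool list" and y assume y: "y \<in> topspace X" and st: "length s = length t \<and> s \<noteq> t"
      have "y \<notin> tr s \<or> y \<notin> tr t" using disj st by blast
      then show "g s y * g t y = 0" using g0[OF y] by auto
    qed
    show "\<forall>s. 1 / 2 ^ length s \<le> Re (ev ?\<mu> (\<lambda>x. of_real (g s x * g s x)))"
    proof
      fix s :: "bool list"
      let ?f = "\<lambda>x. complex_of_real (g s x * g s x)"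
      have fc: "c0 ?f" unfolding of_real_mult by (rule c0_mult[OF gc gc])
      have ev: "ev ?\<mu> ?f = ?L ?f"
        by (rule functional_intro(2)[where L = ?L and B = 1]) (fact L1 L2 L3 L4 fc)+
      \<comment> \<open>Among the \<open>2 ^ m\<close> points of level \<open>m\<close>, those with
        index \<open>u @ s\<close> lie in a child of \<open>tr s\<close>, where \<open>g s\<close>
        is 1. The strict inequality makes \<open>u\<close> nonempty, since \<open>g s\<close> need
        not be 1 on all of \<open>tr s\<close>.\<close>
      have low: "1 / 2 ^ length s \<le> Re (avg m ?f)" if m: "m > length s" for m
      proof -
        let ?k = "m - length s"
        have "real (card (?S ?k)) = (\<Sum>u\<in>?S ?k. 1)" by simp
        also have "\<dots> = (\<Sum>u\<in>?S ?k. g s (x (u @ s)) * g s (x (u @ s)))"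
        proof (rule sum.cong[OF refl])
          fix u assume "u \<in> ?S ?k"
          then have "u \<noteq> []" using m by auto
          then obtain u' b where u: "u = u' @ [b]" by (metis rev_exhaust)
          have "x (u @ s) \<in> tr (b # s)" using x[of "u @ s"] sub[of u' "b # s"] by (auto simp: u)
          then show "1 = g s (x (u @ s)) * g s (x (u @ s))" using g1 by simp
        qed
        also have "\<dots> = (\<Sum>t\<in>(\<lambda>u. u @ s) ` ?S ?k. g s (x t) * g s (x t))"
          by (subst sum.reindex) (auto simp: inj_on_def)
        also have "\<dots> \<le> (\<Sum>t\<in>?S m. g s (x t) * g s (x t))"
          using m by (intro sum_mono2) (auto simp: card_bool_lists)
        finally have le: "2 ^ ?k \<le> (\<Sum>t\<in>?S m. g s (x t) * g s (x t))" by (simp add: card_bool_lists)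
        have "avg m ?f = complex_of_real ((\<Sum>t\<in>?S m. g s (x t) * g s (x t)) / 2 ^ m)"
          by (simp add: avg_def)
        then have "Re (avg m ?f) = (\<Sum>t\<in>?S m. g s (x t) * g s (x t)) / 2 ^ m" by (simp only: Re_complex_of_real)
        also have "\<dots> \<ge> 2 ^ ?k / 2 ^ m" using le by (intro divide_right_mono) auto
        also have "(2::real) ^ ?k / 2 ^ m = 1 / 2 ^ length s"
          using m by (simp add: power_diff field_simps)
        finally show ?thesis .
      qed
      have "eventually (\<lambda>m. m > length s) W" using W(2) eventually_gt_at_top filter_leD by blast
      then have "eventually (\<lambda>m. 1 / 2 ^ length s \<le> Re (avg m ?f)) W" by eventually_elim (rule low)
      then show "1 / 2 ^ length s \<le> Re (ev ?\<mu> ?f)"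
        unfolding ev by (rule tendsto_lowerbound[OF tendsto_Re[OF lim[OF fc]] _ Wb])
    qed
  qed
qed

text \<open>A Rademacher function on one level. Functions of a level have disjoint supports, so the
  values of each \<open>\<mu>\<close> on them have a bounded sum, and on a deep level at least half
  of the cells carry little of every \<open>\<mu>\<close> in \<open>F\<close>. Suitable signs on
  these cells make \<open>r\<close> small against \<open>F\<close>; they do not show in
  \<open>r * r\<close>, of which \<mu>0 keeps the mass 1/2.\<close>

lemma weakly_null_element:
  assumes \<mu>0: "\<mu>0 \<in> MX" and gc: "\<forall>s. c0 (\<lambda>x. complex_of_real (g s x))"
    and g01: "\<forall>s. \<forall>x\<in>topspace X. 0 \<le> g s x \<and> g s x \<le> 1"
    and disj: "\<forall>s t. \<forall>x\<in>topspace X. length s = length (t :: bool list) \<and> s \<noteq> t \<longrightarrow> g s x * g t x = 0"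
    and mass: "\<forall>s. 1 / 2 ^ length s \<le> Re (ev \<mu>0 (\<lambda>x. of_real (g s x * g s x)))"
    and F: "finite F" "F \<subseteq> MX" and e: "e > 0"
  shows "\<exists>r :: 'a \<Rightarrow> real. unit_ball (\<lambda>x. of_real (r x)) \<and> (\<forall>\<mu>\<in>F. cmod (ev \<mu> (\<lambda>x. of_real (r x))) \<le> e) \<and>
    1 / 2 \<le> Re (ev \<mu>0 (\<lambda>x. of_real (r x * r x)))"
proof -
  define M where "M = (\<Sum>\<mu>\<in>F. mnorm \<mu>) + 1"
  have M: "M \<ge> 1" unfolding M_def using F(2) mnorm_nonneg by (auto intro!: sum_nonneg)
  \<comment> \<open>Chosen for the final bound \<open>d * M = e\<^sup>2\<close> on the sum of
    squares.\<close>
  define d where "d = e\<^sup>2 / M"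
  have d: "d > 0" using e M by (simp add: d_def)
  \<comment> \<open>At most \<open>M / d\<close> cells have total weight above \<open>d\<close>, by
    a Chebyshev estimate; the level is taken so deep that this is less than half of its
    \<open>2 ^ n\<close> cells.\<close>
  obtain n where n: "2 * M / d < 2 ^ n" using real_arch_pow[of 2 "2 * M / d"] by auto
  let ?S = "{s :: bool list. length s = n}"
  let ?g = "\<lambda>s x. complex_of_real (g s x)"
  have Sfin: "finite ?S" "card ?S = 2 ^ n" by (simp_all add: card_bool_lists)
  have dj: "g s x * g t x = 0" if "s \<in> ?S" "t \<in> ?S" "s \<noteq> t" "x \<in> topspace X" for s t x
    using disj that by simp
  have sum_le: "(\<Sum>s\<in>S. \<bar>g s x\<bar>) \<le> 1" if "S \<subseteq> ?S" "x \<in> topspace X" for S x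
  proof (cases "\<exists>s\<in>S. g s x \<noteq> 0")
    case True
    then obtain s where s: "s \<in> S" "g s x \<noteq> 0" by blast
    have "(\<Sum>t\<in>S. \<bar>g t x\<bar>) = (\<Sum>t\<in>{s}. \<bar>g t x\<bar>)"
    proof (rule sum.mono_neutral_right)
      show "finite S" using that Sfin finite_subset by blast
      show "\<forall>t\<in>S - {s}. \<bar>g t x\<bar> = 0"
      proof
        fix t assume "t \<in> S - {s}"
        then have "g s x * g t x = 0" using dj[of s t x] s that by blast
        then show "\<bar>g t x\<bar> = 0" using s by simp
      qed
    qed (use s in simp)
    also have "\<dots> \<le> 1" using g01[rule_format, OF that(2), of s] by simp
    finally show ?thesis .
  next
    case False
    then have "(\<Sum>s\<in>S. \<bar>g s x\<bar>) = 0" by (intro sum.neutral) auto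
    then show ?thesis by simp
  qed
  have ball: "unit_ball (\<lambda>x. \<Sum>s\<in>S. c s * ?g s x)" if "S \<subseteq> ?S" "\<And>s. cmod (c s) \<le> 1" for S c
    unfolding unit_ball_def
  proof (intro conjI ballI)
    show "c0 (\<lambda>x. \<Sum>s\<in>S. c s * ?g s x)" using gc by (intro c0_sum c0_scale) blast
    fix x assume x: "x \<in> topspace X"
    have "cmod (\<Sum>s\<in>S. c s * ?g s x) \<le> (\<Sum>s\<in>S. \<bar>g s x\<bar>)"
    proof (rule sum_norm_le)
      fix s assume "s \<in> S"
      have "cmod (c s) * \<bar>g s x\<bar> \<le> 1 * \<bar>g s x\<bar>" using that(2) by (intro mult_right_mono) auto
      then show "cmod (c s * ?g s x) \<le> \<bar>g s x\<bar>" by (simp only: norm_mult norm_of_real mult_1)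
    qed
    then show "cmod (\<Sum>s\<in>S. c s * ?g s x) \<le> 1" using sum_le[OF that(1) x] by linarith
  qed
  have tot: "(\<Sum>s\<in>?S. cmod (ev \<mu> (?g s))) \<le> mnorm \<mu>" if \<mu>: "\<mu> \<in> MX" for \<mu>
    using gc sum_le[OF order_refl] by (intro sum_cmod_ev_le \<mu>) (simp_all only: norm_of_real)
  have total: "(\<Sum>s\<in>?S. \<Sum>\<mu>\<in>F. cmod (ev \<mu> (?g s))) \<le> M"
  proof -
    have "(\<Sum>s\<in>?S. \<Sum>\<mu>\<in>F. cmod (ev \<mu> (?g s))) = (\<Sum>\<mu>\<in>F. \<Sum>s\<in>?S. cmod (ev \<mu> (?g s)))" by (rule sum.swap)
    also have "\<dots> \<le> (\<Sum>\<mu>\<in>F. mnorm \<mu>)" using F(2) tot by (intro sum_mono) blast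
    finally show ?thesis by (simp add: M_def)
  qed
  let ?w = "\<lambda>s. \<Sum>\<mu>\<in>F. cmod (ev \<mu> (?g s))"
  have w0: "?w s \<ge> 0" for s by (simp add: sum_nonneg)
  define S where "S = {s \<in> ?S. ?w s \<le> d}"
  have S: "S \<subseteq> ?S" "finite S" using Sfin(1) by (auto simp: S_def intro: finite_subset)
  have "real (card (?S - S)) * d \<le> (\<Sum>s\<in>?S - S. ?w s)"
  proof (rule sum_bounded_below)
    fix s assume "s \<in> ?S - S"
    then have "\<not> ?w s \<le> d" by (simp add: S_def)
    then show "d \<le> ?w s" by (rule less_imp_le[OF not_le_imp_less])
  qed
  also have "\<dots> \<le> (\<Sum>s\<in>?S. ?w s)" using Sfin(1) w0 by (intro sum_mono2) auto
  also have "\<dots> \<le> M" by (rule total)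
  finally have "real (card (?S - S)) \<le> M / d" using d by (simp add: field_simps)
  moreover have "M / d < 2 ^ n / 2" using n by (simp add: mult.commute)
  moreover have "real (card S) + real (card (?S - S)) = 2 ^ n"
  proof -
    have "card S + card (?S - S) = 2 ^ n"
      using card_Diff_subset[OF S(2,1)] card_mono[OF Sfin(1) S(1)] Sfin(2) by simp
    then have "real (card S + card (?S - S)) = real (2 ^ n)" by (simp only:)
    then show ?thesis by (simp only: of_nat_add of_nat_power of_nat_numeral)
  qed
  ultimately have cardS: "real (card S) \<ge> 2 ^ n / 2" by linarith
  obtain \<sigma> :: "bool list \<Rightarrow> real" where \<sigma>: "\<forall>s. \<sigma> s = 1 \<or> \<sigma> s = -1"
    "(\<Sum>\<mu>\<in>F. (cmod (\<Sum>s\<in>S. of_real (\<sigma> s) * ev \<mu> (?g s)))\<^sup>2) \<le> (\<Sum>\<mu>\<in>F. \<Sum>s\<in>S. (cmod (ev \<mu> (?g s)))\<^sup>2)"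
    using exists_signs[OF S(2), where F = F and v = "\<lambda>\<mu> s. ev \<mu> (?g s)"] by blast
  let ?r = "\<lambda>x. \<Sum>s\<in>S. \<sigma> s * g s x"
  have rc: "(\<lambda>x. complex_of_real (?r x)) = (\<lambda>x. \<Sum>s\<in>S. of_real (\<sigma> s) * ?g s x)" by simp
  have "unit_ball (\<lambda>x. complex_of_real (?r x))"
    unfolding rc using \<sigma>(1) by (intro ball S(1)) (metis norm_of_real abs_1 abs_minus_cancel order_refl)
  moreover have "\<forall>\<mu>\<in>F. cmod (ev \<mu> (\<lambda>x. of_real (?r x))) \<le> e"
  proof
    fix \<mu> assume \<mu>F: "\<mu> \<in> F"
    then have \<mu>: "\<mu> \<in> MX" using F(2) by blast
    have "ev \<mu> (\<lambda>x. of_real (?r x)) = (\<Sum>s\<in>S. ev \<mu> (\<lambda>x. of_real (\<sigma> s) * ?g s x))"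
      unfolding rc using gc by (intro ev_sum \<mu> c0_scale) blast
    also have "\<dots> = (\<Sum>s\<in>S. of_real (\<sigma> s) * ev \<mu> (?g s))"
      using gc by (intro sum.cong refl ev_scale \<mu>) blast
    finally have "(cmod (ev \<mu> (\<lambda>x. of_real (?r x))))\<^sup>2 \<le> (\<Sum>\<mu>\<in>F. (cmod (\<Sum>s\<in>S. of_real (\<sigma> s) * ev \<mu> (?g s)))\<^sup>2)"
      using F(1) \<mu>F by (simp only:) (intro member_le_sum, auto)
    also have "\<dots> \<le> (\<Sum>\<mu>\<in>F. \<Sum>s\<in>S. (cmod (ev \<mu> (?g s)))\<^sup>2)" by (rule \<sigma>(2))
    also have "\<dots> \<le> (\<Sum>\<mu>\<in>F. \<Sum>s\<in>S. d * cmod (ev \<mu> (?g s)))"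
    proof (intro sum_mono)
      fix \<nu> s assume \<nu>: "\<nu> \<in> F" and s: "s \<in> S"
      have "cmod (ev \<nu> (?g s)) \<le> ?w s" using F(1) \<nu> by (intro member_le_sum) auto
      also have "\<dots> \<le> d" using s by (simp add: S_def)
      finally show "(cmod (ev \<nu> (?g s)))\<^sup>2 \<le> d * cmod (ev \<nu> (?g s))"
        unfolding power2_eq_square by (intro mult_right_mono) auto
    qed
    also have "\<dots> = d * (\<Sum>s\<in>S. ?w s)" by (simp only: sum_distrib_left sum.swap[of _ S F])
    also have "\<dots> \<le> d * M"
    proof (intro mult_left_mono)
      have "(\<Sum>s\<in>S. ?w s) \<le> (\<Sum>s\<in>?S. ?w s)" using Sfin(1) S(1) w0 by (intro sum_mono2) auto
      then show "(\<Sum>s\<in>S. ?w s) \<le> M" using total by linarith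
    qed (use d in simp)
    also have "\<dots> = e\<^sup>2" using M by (simp add: d_def)
    finally have "(cmod (ev \<mu> (\<lambda>x. of_real (?r x))))\<^sup>2 \<le> e\<^sup>2" .
    then show "cmod (ev \<mu> (\<lambda>x. of_real (?r x))) \<le> e" by (rule power2_le_imp_le[OF _ less_imp_le[OF e]])
  qed
  moreover have "1 / 2 \<le> Re (ev \<mu>0 (\<lambda>x. of_real (?r x * ?r x)))"
  proof -
    have sq: "?r x * ?r x = (\<Sum>s\<in>S. g s x * g s x)" if x: "x \<in> topspace X" for x
    proof -
      have "?r x * ?r x = (\<Sum>s\<in>S. \<Sum>t\<in>S. (\<sigma> s * g s x) * (\<sigma> t * g t x))" by (rule sum_product)
      also have "\<dots> = (\<Sum>s\<in>S. \<Sum>t\<in>S. if t = s then g s x * g s x else 0)"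
      proof (intro sum.cong refl)
        fix s t assume st: "s \<in> S" "t \<in> S"
        show "\<sigma> s * g s x * (\<sigma> t * g t x) = (if t = s then g s x * g s x else 0)"
        proof (cases "t = s")
          case True
          then show ?thesis using \<sigma>(1)[rule_format, of s] by auto
        next
          case False
          then have "g s x * g t x = 0" using dj[of s t x] st S(1) x by blast
          then show ?thesis using False by auto
        qed
      qed
      also have "\<dots> = (\<Sum>s\<in>S. g s x * g s x)" using S(2) by simp
      finally show ?thesis .
    qed
    have "ev \<mu>0 (\<lambda>x. of_real (?r x * ?r x)) = ev \<mu>0 (\<lambda>x. \<Sum>s\<in>S. of_real (g s x * g s x))"
      by (rule ev_cong) (simp only: sq of_real_sum)
    also have "\<dots> = (\<Sum>s\<in>S. ev \<mu>0 (\<lambda>x. of_real (g s x * g s x)))"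
      unfolding of_real_mult using gc by (intro ev_sum \<mu>0 c0_mult) blast+
    finally have re: "Re (ev \<mu>0 (\<lambda>x. of_real (?r x * ?r x))) = (\<Sum>s\<in>S. Re (ev \<mu>0 (\<lambda>x. of_real (g s x * g s x))))"
      by (simp only: Re_sum)
    have "1 / 2 = (2 ^ n / 2) / (2::real) ^ n" by simp
    also have "\<dots> \<le> real (card S) / 2 ^ n"
      using cardS by (intro divide_right_mono) auto
    also have "\<dots> = (\<Sum>s\<in>S. 1 / 2 ^ n)" by simp
    also have "\<dots> \<le> (\<Sum>s\<in>S. Re (ev \<mu>0 (\<lambda>x. of_real (g s x * g s x))))"
    proof (rule sum_mono)
      fix s assume "s \<in> S"
      then have "length s = n" using S(1) by blast
      then show "1 / 2 ^ n \<le> Re (ev \<mu>0 (\<lambda>x. of_real (g s x * g s x)))" using mass[rule_format, of s] by (simp only:)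
    qed
    finally show ?thesis unfolding re .
  qed
  ultimately show ?thesis by (intro exI[of _ ?r] conjI)
qed

end

section \<open>A lifting that is not multiplicative\<close>

context lch_space
begin

lemma bidual_ops_apply:
  "\<mu> \<in> MX \<Longrightarrow> vadd (bidual (C0 X)) \<Phi> \<Psi> \<mu> = \<Phi> \<mu> + \<Psi> \<mu>"
  "\<mu> \<in> MX \<Longrightarrow> vscale (bidual (C0 X)) c \<Phi> \<mu> = c * \<Phi> \<mu>"
  unfolding dual_ops[of "dual (C0 X)"] by simp_all

text \<open>All properties stand in one existential statement so that an operator can be chosen for
  every index at once. The factor \<open>bnorm \<Phi>\<close> in the weak error comes from
  \<open>BX_approx\<close>.\<close>

lemma approximating_operator:
  assumes H: "finite H" "H \<subseteq> CX" and G: "finite G" "G \<subseteq> MX" and e: "e > 0"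
  shows "\<exists>T. (\<forall>\<Phi>\<in>BX. c0 (T \<Phi>)) \<and>
    (\<forall>\<Phi>\<in>BX. \<forall>\<Psi>\<in>BX. \<forall>t. T (vadd (bidual (C0 X)) \<Phi> \<Psi>) t = T \<Phi> t + T \<Psi> t) \<and>
    (\<forall>\<Phi>\<in>BX. \<forall>c t. T (vscale (bidual (C0 X)) c \<Phi>) t = c * T \<Phi> t) \<and>
    (\<forall>\<Phi>\<in>BX. \<forall>t\<in>topspace X. cmod (T \<Phi> t) \<le> 2 * bnorm \<Phi>) \<and>
    (\<forall>a\<in>H. \<forall>t\<in>topspace X. cmod (T (canonical_embedding (C0 X) a) t - a t) \<le> e) \<and>
    (\<forall>\<mu>\<in>G. \<forall>\<Phi>\<in>BX. cmod (ev \<mu> (T \<Phi>) - \<Phi> \<mu>) \<le> bnorm \<Phi> * e)"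
proof -
  obtain D :: "'a set" and f \<nu> where D: "finite D"
    and \<nu>1: "\<forall>k\<in>D. \<nu> k \<in> MX" and \<nu>2: "\<forall>k\<in>D. mnorm (\<nu> k) \<le> 2"
    and fc: "\<forall>k\<in>D. c0 (\<lambda>x. complex_of_real (f k x))"
    and f0: "\<forall>k\<in>D. \<forall>x\<in>topspace X. 0 \<le> f k x" and f1: "\<forall>x\<in>topspace X. (\<Sum>k\<in>D. f k x) \<le> 1"
    and aH: "\<forall>a\<in>H. \<forall>x\<in>topspace X. cmod ((\<Sum>k\<in>D. ev (\<nu> k) a * of_real (f k x)) - a x) \<le> e"
    and \<mu>G: "\<forall>\<mu>\<in>G. \<forall>g. unit_ball g \<longrightarrow>
      cmod (ev \<mu> g - (\<Sum>k\<in>D. ev \<mu> (\<lambda>x. of_real (f k x)) * ev (\<nu> k) g)) \<le> e"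
    by (rule local_reflexivity[OF H G e])
  note \<nu> = \<nu>1[rule_format] and fc' = fc[rule_format]
  let ?f = "\<lambda>k x. complex_of_real (f k x)"
  let ?T = "\<lambda>\<Phi> x. \<Sum>k\<in>D. \<Phi> (\<nu> k) * ?f k x"
  have 1: "c0 (?T \<Phi>)" for \<Phi> by (intro c0_sum c0_scale fc')
  have 2: "?T (vadd (bidual (C0 X)) \<Phi> \<Psi>) t = ?T \<Phi> t + ?T \<Psi> t" for \<Phi> \<Psi> t
    unfolding sum.distrib[symmetric] distrib_right[symmetric]
    by (intro sum.cong refl) (simp only: bidual_ops_apply \<nu>)
  have 3: "?T (vscale (bidual (C0 X)) c \<Phi>) t = c * ?T \<Phi> t" for \<Phi> c t
    unfolding sum_distrib_left mult.assoc[symmetric]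
    by (intro sum.cong refl) (simp only: bidual_ops_apply \<nu>)
  have 4: "cmod (?T \<Phi> t) \<le> 2 * bnorm \<Phi>" if \<Phi>: "\<Phi> \<in> BX" and t: "t \<in> topspace X" for \<Phi> t
  proof -
    have "cmod (?T \<Phi> t) \<le> (\<Sum>k\<in>D. bnorm \<Phi> * 2 * f k t)"
    proof (rule sum_norm_le)
      fix k assume k: "k \<in> D"
      have "cmod (\<Phi> (\<nu> k)) \<le> bnorm \<Phi> * 2" using \<nu>2 k by (intro BX_bound \<Phi> \<nu>) auto
      then show "cmod (\<Phi> (\<nu> k) * ?f k t) \<le> bnorm \<Phi> * 2 * f k t"
        unfolding norm_mult norm_of_real using f0 k t by (simp add: mult_right_mono)
    qed
    also have "\<dots> = bnorm \<Phi> * 2 * (\<Sum>k\<in>D. f k t)" by (simp only: sum_distrib_left)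
    also have "\<dots> \<le> bnorm \<Phi> * 2 * 1" using f1 t bnorm_nonneg[OF \<Phi>] by (intro mult_left_mono) auto
    finally show ?thesis by simp
  qed
  have 5: "cmod (?T (canonical_embedding (C0 X) a) t - a t) \<le> e" if "a \<in> H" "t \<in> topspace X" for a t
  proof -
    have "a \<in> CX" using that H by blast
    then have "?T (canonical_embedding (C0 X) a) t = (\<Sum>k\<in>D. ev (\<nu> k) a * ?f k t)"
      by (intro sum.cong refl) (simp only: canonical_apply \<nu>)
    then show ?thesis using aH that by (simp only:)
  qed
  have 6: "cmod (ev \<mu> (?T \<Phi>) - \<Phi> \<mu>) \<le> bnorm \<Phi> * e" if \<mu>: "\<mu> \<in> G" and \<Phi>: "\<Phi> \<in> BX" for \<mu> \<Phi>
  proof -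
    have \<mu>M: "\<mu> \<in> MX" using \<mu> G by blast
    have "cmod (\<Phi> \<mu> - (\<Sum>k\<in>D. ev \<mu> (?f k) * \<Phi> (\<nu> k))) \<le> bnorm \<Phi> * e"
    proof (rule BX_approx[OF \<Phi> \<mu>M D])
      show "\<nu> k \<in> MX" if "k \<in> D" for k by (rule \<nu>[OF that])
      show "cmod (ev \<mu> g - (\<Sum>k\<in>D. ev \<mu> (?f k) * ev (\<nu> k) g)) \<le> e" if "unit_ball g" for g
        by (rule \<mu>G[rule_format, OF \<mu> that])
    qed
    moreover have "ev \<mu> (?T \<Phi>) = (\<Sum>k\<in>D. ev \<mu> (?f k) * \<Phi> (\<nu> k))"
    proof -
      have "ev \<mu> (?T \<Phi>) = (\<Sum>k\<in>D. ev \<mu> (\<lambda>x. \<Phi> (\<nu> k) * ?f k x))" by (intro ev_sum \<mu>M c0_scale fc')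
      also have "\<dots> = (\<Sum>k\<in>D. \<Phi> (\<nu> k) * ev \<mu> (?f k))" by (intro sum.cong refl ev_scale \<mu>M fc')
      finally show ?thesis by (simp only: mult.commute)
    qed
    ultimately show ?thesis by (simp only: norm_minus_commute)
  qed
  show ?thesis by (intro exI[of _ ?T] conjI ballI allI; (rule 1 2 3 4 5 6)?; assumption)
qed

lemma Hausdorff_avoid_finite:
  assumes t: "t \<in> topspace X" and B: "finite B" "B \<subseteq> topspace X - {t}"
  shows "\<exists>f :: 'a \<Rightarrow> real. unit_ball (\<lambda>x. of_real (f x)) \<and> f t = 1 \<and> (\<forall>x\<in>B. f x = 0)"
proof -
  have "compactin X B" using B by (intro finite_imp_compactin) auto
  then have "closedin X B" by (rule compactin_imp_closedin[OF Hausdorff])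
  then have "openin X (topspace X - B)" by blast
  moreover have "t \<in> topspace X - B" using t B by blast
  ultimately obtain f :: "'a \<Rightarrow> real" where f: "c0 (\<lambda>x. complex_of_real (f x))" "f t = 1"
    "\<And>x. x \<in> topspace X \<Longrightarrow> 0 \<le> f x \<and> f x \<le> 1" "\<And>x. x \<in> topspace X \<Longrightarrow> x \<notin> topspace X - B \<Longrightarrow> f x = 0"
    using bump by metis
  have "unit_ball (\<lambda>x. complex_of_real (f x))"
    unfolding unit_ball_def norm_of_real using f(1,3) by simp
  moreover have "\<forall>x\<in>B. f x = 0" using f(4) B by auto
  ultimately show ?thesis using f(2) by blast
qed

text \<open>\<open>\<theta> \<Phi>\<close> is the jump of \<open>x \<mapsto> \<Phi> (dirac x)\<close> at \<open>t\<close>, and \<open>\<Phi>0 \<mu>\<close> is the mass that \<open>\<mu>\<close> gives to \<open>{t}\<close>.\<close>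

lemma exists_jump_functional:
  assumes t: "t \<in> topspace X" "\<not> openin X {t}"
  obtains \<theta> \<Phi>0 where "\<Phi>0 \<in> BX" "\<theta> \<Phi>0 = (-1 :: complex)"
    "\<forall>\<Phi>\<in>BX. \<forall>\<Psi>\<in>BX. \<theta> (vadd (bidual (C0 X)) \<Phi> \<Psi>) = \<theta> \<Phi> + \<theta> \<Psi>"
    "\<forall>\<Phi>\<in>BX. \<forall>c. \<theta> (vscale (bidual (C0 X)) c \<Phi>) = c * \<theta> \<Phi>"
    "\<forall>\<Phi>\<in>BX. cmod (\<theta> \<Phi>) \<le> 2 * bnorm \<Phi>"
    "\<forall>a\<in>CX. \<theta> (canonical_embedding (C0 X) a) = 0"
proof -
  \<comment> \<open>As \<open>t\<close> is not isolated, its punctured neighbourhoods form a proper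
    filter, and a one-sided notion of limit at \<open>t\<close> is available along an ultrafilter
    below it.\<close>
  have "atin X t \<noteq> bot"
  proof
    assume "atin X t = bot"
    then have "eventually (\<lambda>_. False) (atin X t)" by simp
    then obtain U where U: "openin X U" "t \<in> U" "\<forall>x\<in>U - {t}. False"
      using t(1) unfolding eventually_atin by auto
    then have "U = {t}" by blast
    then show False using U(1) t(2) by simp
  qed
  then obtain W where W: "ultra W" "W \<le> atin X t" by (rule ultra_exists)
  have Wb: "W \<noteq> bot" using W(1) by (simp add: ultra_def)
  have "eventually (\<lambda>s. s \<in> topspace X - {t}) (atin X t)"
    unfolding eventually_atin using t(1) openin_subset by (intro disjI2 exI[of _ "topspace X"]) auto
  then have Wt: "eventually (\<lambda>s. s \<in> topspace X - {t}) W" by (rule filter_leD[OF W(2)])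
  have bd: "cmod (\<Phi> (dirac s)) \<le> bnorm \<Phi>" if "\<Phi> \<in> BX" "s \<in> topspace X" for \<Phi> s
    by (rule BX_bound_unit[OF that(1) dirac_MX[OF that(2)] mnorm_dirac[OF that(2)]])
  let ?l = "\<lambda>\<Phi>. Lim W (\<lambda>s. \<Phi> (dirac s))"
  have lim: "((\<lambda>s. \<Phi> (dirac s)) \<longlongrightarrow> ?l \<Phi>) W" if "\<Phi> \<in> BX" for \<Phi> :: "(('a \<Rightarrow> complex) \<Rightarrow> complex) \<Rightarrow> complex"
  proof (rule ultra_bounded_tendsto_Lim[OF W(1)])
    show "eventually (\<lambda>s. dist 0 (\<Phi> (dirac s)) \<le> bnorm \<Phi>) W"
      using Wt by eventually_elim (use bd[OF that] in simp)
  qed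
  have limI: "?l \<Phi> = c" if "((\<lambda>s. \<Phi> (dirac s)) \<longlongrightarrow> c) W" for \<Phi> :: "(('a \<Rightarrow> complex) \<Rightarrow> complex) \<Rightarrow> complex" and c
    by (rule tendsto_Lim[OF Wb that])
  define \<theta> where "\<theta> = (\<lambda>\<Phi> :: (('a \<Rightarrow> complex) \<Rightarrow> complex) \<Rightarrow> complex. ?l \<Phi> - \<Phi> (dirac t))"
  have dt: "dirac t \<in> MX" by (rule dirac_MX[OF t(1)])
  have add: "\<theta> (vadd (bidual (C0 X)) \<Phi> \<Psi>) = \<theta> \<Phi> + \<theta> \<Psi>" if "\<Phi> \<in> BX" "\<Psi> \<in> BX" for \<Phi> \<Psi>
  proof -
    have "eventually (\<lambda>s. \<Phi> (dirac s) + \<Psi> (dirac s) = vadd (bidual (C0 X)) \<Phi> \<Psi> (dirac s)) W"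
      using Wt by eventually_elim (simp only: bidual_ops_apply dirac_MX Diff_iff)
    then have "?l (vadd (bidual (C0 X)) \<Phi> \<Psi>) = ?l \<Phi> + ?l \<Psi>"
      by (rule limI[OF Lim_transform_eventually[OF tendsto_add[OF lim[OF that(1)] lim[OF that(2)]]]])
    then show ?thesis unfolding \<theta>_def by (simp only: bidual_ops_apply dt) simp
  qed
  have scale: "\<theta> (vscale (bidual (C0 X)) c \<Phi>) = c * \<theta> \<Phi>" if "\<Phi> \<in> BX" for c \<Phi>
  proof -
    have "eventually (\<lambda>s. c * \<Phi> (dirac s) = vscale (bidual (C0 X)) c \<Phi> (dirac s)) W"
      using Wt by eventually_elim (simp only: bidual_ops_apply dirac_MX Diff_iff)
    then have "?l (vscale (bidual (C0 X)) c \<Phi>) = c * ?l \<Phi>"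
      by (rule limI[OF Lim_transform_eventually[OF tendsto_mult_left[OF lim[OF that]]]])
    then show ?thesis unfolding \<theta>_def by (simp only: bidual_ops_apply dt right_diff_distrib)
  qed
  have bound: "cmod (\<theta> \<Phi>) \<le> 2 * bnorm \<Phi>" if "\<Phi> \<in> BX" for \<Phi>
  proof -
    have "cmod (?l \<Phi>) \<le> bnorm \<Phi>"
    proof (rule Lim_norm_ubound[OF Wb lim[OF that]])
      show "eventually (\<lambda>s. cmod (\<Phi> (dirac s)) \<le> bnorm \<Phi>) W"
        using Wt by eventually_elim (use bd[OF that] in simp)
    qed
    then show ?thesis
      unfolding \<theta>_def using bd[OF that t(1)] norm_triangle_ineq4[of "?l \<Phi>" "\<Phi> (dirac t)"] by linarith
  qed
  \<comment> \<open>A member of C0(X) has no jump: its canonical image takes the value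
    \<open>a s\<close> at \<open>dirac s\<close>, and \<open>a\<close> is continuous at
    \<open>t\<close>.\<close>
  have can: "\<theta> (canonical_embedding (C0 X) a) = 0" if a: "a \<in> CX" for a
  proof -
    have ac: "c0 a" by (rule CX_c0[OF a])
    have "(a \<longlongrightarrow> a t) (atin X t)"
      using c0_continuous[OF ac] t(1) unfolding continuous_map_atin limitin_canonical_iff by blast
    then have "(a \<longlongrightarrow> a t) W" by (rule tendsto_mono[OF W(2)])
    moreover have "eventually (\<lambda>s. a s = canonical_embedding (C0 X) a (dirac s)) W"
      using Wt by eventually_elim (simp only: canonical_apply[OF a] dirac_MX ev_dirac ac Diff_iff)
    ultimately have "?l (canonical_embedding (C0 X) a) = a t"
      by (rule limI[OF Lim_transform_eventually])
    then show ?thesis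
      unfolding \<theta>_def by (simp only: canonical_apply[OF a dt] ev_dirac[OF t(1) ac]) simp
  qed
  \<comment> \<open>The functions \<open>f B\<close> are 1 at \<open>t\<close> and 0 on
    \<open>B\<close>. Along growing finite sets they tend to 0 at every other point, and \<theta>
    depends only on these values at point evaluations.\<close>
  let ?\<F> = "{B. finite B \<and> B \<subseteq> topspace X - {t}}"
  obtain f :: "'a set \<Rightarrow> 'a \<Rightarrow> real" where f: "\<And>B. B \<in> ?\<F> \<Longrightarrow> unit_ball (\<lambda>x. of_real (f B x)) \<and> f B t = 1 \<and> (\<forall>x\<in>B. f B x = 0)"
    using Hausdorff_avoid_finite[OF t(1)] by (metis mem_Collect_eq)
  obtain V where V: "ultra V" "V \<le> finite_subsets_at_top (topspace X - {t})"
    by (rule ultra_exists[OF finite_subsets_at_top_neq_bot])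
  have Vb: "V \<noteq> bot" using V(1) by (simp add: ultra_def)
  have VF: "eventually (\<lambda>B. B \<in> ?\<F>) V"
    by (rule filter_leD[OF V(2)]) (rule eventually_finite_subsets_at_top_weakI, simp)
  let ?v = "\<lambda>B \<mu>. ev \<mu> (\<lambda>x. complex_of_real (f B x))"
  let ?L = "\<lambda>\<mu>. Lim V (\<lambda>B. ?v B \<mu>)"
  have vb: "eventually (\<lambda>B. cmod (?v B \<mu>) \<le> mnorm \<mu>) V" if "\<mu> \<in> MX" for \<mu>
    using VF by eventually_elim (use f ev_bound_unit[OF that] in blast)
  have Lim: "((\<lambda>B. ?v B \<mu>) \<longlongrightarrow> ?L \<mu>) V" if "\<mu> \<in> MX" for \<mu>
    using vb[OF that] by (intro ultra_bounded_tendsto_Lim[OF V(1), of 0 _ "mnorm \<mu>"]) simp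
  define \<Phi>0 where "\<Phi>0 = restrict ?L MX"
  have \<Phi>0: "\<Phi>0 \<in> BX"
    unfolding \<Phi>0_def
  proof (rule BX_I)
    fix \<mu> assume \<mu>: "\<mu> \<in> MX"
    show "?L (vadd (dual (C0 X)) \<mu> \<nu>) = ?L \<mu> + ?L \<nu>" if \<nu>: "\<nu> \<in> MX" for \<nu>
    proof (rule tendsto_Lim[OF Vb Lim_transform_eventually[OF tendsto_add[OF Lim[OF \<mu>] Lim[OF \<nu>]]]])
      show "eventually (\<lambda>B. ?v B \<mu> + ?v B \<nu> = ?v B (vadd (dual (C0 X)) \<mu> \<nu>)) V"
        using VF by eventually_elim (rule vadd_MX(2)[OF \<mu> \<nu> unit_ball_c0, symmetric], use f in blast)
    qed
    show "?L (vscale (dual (C0 X)) c \<mu>) = c * ?L \<mu>" for c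
    proof (rule tendsto_Lim[OF Vb Lim_transform_eventually[OF tendsto_mult_left[OF Lim[OF \<mu>]]]])
      show "eventually (\<lambda>B. c * ?v B \<mu> = ?v B (vscale (dual (C0 X)) c \<mu>)) V"
        using VF by eventually_elim (rule vscale_MX(2)[OF \<mu> unit_ball_c0, symmetric], use f in blast)
    qed
    show "cmod (?L \<mu>) \<le> 1 * mnorm \<mu>"
      using Lim_norm_ubound[OF Vb Lim[OF \<mu>] vb[OF \<mu>]] by simp
  qed
  have point: "\<Phi>0 (dirac s) = c" if s: "s \<in> topspace X" and e: "eventually (\<lambda>B. of_real (f B s) = c) V" for s c
  proof -
    have "eventually (\<lambda>B. c = ?v B (dirac s)) V"
      using VF e
    proof eventually_elim
      case (elim B)
      have "c0 (\<lambda>x. complex_of_real (f B x))" using f[OF elim(1)] unit_ball_c0 by blast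
      then show ?case using elim(2) by (simp only: ev_dirac[OF s])
    qed
    then have "?L (dirac s) = c"
      by (rule tendsto_Lim[OF Vb Lim_transform_eventually[OF tendsto_const]])
    then show ?thesis unfolding \<Phi>0_def by (simp only: restrict_apply' dirac_MX[OF s])
  qed
  have "\<Phi>0 (dirac t) = 1"
  proof (rule point[OF t(1)])
    show "eventually (\<lambda>B. complex_of_real (f B t) = 1) V"
      using VF
    proof eventually_elim
      case (elim B)
      from f[OF this] show ?case by simp
    qed
  qed
  moreover have "?l \<Phi>0 = 0"
  proof (rule limI[OF Lim_transform_eventually[OF tendsto_const]])
    show "eventually (\<lambda>s. 0 = \<Phi>0 (dirac s)) W"
      using Wt
    proof eventually_elim
      case (elim s)
      have "eventually (\<lambda>B. s \<in> B) V"
        by (rule filter_leD[OF V(2)], unfold eventually_finite_subsets_at_top)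
           (use elim in \<open>auto intro!: exI[of _ "{s}"]\<close>)
      with VF have "eventually (\<lambda>B. complex_of_real (f B s) = 0) V"
      proof eventually_elim
        case (elim B)
        from f[OF elim(1)] elim(2) show ?case by simp
      qed
      then have "\<Phi>0 (dirac s) = 0" using elim by (intro point) auto
      then show ?case by (rule sym)
    qed
  qed
  ultimately have "\<theta> \<Phi>0 = -1" unfolding \<theta>_def by (simp only:) simp
  then show ?thesis
    by (intro that[of \<Phi>0 \<theta>] \<Phi>0 ballI allI add scale bound can)
qed

text \<open>Ensures that a finite subset of the bidual contains the canonical images of only
  finitely many functions, so that \<open>local_reflexivity\<close> applies to them.\<close>

lemma canonical_inj: "inj_on (canonical_embedding (C0 X)) CX"
proof (rule inj_onI)
  fix a b assume a: "a \<in> CX" and b: "b \<in> CX"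
    and eq: "canonical_embedding (C0 X) a = canonical_embedding (C0 X) b"
  show "a = b"
  proof (rule extensionalityI)
    show "a \<in> extensional (topspace X)" "b \<in> extensional (topspace X)" using a b CX_iff by blast+
    fix x assume x: "x \<in> topspace X"
    have "canonical_embedding (C0 X) a (dirac x) = canonical_embedding (C0 X) b (dirac x)" by (simp only: eq)
    then show "a x = b x"
      by (simp only: canonical_apply a b dirac_MX x ev_dirac CX_c0)
  qed
qed

text \<open>An ultrafilter below the product of the three filters of growing finite sets and growing
  integers, so that every \<Phi>, every \<mu> and every precision is eventually served. The integer
  component makes it nonprincipal and countably incomplete.\<close>

lemma lr_ultrafilter:
  fixes I :: "('i + 'a lr_index) set"
  assumes I: "I = Inr ` {(F, G, n). finite F \<and> finite G \<and> G \<subseteq> MX}"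
  obtains U where "admissible_ultrafilter I U"
    "\<forall>\<Phi>\<in>BX. eventually (\<lambda>i. \<Phi> \<in> fst (projr i)) U"
    "\<forall>\<mu>\<in>MX. eventually (\<lambda>i. \<mu> \<in> fst (snd (projr i))) U"
    "\<forall>k. eventually (\<lambda>i. k \<le> snd (snd (projr i))) U"
proof -
  let ?N = "finite_subsets_at_top BX \<times>\<^sub>F (finite_subsets_at_top MX \<times>\<^sub>F (sequentially :: nat filter))"
  let ?F = "filtermap (Inr :: _ \<Rightarrow> 'i + 'a lr_index) ?N"
  have "?F \<noteq> bot" by (simp add: filtermap_bot_iff prod_filter_eq_bot)
  then obtain U where U: "ultra U" "U \<le> ?F" by (rule ultra_exists)
  have Ub: "U \<noteq> bot" using U(1) by (simp add: ultra_def)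
  have prod: "eventually (\<lambda>i. P1 (fst (projr i)) \<and> P2 (fst (snd (projr i))) \<and> P3 (snd (snd (projr i))) \<and> (\<exists>x. i = Inr x)) U"
    if "eventually P1 (finite_subsets_at_top BX)" "eventually P2 (finite_subsets_at_top MX)" "eventually P3 sequentially"
    for P1 P2 P3
  proof (rule filter_leD[OF U(2)], unfold eventually_filtermap eventually_prod_filter, intro exI conjI allI impI)
    show "eventually P1 (finite_subsets_at_top BX)" "eventually P2 (finite_subsets_at_top MX)" "eventually P3 sequentially"
      using that by blast+
    show "P2 F \<Longrightarrow> P3 n \<Longrightarrow> (\<lambda>(F, n). P2 F \<and> P3 n) (F, n)" for F n by simp
  qed auto
  have tr: "eventually (\<lambda>_. True) F" for F :: "'z filter" by simp
  have fin: "eventually (\<lambda>F. finite F \<and> F \<subseteq> A) (finite_subsets_at_top A)" for A :: "'z set"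
    by (rule eventually_finite_subsets_at_top_weakI) simp
  have mem: "eventually (\<lambda>F. z \<in> F) (finite_subsets_at_top A)" if "z \<in> A" for z :: 'z and A
    unfolding eventually_finite_subsets_at_top using that by (intro exI[of _ "{z}"]) auto
  have EI: "eventually (\<lambda>i. i \<in> I) U"
    by (rule eventually_mono[OF prod[OF fin fin tr]]) (auto simp: I)
  have E1: "eventually (\<lambda>i. \<Phi> \<in> fst (projr i)) U" if "\<Phi> \<in> BX" for \<Phi>
    by (rule eventually_mono[OF prod[OF mem[OF that] tr tr]]) blast
  have E2: "eventually (\<lambda>i. \<mu> \<in> fst (snd (projr i))) U" if "\<mu> \<in> MX" for \<mu>
    by (rule eventually_mono[OF prod[OF tr mem[OF that] tr]]) blast
  have E3: "eventually (\<lambda>i. k \<le> snd (snd (projr i))) U" for k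
    by (rule eventually_mono[OF prod[OF tr tr eventually_ge_at_top[of k]]]) blast
  \<comment> \<open>Countably many members of \<open>U\<close> with empty intersection.\<close>
  let ?C = "\<lambda>k. {i :: 'i + 'a lr_index. k \<le> snd (snd (projr i))}"
  have "admissible_ultrafilter I U"
    unfolding admissible_ultrafilter_def
  proof (intro conjI ballI allI)
    show "eventually (\<lambda>i. i \<in> I) U" by (rule EI)
    show "U \<noteq> bot" by (rule Ub)
    show "eventually P U \<or> eventually (\<lambda>i. \<not> P i) U" for P using U(1) unfolding ultra_def by blast
    show "\<not> eventually (\<lambda>i. i = j) U" for j
    proof
      assume "eventually (\<lambda>i. i = j) U"
      with E3[of "Suc (snd (snd (projr j)))"] have "eventually (\<lambda>_. False) U"
        by eventually_elim auto
      then show False using Ub by simp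
    qed
    show "\<exists>\<C>. countable \<C> \<and> (\<forall>S\<in>\<C>. eventually (\<lambda>i. i \<in> S) U) \<and> \<not> eventually (\<lambda>i. i \<in> \<Inter>\<C>) U"
    proof (intro exI[of _ "range ?C"] conjI)
      show "\<forall>S\<in>range ?C. eventually (\<lambda>i. i \<in> S) U" using E3 by auto
      have "\<Inter> (range ?C) = {}"
      proof (rule equals0I)
        fix i assume "i \<in> \<Inter> (range ?C)"
        then have "i \<in> ?C (Suc (snd (snd (projr i))))" by blast
        then show False by simp
      qed
      then show "\<not> eventually (\<lambda>i. i \<in> \<Inter> (range ?C)) U" using Ub by (simp only:) simp
    qed simp
  qed
  then show ?thesis using E1 E2 E3 by (intro that[of U]) blast+
qed


text \<open>The formula already fails for a square, at the functional with nonzero jump. The index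
  set lies in the second summand of the index type and is therefore available for every
  \<open>'i\<close>.\<close>

lemma not_scattered_imp_counterexample:
  assumes X: "\<not> scattered_space X"
  shows "\<exists>(I :: ('i + 'a lr_index) set) U K.
       admissible_ultrafilter I U \<and>
       bounded_linear_map (bidual (C0 X)) (ultrapower (C0 X) I U) K \<and>
       (\<forall>\<Phi>\<in>BX. ultra_sigma (C0 X) I U (K \<Phi>) = \<Phi>) \<and>
       (\<forall>a\<in>CX. K (canonical_embedding (C0 X) a) = ultra_const (C0 X) I U a) \<and>
       (\<exists>\<Phi>\<in>BX. ultra_sigma (C0 X) I U (ultra_mult (C0 X) I U (K \<Phi>) (K \<Phi>)) \<noteq> arens (C0 X) \<Phi> \<Phi>)"
proof -
  obtain P where P: "P \<subseteq> topspace X" "P \<noteq> {}" "\<forall>p\<in>P. \<not> openin (subtopology X P) {p}"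
    using X unfolding scattered_space_def by blast
  then obtain t where tP: "t \<in> P" by blast
  have t: "t \<in> topspace X" using tP P(1) by blast
  have "\<not> openin X {t}"
  proof
    assume "openin X {t}"
    moreover have "{t} = {t} \<inter> P" using tP by blast
    ultimately have "openin (subtopology X P) {t}" unfolding openin_subtopology by blast
    then show False using P(3) tP by blast
  qed
  then obtain \<theta> :: "((('a \<Rightarrow> complex) \<Rightarrow> complex) \<Rightarrow> complex) \<Rightarrow> complex" and \<Phi>0
    where \<Phi>0: "\<Phi>0 \<in> BX" and \<theta>0: "\<theta> \<Phi>0 = -1"
    and \<theta>_add: "\<forall>\<Phi>\<in>BX. \<forall>\<Psi>\<in>BX. \<theta> (vadd (bidual (C0 X)) \<Phi> \<Psi>) = \<theta> \<Phi> + \<theta> \<Psi>"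
    and \<theta>_scale: "\<forall>\<Phi>\<in>BX. \<forall>c. \<theta> (vscale (bidual (C0 X)) c \<Phi>) = c * \<theta> \<Phi>"
    and \<theta>_bound: "\<forall>\<Phi>\<in>BX. cmod (\<theta> \<Phi>) \<le> 2 * bnorm \<Phi>"
    and \<theta>_can: "\<forall>a\<in>CX. \<theta> (canonical_embedding (C0 X) a) = 0"
    by (rule exists_jump_functional[OF t])
  obtain \<mu>0 and g :: "bool list \<Rightarrow> 'a \<Rightarrow> real" where \<mu>0: "\<mu>0 \<in> MX"
    and g1: "\<forall>s. c0 (\<lambda>x. complex_of_real (g s x))" and g2: "\<forall>s. \<forall>x\<in>topspace X. 0 \<le> g s x \<and> g s x \<le> 1"
    and g3: "\<forall>s t. \<forall>x\<in>topspace X. length s = length t \<and> s \<noteq> t \<longrightarrow> g s x * g t x = 0"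
    and g4: "\<forall>s. 1 / 2 ^ length s \<le> Re (ev \<mu>0 (\<lambda>x. of_real (g s x * g s x)))"
    by (rule Cantor_scheme[OF X])
  define I :: "('i + 'a lr_index) set" where "I = Inr ` {(F, G, n). finite F \<and> finite G \<and> G \<subseteq> MX}"
  obtain U where U: "admissible_ultrafilter I U"
    and U1: "\<forall>\<Phi>\<in>BX. eventually (\<lambda>i. \<Phi> \<in> fst (projr i)) U"
    and U2: "\<forall>\<mu>\<in>MX. eventually (\<lambda>i. \<mu> \<in> fst (snd (projr i))) U"
    and U3: "\<forall>k. eventually (\<lambda>i. k \<le> snd (snd (projr i))) U"
    by (rule lr_ultrafilter[OF I_def])
  interpret ultra: C0_ultrapower X I U
    by unfold_locales (rule U)
  define \<epsilon> where "\<epsilon> = (\<lambda>i :: 'i + 'a lr_index. 1 / (real (snd (snd (projr i))) + 1))"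
  define H where "H = (\<lambda>i :: 'i + 'a lr_index. {a \<in> CX. canonical_embedding (C0 X) a \<in> fst (projr i)})"
  define G where "G = (\<lambda>i :: 'i + 'a lr_index. fst (snd (projr i)))"
  have \<epsilon>: "\<epsilon> i > 0" for i by (simp add: \<epsilon>_def add_nonneg_pos)
  have H: "finite (H i)" "H i \<subseteq> CX" if "i \<in> I" for i
  proof -
    have "finite (fst (projr i))" using that by (auto simp: I_def)
    moreover have "canonical_embedding (C0 X) ` H i \<subseteq> fst (projr i)" by (auto simp: H_def)
    ultimately have "finite (canonical_embedding (C0 X) ` H i)" by (rule finite_subset[rotated])
    moreover show "H i \<subseteq> CX" by (auto simp: H_def)
    ultimately show "finite (H i)" using inj_on_subset[OF canonical_inj] by (blast dest: finite_imageD)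
  qed
  have G: "finite (G i)" "G i \<subseteq> MX" if "i \<in> I" for i using that by (auto simp: I_def G_def)
  have small: "eventually (\<lambda>i. \<epsilon> i < e) U" if "e > 0" for e
  proof -
    obtain k where k: "1 / e < real k" using reals_Archimedean2 by blast
    from U3[rule_format, of k] show ?thesis
    proof eventually_elim
      case (elim i)
      then have "1 / e < real (snd (snd (projr i))) + 1" using k by linarith
      then show ?case using that by (simp add: \<epsilon>_def field_simps)
    qed
  qed
  define Q where "Q = (\<lambda>i T. (\<forall>\<Phi>\<in>BX. c0 (T \<Phi>)) \<and>
    (\<forall>\<Phi>\<in>BX. \<forall>\<Psi>\<in>BX. \<forall>t. T (vadd (bidual (C0 X)) \<Phi> \<Psi>) t = T \<Phi> t + T \<Psi> t) \<and>
    (\<forall>\<Phi>\<in>BX. \<forall>c t. T (vscale (bidual (C0 X)) c \<Phi>) t = c * T \<Phi> t) \<and>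
    (\<forall>\<Phi>\<in>BX. \<forall>t\<in>topspace X. cmod (T \<Phi> t) \<le> 2 * bnorm \<Phi>) \<and>
    (\<forall>a\<in>H i. \<forall>t\<in>topspace X. cmod (T (canonical_embedding (C0 X) a) t - a t) \<le> \<epsilon> i) \<and>
    (\<forall>\<mu>\<in>G i. \<forall>\<Phi>\<in>BX. cmod (ev \<mu> (T \<Phi>) - \<Phi> \<mu>) \<le> bnorm \<Phi> * \<epsilon> i))"
  have "\<exists>T. Q i T" if "i \<in> I" for i
    unfolding Q_def by (rule approximating_operator[OF H[OF that] G[OF that] \<epsilon>])
  then obtain T where T: "\<And>i. i \<in> I \<Longrightarrow> Q i (T i)" by metis
  define R where "R = (\<lambda>i r. unit_ball (\<lambda>x. complex_of_real (r x)) \<and>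
    (\<forall>\<mu>\<in>G i. cmod (ev \<mu> (\<lambda>x. of_real (r x))) \<le> \<epsilon> i) \<and> 1 / 2 \<le> Re (ev \<mu>0 (\<lambda>x. of_real (r x * r x))))"
  have "\<exists>r. R i r" if "i \<in> I" for i
    unfolding R_def by (rule weakly_null_element[OF \<mu>0 g1 g2 g3 g4 G[OF that] \<epsilon>])
  then obtain r where r: "\<And>i. i \<in> I \<Longrightarrow> R i (r i)" by metis
  let ?r = "\<lambda>i t. complex_of_real (r i t)"
  define S where "S = (\<lambda>s i \<Phi> t. T i \<Phi> t + s * \<theta> \<Phi> * ?r i t)"
  have Tc: "c0 (T i \<Phi>)" and Tb: "\<forall>t\<in>topspace X. cmod (T i \<Phi> t) \<le> 2 * bnorm \<Phi>"
    if "i \<in> I" "\<Phi> \<in> BX" for i \<Phi> using T[OF that(1)] that(2) unfolding Q_def by blast+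
  have rc: "c0 (?r i)" and rb: "\<forall>t\<in>topspace X. cmod (?r i t) \<le> 1" if "i \<in> I" for i
    using r[OF that] unfolding R_def unit_ball_def by blast+
  have Sc: "c0 (S s i \<Phi>)" if "i \<in> I" "\<Phi> \<in> BX" for s i \<Phi>
    unfolding S_def by (intro c0_add Tc c0_scale rc that)
  have evS: "ev \<mu> (S s i \<Phi>) = ev \<mu> (T i \<Phi>) + s * \<theta> \<Phi> * ev \<mu> (?r i)" if "i \<in> I" "\<Phi> \<in> BX" "\<mu> \<in> MX" for s i \<Phi> \<mu>
    unfolding S_def ev_add[OF that(3) Tc[OF that(1,2)] c0_scale[OF rc[OF that(1)]]]
      ev_scale[OF that(3) rc[OF that(1)]] ..
  have lift: "(\<forall>\<Phi>\<in>BX. ultra.fam (\<lambda>i. S s i \<Phi>) \<in> ultra.LX) \<and>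
    bounded_linear_map (bidual (C0 X)) (ultrapower (C0 X) I U) (\<lambda>\<Phi>. ultra.cls (ultra.fam (\<lambda>i. S s i \<Phi>))) \<and>
    (\<forall>\<Phi>\<in>BX. ultra_sigma (C0 X) I U (ultra.cls (ultra.fam (\<lambda>i. S s i \<Phi>))) = \<Phi>) \<and>
    (\<forall>a\<in>CX. ultra.cls (ultra.fam (\<lambda>i. S s i (canonical_embedding (C0 X) a))) = ultra_const (C0 X) I U a)" for s
  proof -
    \<comment> \<open>The 2 bounds \<open>T i\<close>; the rest comes from
      \<open>\<theta>_bound\<close> and the bound 1 on \<open>r i\<close>.\<close>
    let ?B = "2 + 2 * cmod s"
    have 1: "S s i (vadd (bidual (C0 X)) \<Phi> \<Psi>) t = S s i \<Phi> t + S s i \<Psi> t"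
      if "i \<in> I" "\<Phi> \<in> BX" "\<Psi> \<in> BX" "t \<in> topspace X" for i \<Phi> \<Psi> t
    proof -
      have "T i (vadd (bidual (C0 X)) \<Phi> \<Psi>) t = T i \<Phi> t + T i \<Psi> t"
        using T[OF that(1)] that(2,3) unfolding Q_def by blast
      moreover have "\<theta> (vadd (bidual (C0 X)) \<Phi> \<Psi>) = \<theta> \<Phi> + \<theta> \<Psi>" using \<theta>_add that(2,3) by blast
      ultimately show ?thesis unfolding S_def by (simp only:) (simp add: algebra_simps)
    qed
    have 2: "S s i (vscale (bidual (C0 X)) d \<Phi>) t = d * S s i \<Phi> t"
      if "i \<in> I" "\<Phi> \<in> BX" "t \<in> topspace X" for i \<Phi> d t
    proof -
      have "T i (vscale (bidual (C0 X)) d \<Phi>) t = d * T i \<Phi> t"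
        using T[OF that(1)] that(2) unfolding Q_def by blast
      moreover have "\<theta> (vscale (bidual (C0 X)) d \<Phi>) = d * \<theta> \<Phi>" using \<theta>_scale that(2) by blast
      ultimately show ?thesis unfolding S_def by (simp only:) (simp add: algebra_simps)
    qed
    have 3: "cmod (S s i \<Phi> t) \<le> ?B * bnorm \<Phi>" if "i \<in> I" "\<Phi> \<in> BX" "t \<in> topspace X" for i \<Phi> t
    proof -
      have nn: "bnorm \<Phi> \<ge> 0" by (rule bnorm_nonneg[OF that(2)])
      have "cmod (S s i \<Phi> t) \<le> cmod (T i \<Phi> t) + cmod (s * \<theta> \<Phi> * ?r i t)"
        unfolding S_def by (rule norm_triangle_ineq)
      also have "cmod (s * \<theta> \<Phi> * ?r i t) \<le> cmod s * (2 * bnorm \<Phi>) * 1"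
        unfolding norm_mult[of "s * _"] norm_mult[of s]
        using \<theta>_bound that rb[OF that(1)] nn by (intro mult_mono mult_left_mono mult_nonneg_nonneg) auto
      finally show ?thesis using Tb[OF that(1,2)] that(3) by (auto simp: algebra_simps)
    qed
    have 4: "((\<lambda>i. ev \<mu> (S s i \<Phi>)) \<longlongrightarrow> \<Phi> \<mu>) U" if \<Phi>: "\<Phi> \<in> BX" and \<mu>: "\<mu> \<in> MX" for \<Phi> \<mu>
      unfolding tendsto_iff
    proof (intro allI impI)
      fix e :: real assume e: "e > 0"
      let ?C = "bnorm \<Phi> + cmod (s * \<theta> \<Phi>) + 1"
      have C: "?C > 0" using bnorm_nonneg[OF \<Phi>] by (intro add_nonneg_pos add_nonneg_nonneg) auto
      then have "e / ?C > 0" using e by simp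
      from small[OF this] U2[rule_format, OF \<mu>] ultra.eventually_I
      show "eventually (\<lambda>i. dist (ev \<mu> (S s i \<Phi>)) (\<Phi> \<mu>) < e) U"
      proof eventually_elim
        case (elim i)
        have \<mu>G: "\<mu> \<in> G i" using elim(2) by (simp add: G_def)
        have a: "cmod (ev \<mu> (T i \<Phi>) - \<Phi> \<mu>) \<le> bnorm \<Phi> * \<epsilon> i"
          using T[OF elim(3)] \<mu>G \<Phi> unfolding Q_def by blast
        have b: "cmod (ev \<mu> (?r i)) \<le> \<epsilon> i" using r[OF elim(3)] \<mu>G unfolding R_def by blast
        have "ev \<mu> (S s i \<Phi>) - \<Phi> \<mu> = (ev \<mu> (T i \<Phi>) - \<Phi> \<mu>) + s * \<theta> \<Phi> * ev \<mu> (?r i)"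
          unfolding evS[OF elim(3) \<Phi> \<mu>] by simp
        also have "cmod \<dots> \<le> bnorm \<Phi> * \<epsilon> i + cmod (s * \<theta> \<Phi>) * \<epsilon> i"
          by (rule norm_triangle_mono[OF a]) (use b in \<open>simp only: norm_mult[of "s * _"] mult_left_mono norm_ge_zero\<close>)
        also have "\<dots> \<le> ?C * \<epsilon> i" using \<epsilon>[of i] by (simp add: distrib_right)
        also have "\<dots> < ?C * (e / ?C)" using elim(1) C by (intro mult_strict_left_mono)
        also have "\<dots> = e" using C by simp
        finally show ?case by (simp only: dist_norm)
      qed
    qed
    have 5: "eventually (\<lambda>i. \<forall>t\<in>topspace X. cmod (S s i (canonical_embedding (C0 X) a) t - a t) \<le> e) U"
      if a: "a \<in> CX" and e: "e > 0" for a e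
      using small[OF e] U1[rule_format, OF canonical_BX[OF a]] ultra.eventually_I
    proof eventually_elim
      case (elim i)
      have aH: "a \<in> H i" using elim(2) a by (simp add: H_def)
      show ?case
      proof
        fix t assume "t \<in> topspace X"
        then have "cmod (T i (canonical_embedding (C0 X) a) t - a t) \<le> \<epsilon> i"
          using T[OF elim(3)] aH unfolding Q_def by blast
        moreover have "S s i (canonical_embedding (C0 X) a) t = T i (canonical_embedding (C0 X) a) t"
          unfolding S_def using \<theta>_can a by simp
        ultimately show "cmod (S s i (canonical_embedding (C0 X) a) t - a t) \<le> e"
          using elim(1) by simp
      qed
    qed
    have B0: "?B \<ge> 0" by simp
    note L = ultra.lifting_of_approximations[where T = "S s" and B = ?B, OF Sc 1 2 3 B0 4 5]
    show ?thesis by (intro conjI ballI L)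
  qed
  show ?thesis
  proof (rule ccontr)
    assume "\<not> ?thesis"
    then have no: "ultra_sigma (C0 X) I U (ultra_mult (C0 X) I U (K \<Phi>0) (K \<Phi>0)) = arens (C0 X) \<Phi>0 \<Phi>0"
      if "bounded_linear_map (bidual (C0 X)) (ultrapower (C0 X) I U) K"
        "\<forall>\<Phi>\<in>BX. ultra_sigma (C0 X) I U (K \<Phi>) = \<Phi>"
        "\<forall>a\<in>CX. K (canonical_embedding (C0 X) a) = ultra_const (C0 X) I U a" for K
      using U that \<Phi>0 by blast
    define \<alpha> where "\<alpha> = arens (C0 X) \<Phi>0 \<Phi>0 \<mu>0"
    define u where "u = (\<lambda>i. T i \<Phi>0)"
    define p where "p = (\<lambda>s i. ev \<mu>0 (\<lambda>t. S s i \<Phi>0 t * S s i \<Phi>0 t))"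
    \<comment> \<open>If no lifting fails, the limit is the same for all \<open>s\<close>, because
      the Arens square does not depend on the lifting.\<close>
    have lim: "(p s \<longlongrightarrow> \<alpha>) U" for s
    proof -
      let ?x = "ultra.fam (\<lambda>i. S s i \<Phi>0)"
      have x: "?x \<in> ultra.LX" using lift[of s] \<Phi>0 by blast
      have "ultra_sigma (C0 X) I U (ultra_mult (C0 X) I U (ultra.cls ?x) (ultra.cls ?x)) = arens (C0 X) \<Phi>0 \<Phi>0"
        using lift[of s] by (intro no) blast+
      then have "ultra_sigma (C0 X) I U (ultra.cls (ultra.fam (\<lambda>i t. ?x i t * ?x i t))) \<mu>0 = \<alpha>"
        unfolding ultra.cls_mult[OF x x] \<alpha>_def by (simp only:)
      then have "((\<lambda>i. ev \<mu>0 (ultra.fam (\<lambda>i t. ?x i t * ?x i t) i)) \<longlongrightarrow> \<alpha>) U"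
        using ultra.ev_tendsto_sigma[OF ultra.LX_mult[OF x x] \<mu>0] by (simp only:)
      moreover have "eventually (\<lambda>i. ev \<mu>0 (ultra.fam (\<lambda>i t. ?x i t * ?x i t) i) = p s i) U"
        using ultra.eventually_I by eventually_elim (simp add: ultra.ev_fam p_def cong: ev_cong)
      ultimately show ?thesis by (rule Lim_transform_eventually)
    qed
    have "((\<lambda>i. p 1 i + p (-1) i - 2 * p 0 i) \<longlongrightarrow> \<alpha> + \<alpha> - 2 * \<alpha>) U"
      by (intro tendsto_diff tendsto_add tendsto_mult tendsto_const lim)
    moreover have "eventually (\<lambda>i. p 1 i + p (-1) i - 2 * p 0 i = 2 * ev \<mu>0 (\<lambda>t. ?r i t * ?r i t)) U"
      using ultra.eventually_I
    proof eventually_elim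
      case (elim i)
      have uc: "c0 (u i)" unfolding u_def by (rule Tc[OF elim \<Phi>0])
      note c = c0_mult[OF uc uc] c0_mult[OF uc rc[OF elim]] c0_mult[OF rc[OF elim] rc[OF elim]]
      \<comment> \<open>The cross term is linear in \<open>s\<close> and cancels between 1 and -1;
        the term without \<open>s\<close> is removed by \<open>2 * p 0 i\<close>.\<close>
      have "p s i = ev \<mu>0 (\<lambda>t. u i t * u i t) - 2 * s * ev \<mu>0 (\<lambda>t. u i t * ?r i t) + s * s * ev \<mu>0 (\<lambda>t. ?r i t * ?r i t)" for s
      proof -
        have "p s i = ev \<mu>0 (\<lambda>t. u i t * u i t - 2 * s * (u i t * ?r i t) + s * s * (?r i t * ?r i t))"
          unfolding p_def S_def \<theta>0 u_def by (rule ev_cong) (simp add: algebra_simps)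
        then show ?thesis
          by (simp only: ev_add[OF \<mu>0 c0_diff[OF c(1) c0_scale[OF c(2)]] c0_scale[OF c(3)]]
              ev_diff[OF \<mu>0 c(1) c0_scale[OF c(2)]] ev_scale[OF \<mu>0 c(2)] ev_scale[OF \<mu>0 c(3)])
      qed
      then show ?case by simp
    qed
    ultimately have "((\<lambda>i. 2 * ev \<mu>0 (\<lambda>t. ?r i t * ?r i t)) \<longlongrightarrow> \<alpha> + \<alpha> - 2 * \<alpha>) U"
      by (rule Lim_transform_eventually)
    then have "((\<lambda>i. Re (2 * ev \<mu>0 (\<lambda>t. ?r i t * ?r i t))) \<longlongrightarrow> Re (\<alpha> + \<alpha> - 2 * \<alpha>)) U"
      by (rule tendsto_Re)
    moreover have "eventually (\<lambda>i. 1 \<le> Re (2 * ev \<mu>0 (\<lambda>t. ?r i t * ?r i t))) U"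
      using ultra.eventually_I
    proof eventually_elim
      case (elim i)
      have "1 / 2 \<le> Re (ev \<mu>0 (\<lambda>x. ?r i x * ?r i x))"
        using r[OF elim] unfolding R_def of_real_mult by blast
      then show ?case by simp
    qed
    \<comment> \<open>The limit is 0, although each term is at least 1 by the mass that \<mu>0 gives
      to the square of \<open>r i\<close>.\<close>
    ultimately have "1 \<le> Re (\<alpha> + \<alpha> - 2 * \<alpha>)"
      by (rule tendsto_lowerbound[OF _ _ ultra.U_not_bot])
    then show False by simp
  qed
qed

end

theorem theorem6p7:
  fixes X :: "'a topology"
  assumes "locally_compact_space X" and "Hausdorff_space X"
  shows "scattered_space X \<longleftrightarrow>
    (\<forall>(I :: ('i + 'a lr_index) set) U K.
       admissible_ultrafilter I U \<and>
       bounded_linear_map (bidual (C0 X)) (ultrapower (C0 X) I U) K \<and>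
       (\<forall>\<Phi>\<in>vecs (bidual (C0 X)). ultra_sigma (C0 X) I U (K \<Phi>) = \<Phi>) \<and>
       (\<forall>a\<in>vecs (C0 X). K (canonical_embedding (C0 X) a) = ultra_const (C0 X) I U a) \<longrightarrow>
       (\<forall>\<Phi>\<in>vecs (bidual (C0 X)). \<forall>\<Psi>\<in>vecs (bidual (C0 X)).
          ultra_sigma (C0 X) I U (ultra_mult (C0 X) I U (K \<Phi>) (K \<Psi>)) = arens (C0 X) \<Phi> \<Psi>))"
    (is "?lhs = ?rhs")
proof
  interpret lch_space X by unfold_locales fact+
  show ?rhs if ?lhs
  proof (intro allI impI ballI, elim conjE)
    fix I :: "('i + 'a lr_index) set" and U K \<Phi> \<Psi>
    assume U: "admissible_ultrafilter I U"
      and K: "bounded_linear_map (bidual (C0 X)) (ultrapower (C0 X) I U) K"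
      and sigma: "\<forall>\<Phi>\<in>BX. ultra_sigma (C0 X) I U (K \<Phi>) = \<Phi>"
      and \<Phi>: "\<Phi> \<in> BX" and \<Psi>: "\<Psi> \<in> BX"
    interpret ultra: C0_ultrapower X I U by unfold_locales (rule U)
    have "K \<Phi> \<in> vecs (ultrapower (C0 X) I U)" "K \<Psi> \<in> vecs (ultrapower (C0 X) I U)"
      using K \<Phi> \<Psi> unfolding bounded_linear_map_def by blast+
    then obtain x y where x: "x \<in> ultra.LX" "K \<Phi> = ultra.cls x" and y: "y \<in> ultra.LX" "K \<Psi> = ultra.cls y"
      by (metis ultra.ultrapowerE)
    have sx: "ultra_sigma (C0 X) I U (ultra.cls x) = \<Phi>" using sigma \<Phi> x(2) by metis
    have sy: "ultra_sigma (C0 X) I U (ultra.cls y) = \<Psi>" using sigma \<Psi> y(2) by metis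
    show "ultra_sigma (C0 X) I U (ultra_mult (C0 X) I U (K \<Phi>) (K \<Psi>)) = arens (C0 X) \<Phi> \<Psi>"
      using ultra.scattered_imp_product[OF that x(1) y(1)] \<Phi> \<Psi> unfolding sx sy x(2) y(2) by blast
  qed
  show ?lhs if ?rhs
  proof (rule ccontr)
    assume "\<not> scattered_space X"
    \<comment> \<open>The type \<open>'i\<close> does not occur in the premise, so it is fixed by
      hand to the index type of the statement.\<close>
    from not_scattered_imp_counterexample[OF this, where 'i = 'i] that show False by blast
  qed
qed

end
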